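(* There exist $\mu>0$ (sufficiently large), $\delta_0>0$ and $C>0$, independent of $k$ and $h$, such that for every time mesh with $k-k_{\min}\le\delta_0$ and every conformal triangulation $\mathcal T$ of $\Omega$ the following holds. Let $f\in L^\infty(I;L^2(\Omega))$, let $u_0\in H^1_0(\Omega)$ with $A_{k,m}u_0\in L^2(\Omega)$ for all $m=1,2,\dots,M$, and let $u_{kh}\in X^{0,r}_{k,h}$ be the fully discrete solution with data $f,u_0$. Then $$\sum_{m=1}^M\left(k_m\|A_{kh,m}u_{kh,m}\|_{L^2(\Omega)}+\|[u_{kh}]_{m-1}\|_{L^2(\Omega)}\right)\le Ce^{\mu T}\ln\frac{T}{k}\left(\|f\|_{L^1(I;L^2(\Omega))}+\|u_0\|_{L^2(\Omega)}\right).$$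
   Context: Problem data. $\Omega\subset\mathbb R^d$, $d\ge1$, is a bounded polygonal/polyhedral Lipschitz domain, $T>0$, $I=(0,T)$. The coefficients $a_{ij}\in L^\infty(I\times\Omega)$ ($1\le i,j\le d$) satisfy $a_{ij}=a_{ji}$ and $\sum_{i,j}a_{ij}(t,x)\xi_i\xi_j\ge\alpha|\xi|^2$ for all $\xi\in\mathbb R^d$ and a.e. $(t,x)$, with a constant $\alpha>0$; they are continuous in $t$ for almost all $x$, and $|a_{ij}(t_1,x)-a_{ij}(t_2,x)|\le\omega(|t_1-t_2|)$ for all $t_1,t_2\in\bar I$ and almost all $x\in\Omega$, where $\omega:[0,T]\to[0,\infty)$ is nondecreasing, $\omega(t)/t^{3/2}$ is non-increasing on $(0,T]$, and $\int_0^T\omega(t)t^{-3/2}\,dt<\infty$. For $u,v\in H^1_0(\Omega)$ set $a(t;u,v)=\int_\Omega\sum_{i,j}a_{ij}(t,x)\partial_iu\,\partial_jv\,dx$, and let $A(t):H^1_0(\Omega)\to H^{-1}(\Omega)$ be defined by $\langle A(t)u,v\rangle=a(t;u,v)$. Time meshes. $0=t_0<t_1<\dots<t_M=T$, $I_m=(t_{m-1},t_m]$, $k_m=t_m-t_{m-1}$, $k=\max_mk_m$, $k_{\min}=\min_mk_m$. All meshes satisfy, with fixed constants $c,\beta,\kappa>0$: (i) $k_{\min}\ge ck^\beta$; (ii) $\kappa^{-1}\le k_m/k_{m+1}\le\kappa$ for $1\le m\le M-1$; (iii) $k\le T/4$. Set $A_{k,m}=\frac1{k_m}\int_{I_m}A(t)\,dt:H^1_0(\Omega)\to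 H^{-1}(\Omega)$ for $m=1,\dots,M$. Space discretization. $\mathcal T=\{\tau\}$ is a conformal (no hanging nodes) partition of $\Omega$ into simplices, $h$ the maximal diameter; no shape regularity or quasi-uniformity is assumed. $V_h$ is the set of functions in $H^1_0(\Omega)$ that are polynomials of degree $r\ge1$ on each $\tau$. $P_h:L^2(\Omega)\to V_h$ is the $L^2$-orthogonal projection. $A_h(t):V_h\to V_h$ is defined by $(A_h(t)v_h,\chi)_\Omega=a(t;v_h,\chi)$ for all $\chi\in V_h$, and $A_{kh,m}=\frac1{k_m}\int_{I_m}A_h(t)\,dt:V_h\to V_h$. Full discretization. $X^{0,r}_{k,h}$ is the space of functions on $I$ with values in $V_h$ that are constant in time on each $I_m$; $v_{kh,m}:=v_{kh}|_{I_m}$. The fully discrete solution $u_{kh}\in X^{0,r}_{k,h}$ with data $f,u_0$ is defined by $$\int_Ia(t;u_{kh},\varphi_{kh})\,dt+\sum_{m=2}^M(u_{kh,m}-u_{kh,m-1},\varphi_{kh,m})_\Omega+(u_{kh,1},\varphi_{kh,1})_\Omega=\int_I(f,\varphi_{kh})_\Omega\,dt+(u_0,\varphi_{kh,1})_\Omega\quad\forall\varphi_{kh}\in X^{0,r}_{k,h}.$$ Jumps: $[u_{kh}]_m=u_{kh,m+1}-u_{kh,m}$ for $1\le m\le M-1$, and $[u_{kh}]_0=u_{kh,1}-P_hu_0$. "Independent of $k$ and $h$" means: depending only on $\Omega,d,T$, the coefficients $a_{ij}$ (including $\alpha,\omega$) and $c,\beta,\kappa$, and not otherwise on the time mesh,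 nor on the triangulation, $f,u_0$. *)

theory Defs
  imports "HOL-Analysis.Analysis"
begin

section \<open>Domains\<close>

text \<open>Locally, after a rotation, the domain is the strict epigraph of a Lipschitz function.
  The rotation is encoded by the unit vector \<open>e\<close> of the vertical axis; \<open>g\<close> is evaluated only at
  points of the hyperplane orthogonal to \<open>e\<close>, where \<open>x - (x \<bullet> e) *\<^sub>R e\<close> is the projection of \<open>x\<close>.\<close>

definition lipschitz_boundary :: "(real^'d) set \<Rightarrow> bool" where
  "lipschitz_boundary \<Omega> \<longleftrightarrow>
     (\<forall>p \<in> frontier \<Omega>. \<exists>e \<rho> L. \<exists>g :: real^'d \<Rightarrow> real.
        norm e = 1 \<and> \<rho> > 0 \<and> L-lipschitz_on {y. y \<bullet> e = 0} g \<and>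
        \<Omega> \<inter> ball p \<rho> = {x \<in> ball p \<rho>. x \<bullet> e > g (x - (x \<bullet> e) *\<^sub>R e)})"

definition polyhedral_lipschitz_domain :: "(real^'d) set \<Rightarrow> bool" where
  "polyhedral_lipschitz_domain \<Omega> \<longleftrightarrow>
     open \<Omega> \<and> connected \<Omega> \<and> \<Omega> \<noteq> {} \<and> bounded \<Omega> \<and>
     (\<exists>\<P>. finite \<P> \<and> (\<forall>P \<in> \<P>. polytope P) \<and> closure \<Omega> = \<Union>\<P>) \<and>
     lipschitz_boundary \<Omega>"

section \<open>Lebesgue and Sobolev spaces\<close>

text \<open>Elements of \<open>L\<^sup>2(\<Omega>)\<close> and its subspaces are represented by functions on the whole space, of
  which only the values on \<open>\<Omega>\<close> matter, up to null sets. \<open>L2_norm\<close> is meaningful only on \<open>L2 \<Omega>\<close>,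
  as the integral of a nonintegrable function is 0.\<close>

definition L2 :: "(real^'d) set \<Rightarrow> (real^'d \<Rightarrow> real) set" where
  "L2 \<Omega> = {u \<in> borel_measurable (lebesgue_on \<Omega>). integrable (lebesgue_on \<Omega>) (\<lambda>x. (u x)\<^sup>2)}"

definition L2_inner :: "(real^'d) set \<Rightarrow> (real^'d \<Rightarrow> real) \<Rightarrow> (real^'d \<Rightarrow> real) \<Rightarrow> real" where
  "L2_inner \<Omega> u v = (\<integral>x. u x * v x \<partial>lebesgue_on \<Omega>)"

definition L2_norm :: "(real^'d) set \<Rightarrow> (real^'d \<Rightarrow> real) \<Rightarrow> real" where
  "L2_norm \<Omega> u = sqrt (L2_inner \<Omega> u u)"

primrec Ck_fun :: "nat \<Rightarrow> (real^'d \<Rightarrow> real) \<Rightarrow> bool" where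
  "Ck_fun 0 f \<longleftrightarrow> continuous_on UNIV f"
| "Ck_fun (Suc n) f \<longleftrightarrow> (\<exists>g. (\<forall>x. GDERIV f x :> g x) \<and> (\<forall>i. Ck_fun n (\<lambda>x. g x $ i)))"

definition test_fun :: "(real^'d) set \<Rightarrow> (real^'d \<Rightarrow> real) set" where
  "test_fun \<Omega> = {\<phi>. (\<forall>n. Ck_fun n \<phi>) \<and>
     compact (closure {x. \<phi> x \<noteq> 0}) \<and> closure {x. \<phi> x \<noteq> 0} \<subseteq> \<Omega>}"

definition has_weak_gradient ::
    "(real^'d) set \<Rightarrow> (real^'d \<Rightarrow> real) \<Rightarrow> (real^'d \<Rightarrow> real^'d) \<Rightarrow> bool" where
  "has_weak_gradient \<Omega> u g \<longleftrightarrow>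
     (\<forall>i. (\<lambda>x. g x $ i) \<in> L2 \<Omega>) \<and>
     (\<forall>\<phi> \<in> test_fun \<Omega>. \<forall>i.
        (\<integral>x. u x * frechet_derivative \<phi> (at x) (axis i 1) \<partial>lebesgue_on \<Omega>) =
        - (\<integral>x. g x $ i * \<phi> x \<partial>lebesgue_on \<Omega>))"

definition H1 :: "(real^'d) set \<Rightarrow> (real^'d \<Rightarrow> real) set" where
  "H1 \<Omega> = {u \<in> L2 \<Omega>. \<exists>g. has_weak_gradient \<Omega> u g}"

text \<open>Weak gradients are unique up to null sets, so the choice does not affect any integral.\<close>

definition weak_grad :: "(real^'d) set \<Rightarrow> (real^'d \<Rightarrow> real) \<Rightarrow> real^'d \<Rightarrow> real^'d" where
  "weak_grad \<Omega> u = (SOME g. has_weak_gradient \<Omega> u g)"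

definition H1_norm :: "(real^'d) set \<Rightarrow> (real^'d \<Rightarrow> real) \<Rightarrow> real" where
  "H1_norm \<Omega> u =
     sqrt ((L2_norm \<Omega> u)\<^sup>2 + (\<Sum>i\<in>UNIV. (L2_norm \<Omega> (\<lambda>x. weak_grad \<Omega> u x $ i))\<^sup>2))"

definition H10 :: "(real^'d) set \<Rightarrow> (real^'d \<Rightarrow> real) set" where
  "H10 \<Omega> = {u \<in> H1 \<Omega>. \<forall>\<epsilon>>0. \<exists>\<phi> \<in> test_fun \<Omega>. H1_norm \<Omega> (\<lambda>x. u x - \<phi> x) < \<epsilon>}"

text \<open>Bochner spaces \<open>L\<^sup>\<infinity>(J; L\<^sup>2(\<Omega>))\<close>, with strong measurability stated through simple functions.\<close>

definition simple_fun_L2 :: "(real^'d) set \<Rightarrow> real set \<Rightarrow> (real \<Rightarrow> real^'d \<Rightarrow> real) \<Rightarrow> bool" where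
  "simple_fun_L2 \<Omega> J s \<longleftrightarrow>
     finite (s ` J) \<and> (\<forall>w \<in> s ` J. w \<in> L2 \<Omega> \<and> {t \<in> J. s t = w} \<in> sets lebesgue)"

definition Linf_L2 :: "(real^'d) set \<Rightarrow> real set \<Rightarrow> (real \<Rightarrow> real^'d \<Rightarrow> real) set" where
  "Linf_L2 \<Omega> J = {f.
     (AE t in lebesgue_on J. f t \<in> L2 \<Omega>) \<and>
     (\<exists>s. (\<forall>n. simple_fun_L2 \<Omega> J (s n)) \<and>
        (AE t in lebesgue_on J. (\<lambda>n::nat. L2_norm \<Omega> (\<lambda>x. s n t x - f t x)) \<longlonglongrightarrow> 0)) \<and>
     (\<exists>B. AE t in lebesgue_on J. L2_norm \<Omega> (f t) \<le> B)}"

definition L1_L2_norm :: "(real^'d) set \<Rightarrow> real set \<Rightarrow> (real \<Rightarrow> real^'d \<Rightarrow> real) \<Rightarrow> real" where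
  "L1_L2_norm \<Omega> J f = (\<integral>t. L2_norm \<Omega> (f t) \<partial>lebesgue_on J)"

section \<open>The elliptic operators\<close>

definition dini_modulus :: "real \<Rightarrow> (real \<Rightarrow> real) \<Rightarrow> bool" where
  "dini_modulus T \<omega> \<longleftrightarrow>
     (\<forall>t \<in> {0..T}. \<omega> t \<ge> 0) \<and> mono_on {0..T} \<omega> \<and>
     monotone_on {0<..T} (\<le>) (\<ge>) (\<lambda>t. \<omega> t / t powr (3/2)) \<and>
     integrable (lebesgue_on {0<..<T}) (\<lambda>t. \<omega> t * t powr (- (3/2)))"

text \<open>The coefficients are given by pointwise representatives on \<open>[0,T] \<times> \<Omega>\<close>, since continuity in
  time and the modulus of continuity refer to individual times.\<close>

definition admissible_coeffs ::
    "(real^'d) set \<Rightarrow> real \<Rightarrow> real \<Rightarrow> (real \<Rightarrow> real) \<Rightarrow>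
     ('d \<Rightarrow> 'd \<Rightarrow> real \<Rightarrow> real^'d \<Rightarrow> real) \<Rightarrow> bool" where
  "admissible_coeffs \<Omega> T \<alpha> \<omega> a \<longleftrightarrow>
     (\<forall>i j. (\<lambda>z. a i j (fst z) (snd z)) \<in> borel_measurable (lebesgue_on ({0<..<T} \<times> \<Omega>))) \<and>
     (\<exists>B. \<forall>i j. AE z in lebesgue_on ({0<..<T} \<times> \<Omega>). \<bar>a i j (fst z) (snd z)\<bar> \<le> B) \<and>
     (\<forall>i j. AE z in lebesgue_on ({0<..<T} \<times> \<Omega>). a i j (fst z) (snd z) = a j i (fst z) (snd z)) \<and>
     (\<forall>\<xi> :: real^'d. AE z in lebesgue_on ({0<..<T} \<times> \<Omega>).
        (\<Sum>i\<in>UNIV. \<Sum>j\<in>UNIV. a i j (fst z) (snd z) * \<xi> $ i * \<xi> $ j) \<ge> \<alpha> * (norm \<xi>)\<^sup>2) \<and>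
     (\<forall>i j. AE x in lebesgue_on \<Omega>. continuous_on {0..T} (\<lambda>t. a i j t x)) \<and>
     (\<forall>i j. \<forall>t\<^sub>1 \<in> {0..T}. \<forall>t\<^sub>2 \<in> {0..T}. AE x in lebesgue_on \<Omega>.
        \<bar>a i j t\<^sub>1 x - a i j t\<^sub>2 x\<bar> \<le> \<omega> \<bar>t\<^sub>1 - t\<^sub>2\<bar>)"

definition a_form ::
    "(real^'d) set \<Rightarrow> ('d \<Rightarrow> 'd \<Rightarrow> real \<Rightarrow> real^'d \<Rightarrow> real) \<Rightarrow> real \<Rightarrow>
     (real^'d \<Rightarrow> real) \<Rightarrow> (real^'d \<Rightarrow> real) \<Rightarrow> real" where
  "a_form \<Omega> a t u v =
     (\<integral>x. (\<Sum>i\<in>UNIV. \<Sum>j\<in>UNIV. a i j t x * weak_grad \<Omega> u x $ i * weak_grad \<Omega> v x $ j)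
        \<partial>lebesgue_on \<Omega>)"

text \<open>Elements of \<open>H\<^sup>-\<^sup>1(\<Omega>)\<close> are functionals, used only on arguments in \<open>H10 \<Omega>\<close>.\<close>

definition A_op ::
    "(real^'d) set \<Rightarrow> ('d \<Rightarrow> 'd \<Rightarrow> real \<Rightarrow> real^'d \<Rightarrow> real) \<Rightarrow> real \<Rightarrow>
     (real^'d \<Rightarrow> real) \<Rightarrow> ((real^'d \<Rightarrow> real) \<Rightarrow> real)" where
  "A_op \<Omega> a t u = (\<lambda>v. a_form \<Omega> a t u v)"

definition functional_in_L2 :: "(real^'d) set \<Rightarrow> ((real^'d \<Rightarrow> real) \<Rightarrow> real) \<Rightarrow> bool" where
  "functional_in_L2 \<Omega> F \<longleftrightarrow> (\<exists>g \<in> L2 \<Omega>. \<forall>v \<in> H10 \<Omega>. F v = L2_inner \<Omega> g v)"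

section \<open>Time meshes\<close>

definition time_mesh :: "real \<Rightarrow> nat \<Rightarrow> (nat \<Rightarrow> real) \<Rightarrow> bool" where
  "time_mesh T M t \<longleftrightarrow> t 0 = 0 \<and> t M = T \<and> (\<forall>m<M. t m < t (Suc m))"

definition time_cell :: "(nat \<Rightarrow> real) \<Rightarrow> nat \<Rightarrow> real set" where
  "time_cell t m = {t (m - 1)<..t m}"

definition time_step :: "(nat \<Rightarrow> real) \<Rightarrow> nat \<Rightarrow> real" where
  "time_step t m = t m - t (m - 1)"

definition max_step :: "nat \<Rightarrow> (nat \<Rightarrow> real) \<Rightarrow> real" where
  "max_step M t = Max (time_step t ` {1..M})"

definition min_step :: "nat \<Rightarrow> (nat \<Rightarrow> real) \<Rightarrow> real" where
  "min_step M t = Min (time_step t ` {1..M})"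

definition admissible_mesh ::
    "real \<Rightarrow> real \<Rightarrow> real \<Rightarrow> real \<Rightarrow> nat \<Rightarrow> (nat \<Rightarrow> real) \<Rightarrow> bool" where
  "admissible_mesh T c \<beta> \<kappa> M t \<longleftrightarrow>
     time_mesh T M t \<and>
     min_step M t \<ge> c * max_step M t powr \<beta> \<and>
     (\<forall>m \<in> {1..M - 1}. inverse \<kappa> \<le> time_step t m / time_step t (m + 1) \<and>
        time_step t m / time_step t (m + 1) \<le> \<kappa>) \<and>
     max_step M t \<le> T / 4"

definition A_avg ::
    "(real^'d) set \<Rightarrow> ('d \<Rightarrow> 'd \<Rightarrow> real \<Rightarrow> real^'d \<Rightarrow> real) \<Rightarrow> (nat \<Rightarrow> real) \<Rightarrow> nat \<Rightarrow>
     (real^'d \<Rightarrow> real) \<Rightarrow> ((real^'d \<Rightarrow> real) \<Rightarrow> real)" where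
  "A_avg \<Omega> a t m u =
     (\<lambda>v. 1 / time_step t m * (\<integral>s. A_op \<Omega> a s u v \<partial>lebesgue_on (time_cell t m)))"

section \<open>Space discretization\<close>

text \<open>The library notion \<open>triangulation\<close> already requires two simplices to meet in a common face,
  which rules out hanging nodes and overlaps.\<close>

definition conformal_triangulation :: "(real^'d) set \<Rightarrow> (real^'d) set set \<Rightarrow> bool" where
  "conformal_triangulation \<Omega> \<T> \<longleftrightarrow>
     triangulation \<T> \<and> (\<forall>\<tau> \<in> \<T>. int CARD('d) simplex \<tau>) \<and> \<Union>\<T> = closure \<Omega>"

definition polys_upto :: "nat \<Rightarrow> (real^'d \<Rightarrow> real) set" where
  "polys_upto r = {p. \<exists>b :: ('d \<Rightarrow> nat) \<Rightarrow> real.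
     \<forall>x. p x = (\<Sum>\<nu> | (\<Sum>i\<in>UNIV. \<nu> i) \<le> r. b \<nu> * (\<Prod>i\<in>UNIV. x $ i ^ \<nu> i))}"

text \<open>Finite element functions are represented by their continuous representatives, extended by
  zero. Thus two members of \<open>fe_space \<Omega> r \<T>\<close> that agree almost everywhere on \<open>\<Omega>\<close> are equal,
  which makes the definite descriptions below well-defined.\<close>

definition fe_space :: "(real^'d) set \<Rightarrow> nat \<Rightarrow> (real^'d) set set \<Rightarrow> (real^'d \<Rightarrow> real) set" where
  "fe_space \<Omega> r \<T> = {v \<in> H10 \<Omega>.
     (\<forall>\<tau> \<in> \<T>. \<exists>p \<in> polys_upto r. \<forall>x \<in> \<tau>. v x = p x) \<and> (\<forall>x. x \<notin> closure \<Omega> \<longrightarrow> v x = 0)}"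

definition L2_proj ::
    "(real^'d) set \<Rightarrow> (real^'d \<Rightarrow> real) set \<Rightarrow> (real^'d \<Rightarrow> real) \<Rightarrow> (real^'d \<Rightarrow> real)" where
  "L2_proj \<Omega> V u = (THE w. w \<in> V \<and> (\<forall>\<phi> \<in> V. L2_inner \<Omega> (\<lambda>x. u x - w x) \<phi> = 0))"

definition A_disc ::
    "(real^'d) set \<Rightarrow> ('d \<Rightarrow> 'd \<Rightarrow> real \<Rightarrow> real^'d \<Rightarrow> real) \<Rightarrow> (real^'d \<Rightarrow> real) set \<Rightarrow> real \<Rightarrow>
     (real^'d \<Rightarrow> real) \<Rightarrow> (real^'d \<Rightarrow> real)" where
  "A_disc \<Omega> a V t v = (THE w. w \<in> V \<and> (\<forall>\<phi> \<in> V. L2_inner \<Omega> w \<phi> = a_form \<Omega> a t v \<phi>))"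

text \<open>Integration of functions with values in the finite-dimensional space \<open>V\<close> commutes with
  point evaluation, so the average can be taken pointwise.\<close>

definition A_disc_avg ::
    "(real^'d) set \<Rightarrow> ('d \<Rightarrow> 'd \<Rightarrow> real \<Rightarrow> real^'d \<Rightarrow> real) \<Rightarrow> (real^'d \<Rightarrow> real) set \<Rightarrow>
     (nat \<Rightarrow> real) \<Rightarrow> nat \<Rightarrow> (real^'d \<Rightarrow> real) \<Rightarrow> (real^'d \<Rightarrow> real)" where
  "A_disc_avg \<Omega> a V t m v =
     (\<lambda>x. 1 / time_step t m * (\<integral>s. A_disc \<Omega> a V s v x \<partial>lebesgue_on (time_cell t m)))"

section \<open>Full discretization\<close>

text \<open>A piecewise constant function \<open>v\<close> has the value \<open>v (t m)\<close> on the \<open>m\<close>-th time cell, because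
  the cells are closed on the right.\<close>

definition X_space ::
    "nat \<Rightarrow> (nat \<Rightarrow> real) \<Rightarrow> (real^'d \<Rightarrow> real) set \<Rightarrow> (real \<Rightarrow> real^'d \<Rightarrow> real) set" where
  "X_space M t V = {v. \<forall>m \<in> {1..M}. v (t m) \<in> V \<and> (\<forall>s \<in> time_cell t m. v s = v (t m))}"

definition fully_discrete_solution ::
    "(real^'d) set \<Rightarrow> real \<Rightarrow> ('d \<Rightarrow> 'd \<Rightarrow> real \<Rightarrow> real^'d \<Rightarrow> real) \<Rightarrow> nat \<Rightarrow> (nat \<Rightarrow> real) \<Rightarrow>
     (real^'d \<Rightarrow> real) set \<Rightarrow> (real \<Rightarrow> real^'d \<Rightarrow> real) \<Rightarrow> (real^'d \<Rightarrow> real) \<Rightarrow>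
     (real \<Rightarrow> real^'d \<Rightarrow> real) \<Rightarrow> bool" where
  "fully_discrete_solution \<Omega> T a M t V f u\<^sub>0 u \<longleftrightarrow>
     u \<in> X_space M t V \<and>
     (\<forall>\<phi> \<in> X_space M t V.
        (\<integral>s. a_form \<Omega> a s (u s) (\<phi> s) \<partial>lebesgue_on {0<..<T})
        + (\<Sum>m = 2..M. L2_inner \<Omega> (\<lambda>x. u (t m) x - u (t (m - 1)) x) (\<phi> (t m)))
        + L2_inner \<Omega> (u (t 1)) (\<phi> (t 1))
        = (\<integral>s. L2_inner \<Omega> (f s) (\<phi> s) \<partial>lebesgue_on {0<..<T})
        + L2_inner \<Omega> u\<^sub>0 (\<phi> (t 1)))"

definition jump ::
    "(real^'d) set \<Rightarrow> (nat \<Rightarrow> real) \<Rightarrow> (real^'d \<Rightarrow> real) set \<Rightarrow> (real^'d \<Rightarrow> real) \<Rightarrow>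
     (real \<Rightarrow> real^'d \<Rightarrow> real) \<Rightarrow> nat \<Rightarrow> (real^'d \<Rightarrow> real)" where
  "jump \<Omega> t V u\<^sub>0 u m =
     (if m = 0 then (\<lambda>x. u (t 1) x - L2_proj \<Omega> V u\<^sub>0 x)
      else (\<lambda>x. u (t (m + 1)) x - u (t m) x))"

end

theory Submission
  imports Defs "HOL-Library.Function_Algebras"
begin

text \<open>The scheme is backward Euler in the finite-dimensional space \<open>V\<close> of finite element functions:
  testing it yields
  \<open>v\<^sub>m + k\<^sub>m A\<^sub>m v\<^sub>m = v\<^sub>m\<^sub>-\<^sub>1 + F\<^sub>m\<close> with \<open>v\<^sub>0 = 0\<close>, where \<open>A\<^sub>m\<close> is the averaged operator of the
  \<open>m\<close>-th step, \<open>F\<^sub>m\<close> represents the integral of \<open>f\<close> over the step, and \<open>F\<^sub>1\<close> also contains the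
  projected initial value. The argument sees \<open>V\<close> only through the inner product and the
  symmetric coercive forms of the \<open>A\<^sub>m\<close>, so its constants do not depend on the triangulation or the degree.

  To bound \<open>A\<^sub>m v\<^sub>m\<close>, freeze \<open>B = A\<^sub>m\<close> and test with the solution of the dual problem for \<open>B\<close>, which
  starts from \<open>\<phi>\<close> at step \<open>m\<close> and runs backwards (\<open>duality\<close>). With \<open>\<tau> = t\<^sub>m - t\<^sub>j\<^sub>-\<^sub>1\<close>,
  \<open>R\<^sub>j\<close> the product of the resolvents \<open>(1 + k\<^sub>i B)\<^sup>-\<^sup>1\<close> for \<open>j \<le> i \<le> m\<close>, and
  \<open>\<parallel>\<cdot>\<parallel>\<^sub>V\<close> the \<open>L\<^sup>2\<close> norm of the gradient, this gives
  \<open>(A\<^sub>m v\<^sub>m, \<phi>) = \<Sum>\<^sub>j (F\<^sub>j, B R\<^sub>j \<phi>) + k\<^sub>j ((B - A\<^sub>j) v\<^sub>j, B R\<^sub>j \<phi>)\<close>.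
  Expanding the product \<open>\<Prod>\<^sub>i (1 + k\<^sub>i B)\<close> into powers of \<open>B\<close>, all of whose mixed inner products are
  nonnegative, replaces spectral calculus (\<open>smoothing\<close>) and shows \<open>\<parallel>B R\<^sub>j \<phi>\<parallel> \<le> \<parallel>\<phi>\<parallel> / \<tau>\<close>, and
  \<open>\<parallel>B R\<^sub>j \<phi>\<parallel>\<^sub>V \<le> C \<tau>\<^sup>-\<^sup>3\<^sup>/\<^sup>2 \<parallel>\<phi>\<parallel>\<close> for \<open>j < m\<close>. The second bound needs two factors of comparable total size,
  which is where the bounded ratio of neighbouring steps enters. As the frozen operator differs from
  \<open>A\<^sub>j\<close> by at most \<open>C \<omega>(\<tau>)\<close> in the form sense, \<open>pointwise\<close> states
  \<open>\<parallel>A\<^sub>m v\<^sub>m\<parallel> \<le> \<Sum>\<^sub>j\<^sub>\<le>\<^sub>m \<parallel>F\<^sub>j\<parallel> / \<tau> + C \<Sum>\<^sub>j\<^sub><\<^sub>m k\<^sub>j \<parallel>v\<^sub>j\<parallel>\<^sub>V \<omega>(\<tau>) \<tau>\<^sup>-\<^sup>3\<^sup>/\<^sup>2\<close>.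

  Summing over \<open>m\<close> with weights \<open>k\<^sub>m\<close>, the first part produces the harmonic sum
  \<open>\<Sum>\<^sub>m k\<^sub>m / \<tau> \<le> 1 + ln (T / k\<^sub>m\<^sub>i\<^sub>n)\<close>, which is the logarithm of the theorem because \<open>k\<^sub>m\<^sub>i\<^sub>n \<ge> c k\<^sup>\<beta>\<close>.
  In the second part the sum over \<open>m\<close> is a lower Riemann sum of the integral of
  \<open>\<omega>(s) s\<^sup>-\<^sup>3\<^sup>/\<^sup>2\<close>, whose integrand is nonincreasing, and what is left,
  \<open>\<Sum>\<^sub>j k\<^sub>j \<parallel>v\<^sub>j\<parallel>\<^sub>V\<close>, is bounded by the energy estimate (\<open>energy_L1\<close>). So the estimate closes without
  a Gronwall argument; the witnesses are \<open>\<mu> = \<delta>\<^sub>0 = 1\<close>. The jumps are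
  \<open>F\<^sub>m - k\<^sub>m A\<^sub>m v\<^sub>m\<close>, with the initial value taken out of \<open>F\<^sub>1\<close>.

  The remaining parts supply what this argument presupposes about the concrete spaces: weak gradients
  are linear and unique up to null sets (by the fundamental lemma of the calculus of variations), the
  finite element space is a finite-dimensional subspace on which the \<open>L\<^sup>2\<close> inner product is definite,
  and the coefficient bounds, which are stated almost everywhere in space-time, hold on every time slice.\<close>

section \<open>Positive forms on a subspace\<close>

text \<open>The forms below are bilinear only on a subspace of a vector space of functions: two functions that
  agree almost everywhere are different vectors, and integrals of non-integrable functions are not additive.
  Hence a carrier \<open>V\<close> instead of a type of class \<open>real_inner\<close>.\<close>

locale psd_form =
  fixes V :: "'v::real_vector set" and q :: "'v \<Rightarrow> 'v \<Rightarrow> real"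
  assumes subspace_V: "subspace V"
    and add_left: "x \<in> V \<Longrightarrow> y \<in> V \<Longrightarrow> z \<in> V \<Longrightarrow> q (x + y) z = q x z + q y z"
    and scale_left: "x \<in> V \<Longrightarrow> y \<in> V \<Longrightarrow> q (c *\<^sub>R x) y = c * q x y"
    and sym: "x \<in> V \<Longrightarrow> y \<in> V \<Longrightarrow> q x y = q y x"
    and nonneg: "x \<in> V \<Longrightarrow> q x x \<ge> 0"
begin

lemma mem [simp, intro]:
  "0 \<in> V" "x \<in> V \<Longrightarrow> y \<in> V \<Longrightarrow> x + y \<in> V" "x \<in> V \<Longrightarrow> c *\<^sub>R x \<in> V"
  "x \<in> V \<Longrightarrow> y \<in> V \<Longrightarrow> x - y \<in> V"
  using subspace_V by (auto simp: subspace_0 subspace_add subspace_scale subspace_diff)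

lemma mem_sum: "(\<And>i. i \<in> I \<Longrightarrow> f i \<in> V) \<Longrightarrow> sum f I \<in> V"
  using subspace_V by (rule subspace_sum)

lemma add_right: "x \<in> V \<Longrightarrow> y \<in> V \<Longrightarrow> z \<in> V \<Longrightarrow> q z (x + y) = q z x + q z y"
  using sym[of z "x+y"] sym[of z x] sym[of z y] add_left[of x y z] by simp

lemma scale_right: "x \<in> V \<Longrightarrow> y \<in> V \<Longrightarrow> q y (c *\<^sub>R x) = c * q y x"
  using sym[of y "c *\<^sub>R x"] sym[of y x] scale_left[of x y c] by simp

lemma diff_left: "x \<in> V \<Longrightarrow> y \<in> V \<Longrightarrow> z \<in> V \<Longrightarrow> q (x - y) z = q x z - q y z"
  using add_left[of "x - y" y z] by simp

lemma diff_right: "x \<in> V \<Longrightarrow> y \<in> V \<Longrightarrow> z \<in> V \<Longrightarrow> q z (x - y) = q z x - q z y"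
  using add_right[of "x - y" y z] by simp

lemma zero_left: "x \<in> V \<Longrightarrow> q 0 x = 0"
  using scale_left[of 0 x 0] by simp

lemma sum_left:
  "finite I \<Longrightarrow> (\<And>i. i \<in> I \<Longrightarrow> f i \<in> V) \<Longrightarrow> z \<in> V \<Longrightarrow> q (sum f I) z = (\<Sum>i\<in>I. q (f i) z)"
  by (induction I rule: finite_induct) (auto simp: zero_left add_left mem_sum)

lemmas bilinear = add_left add_right scale_left scale_right diff_left diff_right

lemma Cauchy_Schwarz_sq:
  assumes x: "x \<in> V" and y: "y \<in> V"
  shows "(q x y)\<^sup>2 \<le> q x x * q y y"
proof (cases "q y y = 0")
  case True
  have "q x y = 0"
  proof (rule ccontr)
    assume n: "q x y \<noteq> 0"
    \<comment> \<open>makes \<open>q (x + s y) (x + s y) = -1\<close>, as \<open>q y y = 0\<close>\<close>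
    define s where "s = - (q x x + 1) / (2 * q x y)"
    have "0 \<le> q (x + s *\<^sub>R y) (x + s *\<^sub>R y)" using x y by (intro nonneg) auto
    also have "\<dots> = q x x + 2 * s * q x y"
      using x y True sym[of y x] by (simp add: bilinear)
    also have "\<dots> = -1" using n by (simp add: s_def field_simps)
    finally show False by simp
  qed
  then show ?thesis using True by simp
next
  case False
  then have pos: "q y y > 0" using nonneg[OF y] by simp
  define s where "s = - q x y / q y y"
  have "0 \<le> q (x + s *\<^sub>R y) (x + s *\<^sub>R y)" using x y by (intro nonneg) auto
  also have "\<dots> = q x x + 2 * s * q x y + s\<^sup>2 * q y y"
    using x y sym[of y x] by (simp add: bilinear power2_eq_square algebra_simps)
  also have "\<dots> = q x x - (q x y)\<^sup>2 / q y y"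
    using pos by (simp add: s_def field_simps power2_eq_square)
  finally show ?thesis using pos by (simp add: field_simps)
qed

lemma Cauchy_Schwarz:
  assumes "x \<in> V" "y \<in> V"
  shows "q x y \<le> sqrt (q x x) * sqrt (q y y)"
proof -
  have "\<bar>q x y\<bar> = sqrt ((q x y)\<^sup>2)" by simp
  also have "\<dots> \<le> sqrt (q x x * q y y)" using Cauchy_Schwarz_sq[OF assms] by (rule real_sqrt_le_mono)
  finally show ?thesis by (simp add: real_sqrt_mult)
qed

lemma triangle:
  assumes "x \<in> V" "y \<in> V"
  shows "sqrt (q (x + y) (x + y)) \<le> sqrt (q x x) + sqrt (q y y)"
proof (rule real_le_lsqrt)
  have "q (x + y) (x + y) = q x x + 2 * q x y + q y y"
    using assms by (simp add: bilinear sym[of y x])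
  also have "\<dots> \<le> q x x + 2 * (sqrt (q x x) * sqrt (q y y)) + q y y"
    using Cauchy_Schwarz[OF assms] by simp
  also have "\<dots> = (sqrt (q x x) + sqrt (q y y))\<^sup>2"
    using assms nonneg by (simp add: power2_sum)
  finally show "q (x + y) (x + y) \<le> (sqrt (q x x) + sqrt (q y y))\<^sup>2" .
qed (use assms nonneg in auto)

lemma norm_scale:
  assumes "x \<in> V"
  shows "sqrt (q (c *\<^sub>R x) (c *\<^sub>R x)) = \<bar>c\<bar> * sqrt (q x x)"
proof -
  have "q (c *\<^sub>R x) (c *\<^sub>R x) = c\<^sup>2 * q x x"
    using assms by (simp only: bilinear mem power2_eq_square mult.assoc)
  then show ?thesis by (simp add: real_sqrt_mult)
qed

end

lemma psd_form_subset:
  assumes "psd_form V q" "W \<subseteq> V" "subspace W"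
  shows "psd_form W q"
proof -
  interpret psd_form V q by fact
  show ?thesis using assms by unfold_locales (auto simp: subset_iff bilinear nonneg intro: sym)
qed

lemma subspace_lincombI:
  assumes zero: "0 \<in> S" and lin: "\<And>u v c. u \<in> S \<Longrightarrow> v \<in> S \<Longrightarrow> u + c *\<^sub>R v \<in> S"
  shows "subspace S"
proof (rule subspaceI)
  show "u + v \<in> S" if "u \<in> S" "v \<in> S" for u v using lin[OF that, of 1] by simp
  show "c *\<^sub>R u \<in> S" if "u \<in> S" for u c using lin[OF zero that, of c] by simp
qed (rule zero)

lemma psd_form_lincombI:
  assumes V: "subspace V"
    and lin: "\<And>u v w c. u \<in> V \<Longrightarrow> v \<in> V \<Longrightarrow> w \<in> V \<Longrightarrow> q (u + c *\<^sub>R v) w = q u w + c * q v w"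
    and sym: "\<And>u v. u \<in> V \<Longrightarrow> v \<in> V \<Longrightarrow> q u v = q v u"
    and nonneg: "\<And>u. u \<in> V \<Longrightarrow> q u u \<ge> 0"
  shows "psd_form V q"
proof
  show "q (u + v) w = q u w + q v w" if "u \<in> V" "v \<in> V" "w \<in> V" for u v w
    using lin[OF that, of 1] by simp
  show "q (c *\<^sub>R u) w = c * q u w" if "u \<in> V" "w \<in> V" for u w c
    using lin[of 0 u w c] lin[of 0 0 w 1] that subspace_0[OF V] by simp
qed (use V sym nonneg in auto)

locale fd_inner = psd_form +
  assumes definite: "x \<in> V \<Longrightarrow> q x x = 0 \<Longrightarrow> x = 0"
    and fd: "\<exists>S. finite S \<and> V \<subseteq> span S"
begin

lemma ext:
  assumes "x \<in> V" "y \<in> V" "\<And>z. z \<in> V \<Longrightarrow> q x z = q y z"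
  shows "x = y"
  using definite[of "x - y"] assms by (simp add: diff_left)

text \<open>Gram--Schmidt orthogonalization; vectors that become zero are dropped.\<close>

lemma ex_orthogonal_generators:
  assumes "finite S" "S \<subseteq> V"
  shows "\<exists>E. finite E \<and> E \<subseteq> V \<and> span E = span S \<and> (\<forall>e\<in>E. q e e = 1) \<and>
    (\<forall>e\<in>E. \<forall>e'\<in>E. e \<noteq> e' \<longrightarrow> q e e' = 0)"
  using assms
proof (induction S rule: finite_induct)
  case empty
  show ?case by (rule exI[of _ "{}"]) auto
next
  case (insert x S)
  then obtain E where E: "finite E" "E \<subseteq> V" "span E = span S" "\<forall>e\<in>E. q e e = 1"
    "\<forall>e\<in>E. \<forall>e'\<in>E. e \<noteq> e' \<longrightarrow> q e e' = 0" by auto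
  define p where "p = (\<Sum>e\<in>E. q x e *\<^sub>R e)"
  define y where "y = x - p"
  have xV: "x \<in> V" using insert by auto
  have pV: "p \<in> V" unfolding p_def using E by (intro mem_sum) auto
  have yV: "y \<in> V" using xV pV by (auto simp: y_def)
  have pE: "p \<in> span E" unfolding p_def by (intro span_sum span_scale span_base)
  have orth: "q y e = 0" if "e \<in> E" for e
  proof -
    have "q p e = (\<Sum>e'\<in>E. q (q x e' *\<^sub>R e') e)"
      unfolding p_def using E that by (intro sum_left) auto
    also have "\<dots> = (\<Sum>e'\<in>E. q x e' * q e' e)"
      using E that by (intro sum.cong) (auto simp: scale_left subset_iff)
    also have "\<dots> = (\<Sum>e'\<in>E. if e' = e then q x e else 0)"
      using E that by (intro sum.cong) auto
    also have "\<dots> = q x e" using E that by simp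
    finally show ?thesis using xV pV E that by (simp add: y_def diff_left subset_iff)
  qed
  have sp: "span (insert x S) = span (insert y E)"
  proof -
    have "span (insert x S) = span (insert x E)"
      using E(3) by (simp add: span_insert)
    also have "\<dots> = span (insert y E)"
    proof (rule span_eq[THEN iffD2], intro conjI subsetI)
      fix z assume "z \<in> insert x E"
      moreover have "x \<in> span (insert y E)"
        using pE span_base[of y "insert y E"] span_mono[of E "insert y E"]
          span_add[of y "insert y E" p] by (auto simp: y_def)
      ultimately show "z \<in> span (insert y E)" by (auto intro: span_base)
    next
      fix z assume "z \<in> insert y E"
      moreover have "y \<in> span (insert x E)"
        using pE span_base[of x "insert x E"] span_mono[of E "insert x E"]
          span_diff[of x "insert x E" p] by (auto simp: y_def)
      ultimately show "z \<in> span (insert x E)" by (auto intro: span_base)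
    qed
    finally show ?thesis .
  qed
  show ?case
  proof (cases "y = 0")
    case True
    then have "span (insert x S) = span E" using sp by simp
    then show ?thesis using E by blast
  next
    case False
    then have pos: "q y y > 0" using definite[OF yV] nonneg[OF yV] by force
    define c where "c = 1 / sqrt (q y y)"
    have c: "c * (c * q y y) = 1" "c \<noteq> 0" using pos by (auto simp: c_def)
    define e where "e = c *\<^sub>R y"
    have eV: "e \<in> V" using yV by (auto simp: e_def)
    have "span (insert e E) = span (insert y E)"
    proof (rule span_eq[THEN iffD2], intro conjI subsetI)
      fix z assume "z \<in> insert e E"
      then show "z \<in> span (insert y E)" by (auto simp: e_def intro: span_base span_scale)
    next
      fix z assume "z \<in> insert y E"
      moreover have "y = (1/c) *\<^sub>R e" using c by (simp add: e_def)
      then have "y \<in> span (insert e E)" by (auto intro: span_scale span_base)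
      ultimately show "z \<in> span (insert e E)" by (auto intro: span_base)
    qed
    moreover have "q e e = 1" using yV c(1) by (simp only: e_def scale_left scale_right mem)
    moreover have "q e e' = 0" "q e' e = 0" if "e' \<in> E" for e'
      using that orth[OF that] E yV eV sym[of e' e] by (auto simp: e_def scale_left subset_iff)
    ultimately show ?thesis using E eV sp by (intro exI[of _ "insert e E"]) auto
  qed
qed

lemma orthonormal_basis:
  obtains E where "finite E" "E \<subseteq> V" "\<And>x. x \<in> V \<Longrightarrow> x = (\<Sum>e\<in>E. q x e *\<^sub>R e)"
proof -
  obtain S where S: "finite S" "V \<subseteq> span S" using fd by auto
  obtain B where B: "B \<subseteq> V" "independent B" "V \<subseteq> span B"
    using maximal_independent_subset[of V] by auto
  have "finite B" using independent_span_bound[OF S(1) B(2)] B(1) S(2) by auto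
  from ex_orthogonal_generators[OF this B(1)] obtain E where E: "finite E" "E \<subseteq> V" "span E = span B"
    "\<forall>e\<in>E. q e e = 1" "\<forall>e\<in>E. \<forall>e'\<in>E. e \<noteq> e' \<longrightarrow> q e e' = 0" by (elim exE conjE)
  have "x = (\<Sum>e\<in>E. q x e *\<^sub>R e)" if x: "x \<in> V" for x
  proof -
    have "x \<in> span E" using B(3) E(3) x by auto
    then obtain c where c: "x = (\<Sum>e\<in>E. c e *\<^sub>R e)"
      using span_finite[OF E(1)] by auto
    have "q x e = c e" if "e \<in> E" for e
    proof -
      have "q x e = (\<Sum>e'\<in>E. q (c e' *\<^sub>R e') e)"
        unfolding c using E that by (intro sum_left) auto
      also have "\<dots> = (\<Sum>e'\<in>E. c e' * q e' e)"
        using E that by (intro sum.cong) (auto simp: scale_left subset_iff)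
      also have "\<dots> = (\<Sum>e'\<in>E. if e' = e then c e else 0)"
        using E that by (intro sum.cong) auto
      also have "\<dots> = c e" using E that by simp
      finally show ?thesis .
    qed
    then show ?thesis using c by simp
  qed
  then show ?thesis by (rule that[OF E(1,2)])
qed

text \<open>In finite dimension the representing vector is \<open>\<Sum> F(e) e\<close> over an orthonormal basis. All existence
  statements (discrete operators, resolvents, the projection, the load vector) are instances.\<close>

lemma Riesz:
  assumes add: "\<And>x y. x \<in> V \<Longrightarrow> y \<in> V \<Longrightarrow> F (x + y) = F x + F y"
    and scale: "\<And>c x. x \<in> V \<Longrightarrow> F (c *\<^sub>R x) = c * F x"
  shows "\<exists>w\<in>V. \<forall>z\<in>V. q w z = F z"
proof -
  obtain E where E: "finite E" "E \<subseteq> V" "\<And>x. x \<in> V \<Longrightarrow> x = (\<Sum>e\<in>E. q x e *\<^sub>R e)"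
    using orthonormal_basis by blast
  define w where "w = (\<Sum>e\<in>E. F e *\<^sub>R e)"
  have wV: "w \<in> V" unfolding w_def using E by (intro mem_sum) auto
  have Fsum: "finite I \<Longrightarrow> (\<And>i. i \<in> I \<Longrightarrow> f i \<in> V) \<Longrightarrow> F (sum f I) = (\<Sum>i\<in>I. F (f i))"
    for I and f :: "'a \<Rightarrow> 'a"
  proof (induction I rule: finite_induct)
    case empty
    have "F 0 = 0" using scale[of 0 0] by simp
    then show ?case by simp
  qed (auto simp: add mem_sum)
  have "q w z = F z" if z: "z \<in> V" for z
  proof -
    have "q w z = (\<Sum>e\<in>E. q (F e *\<^sub>R e) z)"
      unfolding w_def using E z by (intro sum_left) auto
    also have "\<dots> = (\<Sum>e\<in>E. F (q z e *\<^sub>R e))"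
      using E z by (intro sum.cong) (auto simp: scale_left scale sym[of z] subset_iff)
    also have "\<dots> = F (\<Sum>e\<in>E. q z e *\<^sub>R e)" using E z by (intro Fsum[symmetric]) auto
    finally show ?thesis using E(3)[OF z] by simp
  qed
  with wV show ?thesis by blast
qed

end

section \<open>The operator of a form and its resolvents\<close>

context fd_inner
begin

abbreviation nrm :: "'a \<Rightarrow> real" where "nrm x \<equiv> sqrt (q x x)"

text \<open>The operator \<open>V \<rightarrow> V\<close> of a form, that is, \<open>A\<^sub>h\<close> if \<open>b\<close> is the elliptic form.\<close>

definition rep :: "('a \<Rightarrow> 'a \<Rightarrow> real) \<Rightarrow> 'a \<Rightarrow> 'a" where
  "rep b u = (SOME w. w \<in> V \<and> (\<forall>z\<in>V. q w z = b u z))"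

lemma rep:
  assumes "psd_form V b" "u \<in> V"
  shows rep_mem: "rep b u \<in> V" and rep_eq: "z \<in> V \<Longrightarrow> q (rep b u) z = b u z"
proof -
  interpret b: psd_form V b by fact
  have "\<exists>w\<in>V. \<forall>z\<in>V. q w z = b u z"
    using assms(2) by (intro Riesz) (auto simp: b.bilinear)
  then have "\<exists>w. w \<in> V \<and> (\<forall>z\<in>V. q w z = b u z)" by blast
  from someI_ex[OF this]
  show "rep b u \<in> V" "z \<in> V \<Longrightarrow> q (rep b u) z = b u z" by (auto simp: rep_def)
qed

text \<open>Solvability of one implicit Euler step: \<open>q + k b\<close> is again an inner product, so the Riesz
  representation applies to it.\<close>

lemma resolvent:
  assumes "psd_form V b" "k \<ge> 0" "y \<in> V"
  shows "\<exists>x\<in>V. x + k *\<^sub>R rep b x = y"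
proof -
  interpret b: psd_form V b by fact
  interpret r: fd_inner V "\<lambda>x z. q x z + k * b x z"
  proof
    show "subspace V" by (rule subspace_V)
    show "q (x + y) z + k * b (x + y) z = q x z + k * b x z + (q y z + k * b y z)"
      if "x \<in> V" "y \<in> V" "z \<in> V" for x y z
      using that by (simp add: add_left b.add_left algebra_simps)
    show "q (c *\<^sub>R x) y + k * b (c *\<^sub>R x) y = c * (q x y + k * b x y)"
      if "x \<in> V" "y \<in> V" for x y c
      using that by (simp add: scale_left b.scale_left algebra_simps)
    show "q x y + k * b x y = q y x + k * b y x" if "x \<in> V" "y \<in> V" for x y
      using that sym b.sym by simp
    show "0 \<le> q x x + k * b x x" if "x \<in> V" for x
      using that nonneg b.nonneg assms(2) by simp
    show "x = 0" if "x \<in> V" "q x x + k * b x x = 0" for x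
    proof -
      have "q x x \<ge> 0" "k * b x x \<ge> 0" using that nonneg b.nonneg assms(2) by auto
      with that show ?thesis using definite[of x] by simp
    qed
    show "\<exists>S. finite S \<and> V \<subseteq> span S" by (rule fd)
  qed
  obtain x where x: "x \<in> V" "\<And>z. z \<in> V \<Longrightarrow> q x z + k * b x z = q y z"
    using r.Riesz[of "q y"] assms(3) by (auto simp: bilinear)
  have "x + k *\<^sub>R rep b x = y"
  proof (rule ext)
    fix z assume "z \<in> V"
    then show "q (x + k *\<^sub>R rep b x) z = q y z"
      using x assms by (simp add: bilinear rep)
  qed (use x assms rep in auto)
  with x show ?thesis by blast
qed

lemma rep_linear:
  assumes "psd_form V b" "u \<in> V" "v \<in> V"
  shows "rep b (u + c *\<^sub>R v) = rep b u + c *\<^sub>R rep b v"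
proof (rule ext)
  interpret b: psd_form V b by fact
  fix z assume "z \<in> V"
  then show "q (rep b (u + c *\<^sub>R v)) z = q (rep b u + c *\<^sub>R rep b v) z"
    using assms by (simp add: bilinear b.bilinear rep)
qed (use assms rep in auto)

lemma rep_selfadjoint:
  assumes "psd_form V b" "u \<in> V" "v \<in> V"
  shows "q (rep b u) v = q u (rep b v)"
proof -
  interpret b: psd_form V b by fact
  show ?thesis using assms by (simp add: sym[of u] rep b.sym[of u])
qed

lemma funpow_rep_mem: "psd_form V b \<Longrightarrow> u \<in> V \<Longrightarrow> (rep b ^^ n) u \<in> V"
  by (induction n) (auto intro: rep)

text \<open>Moving factors \<open>B\<close> from one side to the other reduces \<open>(B\<^sup>i u, B\<^sup>j u)\<close> to a square \<open>\<parallel>B\<^sup>l u\<parallel>\<^sup>2\<close> or, if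
  \<open>i + j\<close> is odd, to a value \<open>b(B\<^sup>l u, B\<^sup>l u)\<close> of the form.\<close>

lemma powers_nonneg:
  assumes b: "psd_form V b" and u: "u \<in> V"
  shows "q ((rep b ^^ i) u) ((rep b ^^ j) u) \<ge> 0"
proof -
  interpret b: psd_form V b by fact
  have *: "q ((rep b ^^ (j + n)) u) ((rep b ^^ j) u) \<ge> 0" for j n
  proof (induction n arbitrary: j rule: less_induct)
    case (less n)
    note m = funpow_rep_mem[OF b u]
    consider "n = 0" | "n = 1" | n' where "n = Suc (Suc n')"
      by (metis One_nat_def old.nat.exhaust)
    then show ?case
    proof cases
      case 1
      then show ?thesis using nonneg[OF m] by simp
    next
      case 2
      then show ?thesis using b.nonneg[OF m] by (simp add: rep[OF b m] m)
    next
      case 3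
      have "q ((rep b ^^ (j + n)) u) ((rep b ^^ j) u)
          = q ((rep b ^^ (Suc j + n')) u) ((rep b ^^ Suc j) u)"
        using 3 rep_selfadjoint[OF b m m, of "Suc (j + n')" j] by simp
      then show ?thesis using less.IH[of n' "Suc j"] 3 by simp
    qed
  qed
  show ?thesis
  proof (cases "j \<le> i")
    case True
    then show ?thesis using *[of j "i - j"] by simp
  next
    case False
    then show ?thesis using *[of i "j - i"] sym[OF funpow_rep_mem[OF b u] funpow_rep_mem[OF b u]]
      by simp
  qed
qed

text \<open>The numbers \<open>e1\<close> and \<open>e2\<close> are the first two elementary symmetric polynomials of the steps, so the
  expansion is that of \<open>\<Prod> (1 + k\<^sub>i B)\<close> up to second order. Of the remainder only the signs of its
  inner products with the powers are needed, and these are preserved by each factor.\<close>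

lemma product_expansion:
  assumes b: "psd_form V b"
    and z: "\<And>i. z i \<in> V" and step: "\<And>i. j \<le> i \<Longrightarrow> i < n \<Longrightarrow> z (Suc i) = z i + k i *\<^sub>R rep b (z i)"
    and k: "\<And>i. j \<le> i \<Longrightarrow> i < n \<Longrightarrow> k i \<ge> 0" and "j \<le> n"
  defines "e1 \<equiv> \<lambda>n. \<Sum>i=j..<n. k i"
  defines "e2 \<equiv> \<lambda>n. ((e1 n)\<^sup>2 - (\<Sum>i=j..<n. (k i)\<^sup>2)) / 2"
  shows "e1 n \<ge> 0 \<and> e2 n \<ge> 0 \<and> (\<exists>r\<in>V. (\<forall>l. q r ((rep b ^^ l) (z j)) \<ge> 0) \<and>
      z n = z j + e1 n *\<^sub>R rep b (z j) + e2 n *\<^sub>R rep b (rep b (z j)) + r)"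
  using \<open>j \<le> n\<close> step k
proof (induction n rule: dec_induct)
  case base
  have "\<forall>l. q 0 ((rep b ^^ l) (z j)) \<ge> 0" using funpow_rep_mem[OF b z] by (simp add: zero_left)
  then show ?case by (auto simp: e1_def e2_def intro!: bexI[of _ 0])
next
  case (step n)
  let ?B = "rep b"
  have IH: "e1 n \<ge> 0" "e2 n \<ge> 0" using step by auto
  obtain r where r: "r \<in> V" "\<And>l. q r ((?B ^^ l) (z j)) \<ge> 0"
    "z n = z j + e1 n *\<^sub>R ?B (z j) + e2 n *\<^sub>R ?B (?B (z j)) + r" using step by auto
  have kn: "k n \<ge> 0" using step by auto
  have m: "z j \<in> V" "?B (z j) \<in> V" "?B (?B (z j)) \<in> V" "?B (?B (?B (z j))) \<in> V" "?B r \<in> V"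
    using z b r by (auto intro!: rep)
  have e1: "e1 (Suc n) = e1 n + k n" using step by (simp add: e1_def)
  have e2: "e2 (Suc n) = e2 n + k n * e1 n"
    using step by (simp add: e2_def e1 field_simps power2_eq_square)
  define r' where "r' = r + k n *\<^sub>R ?B r + (k n * e2 n) *\<^sub>R ?B (?B (?B (z j)))"
  have Bn: "?B (z n) = ?B (z j) + e1 n *\<^sub>R ?B (?B (z j)) + e2 n *\<^sub>R ?B (?B (?B (z j))) + ?B r"
    using m r(1) rep_linear[OF b, of "z j + e1 n *\<^sub>R ?B (z j) + e2 n *\<^sub>R ?B (?B (z j))" r 1]
      rep_linear[OF b, of "z j + e1 n *\<^sub>R ?B (z j)" "?B (?B (z j))" "e2 n"]
      rep_linear[OF b, of "z j" "?B (z j)" "e1 n"] r(3) by simp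
  have "z (Suc n) = z n + k n *\<^sub>R ?B (z n)" using step by simp
  also have "\<dots> = z j + e1 (Suc n) *\<^sub>R ?B (z j) + e2 (Suc n) *\<^sub>R ?B (?B (z j)) + r'"
    unfolding Bn r'_def e1 e2 by (subst r(3)) (simp add: algebra_simps)
  finally have "z (Suc n) = z j + e1 (Suc n) *\<^sub>R ?B (z j) + e2 (Suc n) *\<^sub>R ?B (?B (z j)) + r'" .
  moreover have "r' \<in> V" unfolding r'_def using m r by auto
  moreover have "q r' ((?B ^^ l) (z j)) \<ge> 0" for l
  proof -
    have p: "(?B ^^ l) (z j) \<in> V" using funpow_rep_mem[OF b z] .
    have "q (?B r) ((?B ^^ l) (z j)) = q r ((?B ^^ Suc l) (z j))"
      using rep_selfadjoint[OF b r(1) p] by simp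
    then have 1: "q (?B r) ((?B ^^ l) (z j)) \<ge> 0" using r(2)[of "Suc l"] by simp
    have 2: "q (?B (?B (?B (z j)))) ((?B ^^ l) (z j)) \<ge> 0"
      using powers_nonneg[OF b z[of j], of 3 l] by (simp add: numeral_3_eq_3)
    have "q r' ((?B ^^ l) (z j)) = q r ((?B ^^ l) (z j)) + k n * q (?B r) ((?B ^^ l) (z j))
        + k n * e2 n * q (?B (?B (?B (z j)))) ((?B ^^ l) (z j))"
      unfolding r'_def using m r(1) p by (simp add: bilinear)
    then show ?thesis using 1 2 r(2)[of l] kn IH by simp
  qed
  ultimately show ?case using IH kn e1 e2 by auto
qed

text \<open>Smoothing property of products of resolvents. With \<open>y = B z\<^sub>j\<close> and \<open>z\<^sub>n = z\<^sub>j + \<tau> y + e2 B y + r\<close>, the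
  square of the norm of \<open>z\<^sub>n\<close> contains \<open>\<tau>\<^sup>2 \<parallel>y\<parallel>\<^sup>2\<close> and \<open>2 \<tau> e2 (y, B y)\<close>, and all other contributions are
  nonnegative.\<close>

lemma smoothing:
  assumes b: "psd_form V b"
    and z: "\<And>i. z i \<in> V" and step: "\<And>i. j \<le> i \<Longrightarrow> i < n \<Longrightarrow> z (Suc i) = z i + k i *\<^sub>R rep b (z i)"
    and k: "\<And>i. j \<le> i \<Longrightarrow> i < n \<Longrightarrow> k i \<ge> 0" and "j \<le> n"
  defines "\<tau> \<equiv> \<Sum>i=j..<n. k i"
  defines "y \<equiv> rep b (z j)"
  shows "\<tau>\<^sup>2 * q y y + \<tau> * (\<tau>\<^sup>2 - (\<Sum>i=j..<n. (k i)\<^sup>2)) * b y y \<le> q (z n) (z n)"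
proof -
  define e where "e = (\<tau>\<^sup>2 - (\<Sum>i=j..<n. (k i)\<^sup>2)) / 2"
  have "\<tau> \<ge> 0 \<and> e \<ge> 0 \<and> (\<exists>r\<in>V. (\<forall>l. q r ((rep b ^^ l) (z j)) \<ge> 0) \<and>
      z n = z j + \<tau> *\<^sub>R rep b (z j) + e *\<^sub>R rep b (rep b (z j)) + r)"
    using product_expansion[of b z j n k, OF b z step k \<open>j \<le> n\<close>] by (simp add: \<tau>_def e_def)
  then obtain r where r: "\<tau> \<ge> 0" "e \<ge> 0" "r \<in> V" "\<And>l. q r ((rep b ^^ l) (z j)) \<ge> 0"
    "z n = z j + \<tau> *\<^sub>R y + e *\<^sub>R rep b y + r" by (auto simp: y_def)
  have m: "z j \<in> V" "y \<in> V" "rep b y \<in> V" using z b by (auto simp: y_def intro!: rep)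
  define s where "s = z j + e *\<^sub>R rep b y + r"
  have sV: "s \<in> V" using m r by (auto simp: s_def)
  have zn: "z n = \<tau> *\<^sub>R y + s" by (simp add: s_def r(5) algebra_simps)
  have 1: "q (z j) y \<ge> 0" using powers_nonneg[OF b z[of j], of 0 1] by (simp add: y_def)
  have 2: "q r y \<ge> 0" using r(4)[of 1] by (simp add: y_def)
  \<comment> \<open>all parts of \<open>z n\<close> other than \<open>\<tau> y\<close> have nonnegative inner product with \<open>y\<close>\<close>
  have "q s y = q (z j) y + e * b y y + q r y"
    unfolding s_def using m r b by (simp add: bilinear rep)
  then have 3: "q s y \<ge> e * b y y" using 1 2 by simp
  have "q (z n) (z n) = \<tau>\<^sup>2 * q y y + 2 * \<tau> * q s y + q s s"
    unfolding zn using m sV by (simp add: bilinear sym[of y s] power2_eq_square algebra_simps)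
  moreover have "2 * \<tau> * q s y \<ge> 2 * \<tau> * (e * b y y)" using 3 r by (intro mult_left_mono) auto
  moreover have "q s s \<ge> 0" using sV by (rule nonneg)
  ultimately show ?thesis by (simp add: e_def field_simps)
qed

end

section \<open>Time stepping\<close>

lemma le_of_square_le_mult: "0 \<le> x \<Longrightarrow> 0 \<le> y \<Longrightarrow> x * x \<le> x * y \<Longrightarrow> x \<le> (y::real)"
  by (cases "x = 0") (auto simp: mult_le_cancel_left)

text \<open>A backward Euler scheme with operators that vary from step to step. Here \<open>N\<close> plays the role of the
  \<open>L\<^sup>2\<close> norm of the gradient; it enters through coercivity and the modulus of continuity. The initial value is part of the first source \<open>F 1\<close>.\<close>

locale time_stepping = fd_inner V q for V :: "'v::real_vector set" and q +
  fixes M :: nat and t :: "nat \<Rightarrow> real" and T \<kappa> \<alpha> D :: real and \<omega> :: "real \<Rightarrow> real"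
    and b :: "nat \<Rightarrow> 'v \<Rightarrow> 'v \<Rightarrow> real" and N :: "'v \<Rightarrow> real"
    and v F :: "nat \<Rightarrow> 'v" and k :: "nat \<Rightarrow> real"
  assumes t0: "t 0 = 0" and tM: "t M = T" and t_less: "m < M \<Longrightarrow> t m < t (Suc m)"
    and k_def: "k m = t m - t (m - 1)"
    and ratio: "1 \<le> m \<Longrightarrow> m < M \<Longrightarrow> k m \<le> \<kappa> * k (Suc m) \<and> k (Suc m) \<le> \<kappa> * k m"
    and \<kappa>: "\<kappa> > 0" and \<alpha>: "\<alpha> > 0" and D: "D \<ge> 0"
    and \<omega>: "s \<in> {0..T} \<Longrightarrow> \<omega> s \<ge> 0"
    and form: "m \<in> {1..M} \<Longrightarrow> psd_form V (b m)"
    and N: "N x \<ge> 0"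
    and coercive: "m \<in> {1..M} \<Longrightarrow> x \<in> V \<Longrightarrow> \<alpha> * (N x)\<^sup>2 \<le> b m x x"
    and modulus: "1 \<le> j \<Longrightarrow> j < m \<Longrightarrow> m \<le> M \<Longrightarrow> x \<in> V \<Longrightarrow> y \<in> V \<Longrightarrow>
      \<bar>b m x y - b j x y\<bar> \<le> D * \<omega> (t m - t (j - 1)) * N x * N y"
    and v0: "v 0 = 0" and vV: "v m \<in> V" and FV: "F m \<in> V"
    and scheme: "m \<in> {1..M} \<Longrightarrow> v m + k m *\<^sub>R rep (b m) (v m) = v (m - 1) + F m"
begin

lemma t_mono: "i \<le> j \<Longrightarrow> j \<le> M \<Longrightarrow> t i \<le> t j"
proof (induction j rule: dec_induct)
  case (step n)
  then show ?case using t_less[of n] by simp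
qed simp

lemma t_strict: "i < j \<Longrightarrow> j \<le> M \<Longrightarrow> t i < t j"
  using t_mono[of "Suc i" j] t_less[of i] by simp

lemma \<omega>_nonneg:
  assumes "j \<le> m" "m \<le> M"
  shows "\<omega> (t m - t (j - 1)) \<ge> 0"
proof -
  have "j - 1 \<le> m" "j - 1 \<le> M" using assms by auto
  then show ?thesis
    using t_mono[of 0 "j - 1"] t_mono[of m M] t_mono[of "j - 1" m] assms t0 tM by (intro \<omega>) auto
qed

lemma k_pos: "m \<in> {1..M} \<Longrightarrow> k m > 0"
  using t_strict[of "m - 1" m] by (simp add: k_def)

lemma sum_k: "j \<le> n \<Longrightarrow> (\<Sum>i=Suc j..<Suc n. k i) = t n - t j"
  by (induction n rule: dec_induct) (auto simp: k_def)

text \<open>Each step in a range of at least two steps has a neighbour within the range, whose length is at least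
  \<open>1/\<kappa>\<close> times its own. So no step takes up more than the fraction \<open>\<kappa> / (1 + \<kappa>)\<close> of the total length.\<close>

lemma sum_k_sq:
  assumes "1 \<le> j" "j < m" "m \<le> M"
  shows "(\<Sum>i=j..<Suc m. (k i)\<^sup>2) \<le> (\<kappa> / (1 + \<kappa>)) * (t m - t (j - 1))\<^sup>2"
proof -
  define \<tau> where "\<tau> = t m - t (j - 1)"
  have \<tau>: "\<tau> = (\<Sum>i=j..<Suc m. k i)" using sum_k[of "j - 1" m] assms by (simp add: \<tau>_def)
  have bound: "k i \<le> (\<kappa> / (1 + \<kappa>)) * \<tau>" if i: "i \<in> {j..<Suc m}" for i
  proof -
    \<comment> \<open>the right neighbour, or the left one for the last step\<close>
    obtain i' where i': "i' \<in> {j..<Suc m}" "i' \<noteq> i" "k i \<le> \<kappa> * k i'"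
    proof (cases "i = m")
      case True
      then show ?thesis using ratio[of "m - 1"] assms that[of "m - 1"] by (cases m) auto
    next
      case False
      then show ?thesis using ratio[of i] assms i that[of "Suc i"] by auto
    qed
    have "k i + k i' = (\<Sum>l\<in>{i, i'}. k l)" using i' by simp
    also have "\<dots> \<le> (\<Sum>l=j..<Suc m. k l)"
      using i i' assms by (intro sum_mono2 less_imp_le[OF k_pos]) auto
    finally have "\<kappa> * (k i + k i') \<le> \<kappa> * \<tau>" using \<tau> \<kappa> by simp
    then have "(1 + \<kappa>) * k i \<le> \<kappa> * \<tau>" using i' by (simp add: algebra_simps)
    then show ?thesis using \<kappa> by (simp add: field_simps)
  qed
  have "(\<Sum>i=j..<Suc m. (k i)\<^sup>2) \<le> (\<Sum>i=j..<Suc m. (\<kappa> / (1 + \<kappa>)) * \<tau> * k i)"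
    unfolding power2_eq_square using assms
    by (intro sum_mono mult_right_mono bound less_imp_le[OF k_pos]) auto
  also have "\<dots> = (\<kappa> / (1 + \<kappa>)) * \<tau> * \<tau>" unfolding \<tau> by (simp only: sum_distrib_left[symmetric])
  finally show ?thesis by (simp only: \<tau>_def power2_eq_square mult.assoc)
qed

definition S where "S = (\<Sum>m=1..M. nrm (F m))"

lemma S_nonneg: "S \<ge> 0" unfolding S_def by (intro sum_nonneg) (simp add: nonneg FV)

lemma scheme_tested:
  assumes "m \<in> {1..M}" "z \<in> V"
  shows "q (v m) z + k m * b m (v m) z = q (v (m - 1)) z + q (F m) z"
proof -
  have "q (v m + k m *\<^sub>R rep (b m) (v m)) z = q (v (m - 1) + F m) z"
    using scheme[OF assms(1)] by simp
  then show ?thesis using assms form[OF assms(1)] vV FV by (simp add: bilinear rep)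
qed

text \<open>Resolvents of nonnegative operators are contractions.\<close>

lemma norm_v: "m \<le> M \<Longrightarrow> nrm (v m) \<le> (\<Sum>j=1..m. nrm (F j))"
proof (induction m)
  case 0
  then show ?case by (simp add: v0 zero_left)
next
  case (Suc m)
  have m: "Suc m \<in> {1..M}" using Suc by auto
  interpret b: psd_form V "b (Suc m)" by (rule form[OF m])
  have "nrm (v (Suc m)) * nrm (v (Suc m)) = q (v (Suc m)) (v (Suc m))"
    using nonneg vV by simp
  also have "\<dots> \<le> q (v (Suc m)) (v (Suc m)) + k (Suc m) * b (Suc m) (v (Suc m)) (v (Suc m))"
    using b.nonneg[OF vV] k_pos[OF m] by simp
  also have "\<dots> = q (v m) (v (Suc m)) + q (F (Suc m)) (v (Suc m))"
    using scheme_tested[OF m vV] by simp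
  also have "\<dots> \<le> nrm (v m) * nrm (v (Suc m)) + nrm (F (Suc m)) * nrm (v (Suc m))"
    by (intro add_mono Cauchy_Schwarz vV FV)
  also have "\<dots> = nrm (v (Suc m)) * (nrm (v m) + nrm (F (Suc m)))"
    by (simp only: distrib_left mult.commute[of "nrm (v (Suc m))"])
  finally have "nrm (v (Suc m)) \<le> nrm (v m) + nrm (F (Suc m))"
    by (rule le_of_square_le_mult[rotated 2]) (simp_all add: nonneg vV FV)
  then show ?case using Suc by simp
qed

text \<open>Test the scheme with \<open>v\<^sub>m\<close>; the norms telescope, and \<open>norm_v\<close> controls the source.\<close>

lemma energy: "\<alpha> * (\<Sum>m=1..M. k m * (N (v m))\<^sup>2) \<le> S\<^sup>2"
proof -
  have *: "(\<Sum>j=1..m. k j * b j (v j) (v j)) \<le> (\<Sum>j=1..m. nrm (F j)) * S - q (v m) (v m) / 2"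
    if "m \<le> M" for m
    using that
  proof (induction m)
    case 0
    then show ?case by (simp add: v0 zero_left)
  next
    case (Suc m)
    have m: "Suc m \<in> {1..M}" using Suc by auto
    let ?v = "v (Suc m)"
    have "0 \<le> q (v m - ?v) (v m - ?v)" by (intro nonneg mem vV)
    then have 1: "q (v m) ?v \<le> q (v m) (v m) / 2 + q ?v ?v / 2"
      using vV sym[of ?v "v m"] by (simp add: bilinear)
    have "q (F (Suc m)) ?v \<le> nrm (F (Suc m)) * nrm ?v" by (intro Cauchy_Schwarz vV FV)
    also have "\<dots> \<le> nrm (F (Suc m)) * S"
    proof (intro mult_left_mono)
      have "nrm ?v \<le> (\<Sum>j=1..Suc m. nrm (F j))" using norm_v Suc by blast
      also have "\<dots> \<le> S" unfolding S_def using Suc.prems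
        by (intro sum_mono2) (auto simp: nonneg FV)
      finally show "nrm ?v \<le> S" .
    qed (simp add: nonneg FV)
    finally have 2: "q (F (Suc m)) ?v \<le> nrm (F (Suc m)) * S" .
    have "k (Suc m) * b (Suc m) ?v ?v = q (v m) ?v + q (F (Suc m)) ?v - q ?v ?v"
      using scheme_tested[OF m, of ?v] vV by simp
    then show ?case using 1 2 Suc by (simp add: algebra_simps)
  qed
  have "\<alpha> * (\<Sum>m=1..M. k m * (N (v m))\<^sup>2) = (\<Sum>m=1..M. k m * (\<alpha> * (N (v m))\<^sup>2))"
    by (simp add: sum_distrib_left algebra_simps)
  also have "\<dots> \<le> (\<Sum>m=1..M. k m * b m (v m) (v m))"
    by (intro sum_mono mult_left_mono coercive vV less_imp_le[OF k_pos]) auto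
  also have "\<dots> \<le> S * S - q (v M) (v M) / 2" using *[of M] by (simp add: S_def)
  also have "\<dots> \<le> S\<^sup>2" using nonneg[OF vV[of M]] by (simp add: power2_eq_square)
  finally show ?thesis .
qed

lemma energy_L1: "(\<Sum>m=1..M. k m * N (v m)) \<le> sqrt (T / \<alpha>) * S"
proof -
  have T: "T = (\<Sum>m=1..M. k m)"
    using sum_k[of 0 M] t0 tM by (simp add: atLeastLessThanSuc_atLeastAtMost)
  have "(\<Sum>m=1..M. k m * N (v m))\<^sup>2 = (\<Sum>m=1..M. sqrt (k m) * (sqrt (k m) * N (v m)))\<^sup>2"
    using k_pos by (intro arg_cong[of _ _ "\<lambda>x. x\<^sup>2"] sum.cong)
      (auto simp: mult.assoc[symmetric] less_imp_le)
  also have "\<dots> \<le> (\<Sum>m=1..M. (sqrt (k m))\<^sup>2) * (\<Sum>m=1..M. (sqrt (k m) * N (v m))\<^sup>2)"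
    by (rule Cauchy_Schwarz_ineq_sum)
  also have "\<dots> = T * (\<Sum>m=1..M. k m * (N (v m))\<^sup>2)"
    unfolding T using k_pos by (intro arg_cong2[of _ _ _ _ "(*)"] sum.cong)
      (auto simp: power_mult_distrib less_imp_le)
  also have "\<dots> \<le> T * (S\<^sup>2 / \<alpha>)"
  proof (rule mult_left_mono)
    show "(\<Sum>m=1..M. k m * (N (v m))\<^sup>2) \<le> S\<^sup>2 / \<alpha>"
      using energy \<alpha> by (simp add: field_simps)
    show "0 \<le> T" using t_mono[of 0 M] t0 tM by simp
  qed
  finally have "(\<Sum>m=1..M. k m * N (v m))\<^sup>2 \<le> (T / \<alpha>) * S\<^sup>2" by simp
  then have "(\<Sum>m=1..M. k m * N (v m)) \<le> sqrt ((T / \<alpha>) * S\<^sup>2)" by (rule real_le_rsqrt)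
  also have "\<dots> = sqrt (T / \<alpha>) * S" by (subst real_sqrt_mult) (simp add: S_nonneg)
  finally show ?thesis .
qed

text \<open>The dual problem for the frozen operator, solved backwards from \<open>\<phi>\<close> at step \<open>m\<close>.\<close>

lemma backward_sequence:
  assumes m: "m \<in> {1..M}" and \<phi>: "\<phi> \<in> V"
  obtains z where "\<And>i. z i \<in> V" "z (Suc m) = \<phi>"
    "\<And>i. 1 \<le> i \<Longrightarrow> i < Suc m \<Longrightarrow> z (Suc i) = z i + k i *\<^sub>R rep (b m) (z i)"
proof -
  define R where "R i y = (SOME x. x \<in> V \<and> x + k i *\<^sub>R rep (b m) x = y)" for i y
  have R: "R i y \<in> V \<and> R i y + k i *\<^sub>R rep (b m) (R i y) = y" if "i \<in> {1..M}" "y \<in> V" for i y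
  proof -
    have "\<exists>x. x \<in> V \<and> x + k i *\<^sub>R rep (b m) x = y"
      using resolvent[OF form[OF m] less_imp_le[OF k_pos[OF that(1)]] that(2)] by blast
    from someI_ex[OF this] show ?thesis by (simp add: R_def)
  qed
  define \<zeta> where "\<zeta> = rec_nat \<phi> (\<lambda>n y. R (m - n) y)"
  have \<zeta>0: "\<zeta> 0 = \<phi>" and \<zeta>S: "\<zeta> (Suc n) = R (m - n) (\<zeta> n)" for n by (auto simp: \<zeta>_def)
  have \<zeta>V: "\<zeta> n \<in> V" if "n \<le> m" for n
    using that
  proof (induction n)
    case (Suc n)
    then show ?case using R[of "m - n" "\<zeta> n"] m by (simp add: \<zeta>S Suc_le_eq)
  qed (simp add: \<zeta>0 \<phi>)
  define z where "z i = (if 1 \<le> i \<and> i \<le> Suc m then \<zeta> (Suc m - i) else \<phi>)" for i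
  show ?thesis
  proof (rule that[of z])
    show "z i \<in> V" for i using \<zeta>V \<phi> by (auto simp: z_def)
    show "z (Suc m) = \<phi>" by (simp add: z_def \<zeta>0)
    show "z (Suc i) = z i + k i *\<^sub>R rep (b m) (z i)" if i: "1 \<le> i" "i < Suc m" for i
    proof -
      have "z i = R i (z (Suc i))"
        using i \<zeta>S[of "m - i"] by (simp add: z_def Suc_diff_le)
      moreover have "z (Suc i) \<in> V" using i \<zeta>V by (auto simp: z_def)
      ultimately show ?thesis using R[of i "z (Suc i)"] i m by auto
    qed
  qed
qed

text \<open>One step of the induction: by self-adjointness the dual step moves \<open>1 + k\<^sub>n B\<close> onto \<open>v\<^sub>n\<close>, where
  the scheme replaces \<open>v\<^sub>n + k\<^sub>n A\<^sub>n v\<^sub>n\<close> by \<open>v\<^sub>n\<^sub>-\<^sub>1 + F\<^sub>n\<close>. The defect \<open>B - A\<^sub>n\<close> remains.\<close>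

lemma duality:
  assumes m: "m \<in> {1..M}" and z: "\<And>i. z i \<in> V"
    and step: "\<And>i. 1 \<le> i \<Longrightarrow> i < Suc m \<Longrightarrow> z (Suc i) = z i + k i *\<^sub>R rep (b m) (z i)"
  defines "y \<equiv> \<lambda>i. rep (b m) (z i)"
  shows "n \<le> m \<Longrightarrow> q (v n) (y (Suc n)) =
    (\<Sum>j=1..n. q (F j) (y j) + k j * (b m (v j) (y j) - b j (v j) (y j)))"
proof (induction n)
  case 0
  then show ?case using z form[OF m] by (simp add: v0 y_def zero_left rep_mem)
next
  case (Suc n)
  interpret bm: psd_form V "b m" by (rule form[OF m])
  have yV: "y i \<in> V" for i using z form[OF m] by (simp add: y_def rep_mem)
  have n: "Suc n \<in> {1..M}" using Suc m by auto
  have "y (Suc (Suc n)) = y (Suc n) + k (Suc n) *\<^sub>R rep (b m) (y (Suc n))"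
    using step[of "Suc n"] Suc z rep_linear[OF form[OF m] z yV[of "Suc n"]] by (simp add: y_def)
  then have "q (v (Suc n)) (y (Suc (Suc n))) = q (v (Suc n)) (y (Suc n))
      + k (Suc n) * q (v (Suc n)) (rep (b m) (y (Suc n)))"
    using vV yV rep_mem[OF form[OF m]] by (simp add: bilinear)
  also have "q (v (Suc n)) (rep (b m) (y (Suc n))) = b m (v (Suc n)) (y (Suc n))"
    using rep_selfadjoint[OF form[OF m] vV yV] rep_eq[OF form[OF m] vV yV] by simp
  also have "q (v (Suc n)) (y (Suc n)) = q (v n) (y (Suc n)) + q (F (Suc n)) (y (Suc n))
      - k (Suc n) * b (Suc n) (v (Suc n)) (y (Suc n))"
    using scheme_tested[OF n yV[of "Suc n"]] by simp
  finally show ?case using Suc by (simp add: algebra_simps)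
qed

text \<open>Duality with \<open>\<phi> = A\<^sub>m v\<^sub>m\<close>, the two smoothing bounds for the dual solution, and division by
  \<open>\<parallel>\<phi>\<parallel>\<close>. The term \<open>j = m\<close> of the perturbation vanishes, because the operator is frozen at step \<open>m\<close>;
  for it the bound with exponent \<open>-3/2\<close> would be false.\<close>

lemma pointwise:
  assumes m: "m \<in> {1..M}"
  shows "nrm (rep (b m) (v m)) \<le> (\<Sum>j=1..m. nrm (F j) / (t m - t (j - 1))) +
    (\<Sum>j=1..<m. k j * N (v j) * (D * sqrt ((1 + \<kappa>) / \<alpha>)
        * (\<omega> (t m - t (j - 1)) * (t m - t (j - 1)) powr (- 3/2))))"
    (is "_ \<le> ?A + ?B")
proof -
  interpret bm: psd_form V "b m" by (rule form[OF m])
  define \<phi> where "\<phi> = rep (b m) (v m)"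
  have \<phi>: "\<phi> \<in> V" using rep_mem[OF form[OF m] vV] by (simp add: \<phi>_def)
  from backward_sequence[OF m \<phi>] obtain z where z: "\<And>i. z i \<in> V" "z (Suc m) = \<phi>"
    "\<And>i. 1 \<le> i \<Longrightarrow> i < Suc m \<Longrightarrow> z (Suc i) = z i + k i *\<^sub>R rep (b m) (z i)" by blast
  define y where "y i = rep (b m) (z i)" for i
  have yV: "y i \<in> V" for i using z form[OF m] by (simp add: y_def rep_mem)
  have smooth: "(t m - t (j - 1))\<^sup>2 * q (y j) (y j) + (t m - t (j - 1))
      * ((t m - t (j - 1))\<^sup>2 - (\<Sum>i=j..<Suc m. (k i)\<^sup>2)) * b m (y j) (y j) \<le> q \<phi> \<phi>"
    if j: "j \<in> {1..m}" for j
  proof -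
    have "(\<Sum>i=j..<Suc m. k i) = t m - t (j - 1)" using sum_k[of "j - 1" m] j by (cases j) auto
    then show ?thesis using smoothing[of "b m" z j "Suc m" k] j m z form[OF m] k_pos
      by (auto simp: y_def less_imp_le)
  qed
  have \<tau>: "t m - t (j - 1) > 0" if "j \<in> {1..m}" for j using t_strict[of "j - 1" m] that m by auto
  have y1: "nrm (y j) \<le> nrm \<phi> / (t m - t (j - 1))" if j: "j \<in> {1..m}" for j
  proof -
    have "(\<Sum>i=j..<Suc m. (k i)\<^sup>2) \<le> (t m - t (j - 1))\<^sup>2"
    proof (cases "j = m")
      case True
      then show ?thesis by (simp add: k_def)
    next
      case False
      have "(\<Sum>i=j..<Suc m. (k i)\<^sup>2) \<le> (\<kappa> / (1 + \<kappa>)) * (t m - t (j - 1))\<^sup>2"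
        using False j m by (intro sum_k_sq) auto
      also have "\<dots> \<le> 1 * (t m - t (j - 1))\<^sup>2"
        using \<kappa> by (intro mult_right_mono) (auto simp: field_simps)
      finally show ?thesis by simp
    qed
    then have "(t m - t (j - 1)) * ((t m - t (j - 1))\<^sup>2 - (\<Sum>i=j..<Suc m. (k i)\<^sup>2)) * b m (y j) (y j) \<ge> 0"
      using bm.nonneg[OF yV] \<tau>[OF j] by simp
    then have "(t m - t (j - 1))\<^sup>2 * q (y j) (y j) \<le> q \<phi> \<phi>" using smooth[OF j] by simp
    then have "sqrt ((t m - t (j - 1))\<^sup>2 * q (y j) (y j)) \<le> nrm \<phi>" by (rule real_sqrt_le_mono)
    then show ?thesis using \<tau>[OF j] by (simp add: real_sqrt_mult field_simps)
  qed
  have y2: "N (y j) \<le> sqrt ((1 + \<kappa>) / \<alpha>) * nrm \<phi> * (t m - t (j - 1)) powr (- 3/2)"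
    if j: "j \<in> {1..<m}" for j
  proof -
    define \<tau>j where "\<tau>j = t m - t (j - 1)"
    have \<tau>j: "\<tau>j > 0" using \<tau>[of j] j by (simp add: \<tau>j_def)
    have "\<tau>j\<^sup>2 / (1 + \<kappa>) = \<tau>j\<^sup>2 - (\<kappa> / (1 + \<kappa>)) * \<tau>j\<^sup>2" using \<kappa> by (simp add: field_simps)
    also have "\<dots> \<le> \<tau>j\<^sup>2 - (\<Sum>i=j..<Suc m. (k i)\<^sup>2)" using sum_k_sq[of j m] j m by (simp add: \<tau>j_def)
    finally have "\<tau>j * (\<tau>j\<^sup>2 / (1 + \<kappa>)) * b m (y j) (y j)
        \<le> \<tau>j * (\<tau>j\<^sup>2 - (\<Sum>i=j..<Suc m. (k i)\<^sup>2)) * b m (y j) (y j)"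
      using bm.nonneg[OF yV] \<tau>j by (intro mult_right_mono mult_left_mono) auto
    also have "\<dots> \<le> q \<phi> \<phi>"
    proof -
      have "\<tau>j\<^sup>2 * q (y j) (y j) \<ge> 0" using nonneg[OF yV] by simp
      then show ?thesis using smooth[of j] j by (simp add: \<tau>j_def)
    qed
    finally have "\<tau>j ^ 3 * b m (y j) (y j) \<le> (1 + \<kappa>) * q \<phi> \<phi>"
      using \<kappa> by (simp add: field_simps power3_eq_cube power2_eq_square)
    moreover have "\<tau>j ^ 3 * (\<alpha> * (N (y j))\<^sup>2) \<le> \<tau>j ^ 3 * b m (y j) (y j)"
      using \<tau>j by (intro mult_left_mono coercive m yV) auto
    ultimately have "\<tau>j ^ 3 * (\<alpha> * (N (y j))\<^sup>2) \<le> (1 + \<kappa>) * q \<phi> \<phi>" by linarith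
    then have *: "(N (y j))\<^sup>2 \<le> (1 + \<kappa>) / \<alpha> * q \<phi> \<phi> / \<tau>j ^ 3"
      using \<alpha> \<tau>j by (simp add: field_simps)
    have p: "1 / \<tau>j ^ 3 = (\<tau>j powr (- 3/2))\<^sup>2"
    proof -
      have "(\<tau>j powr (- 3/2))\<^sup>2 = \<tau>j powr (- 3)"
        using \<tau>j by (simp add: power2_eq_square flip: powr_add)
      also have "\<dots> = 1 / \<tau>j ^ 3"
        using \<tau>j by (simp add: powr_minus divide_inverse powr_numeral)
      finally show ?thesis by simp
    qed
    have "(1 + \<kappa>) / \<alpha> * q \<phi> \<phi> / \<tau>j ^ 3 = (1 + \<kappa>) / \<alpha> * q \<phi> \<phi> * (\<tau>j powr (- 3/2))\<^sup>2"
      unfolding p[symmetric] by simp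
    with * have "N (y j) \<le> sqrt ((1 + \<kappa>) / \<alpha> * q \<phi> \<phi> * (\<tau>j powr (- 3/2))\<^sup>2)"
      by (intro real_le_rsqrt) simp
    also have "\<dots> = sqrt ((1 + \<kappa>) / \<alpha>) * nrm \<phi> * \<tau>j powr (- 3/2)"
      by (subst real_sqrt_mult, subst real_sqrt_mult) simp
    finally show ?thesis unfolding \<tau>j_def .
  qed
  have "nrm \<phi> * nrm \<phi> = q \<phi> \<phi>" using nonneg[OF \<phi>] by simp
  also have "\<dots> = b m (v m) \<phi>" unfolding \<phi>_def using rep_eq[OF form[OF m] vV \<phi>] by (simp add: \<phi>_def)
  also have "\<dots> = q (v m) (y (Suc m))"
    using rep_selfadjoint[OF form[OF m] vV \<phi>] rep_eq[OF form[OF m] vV \<phi>] z(2) by (simp add: y_def)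
  also have "\<dots> = (\<Sum>j=1..m. q (F j) (y j) + k j * (b m (v j) (y j) - b j (v j) (y j)))"
    unfolding y_def by (rule duality[OF m z(1,3)]) auto
  also have "\<dots> = (\<Sum>j=1..m. q (F j) (y j)) + (\<Sum>j=1..<m. k j * (b m (v j) (y j) - b j (v j) (y j)))"
  proof -
    have "(\<Sum>j=1..m. k j * (b m (v j) (y j) - b j (v j) (y j))) =
        (\<Sum>j=1..<m. k j * (b m (v j) (y j) - b j (v j) (y j)))"
      using m by (intro sum.mono_neutral_right) auto
    then show ?thesis by (simp add: sum.distrib)
  qed
  also have "\<dots> \<le> nrm \<phi> * ?A + nrm \<phi> * ?B"
  proof (rule add_mono)
    show "(\<Sum>j=1..m. q (F j) (y j)) \<le> nrm \<phi> * ?A"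
      unfolding sum_distrib_left
    proof (rule sum_mono)
      fix j assume j: "j \<in> {1..m}"
      have "q (F j) (y j) \<le> nrm (F j) * nrm (y j)" by (intro Cauchy_Schwarz FV yV)
      also have "\<dots> \<le> nrm (F j) * (nrm \<phi> / (t m - t (j - 1)))"
        by (intro mult_left_mono y1 j) (simp add: nonneg FV)
      finally show "q (F j) (y j) \<le> nrm \<phi> * (nrm (F j) / (t m - t (j - 1)))"
        by (simp add: mult.commute)
    qed
    show "(\<Sum>j=1..<m. k j * (b m (v j) (y j) - b j (v j) (y j))) \<le> nrm \<phi> * ?B"
      unfolding sum_distrib_left
    proof (rule sum_mono)
      fix j assume j: "j \<in> {1..<m}"
      let ?w = "\<omega> (t m - t (j - 1))"
      have w: "?w \<ge> 0" using m j by (intro \<omega>_nonneg) auto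
      have "b m (v j) (y j) - b j (v j) (y j) \<le> D * ?w * N (v j) * N (y j)"
        using modulus[of j m "v j" "y j"] j m vV yV by auto
      also have "\<dots> \<le> D * ?w * N (v j) * (sqrt ((1 + \<kappa>) / \<alpha>) * nrm \<phi> * (t m - t (j - 1)) powr (- 3/2))"
        using w D N by (intro mult_left_mono y2 j) auto
      finally have "k j * (b m (v j) (y j) - b j (v j) (y j)) \<le>
          k j * (D * ?w * N (v j) * (sqrt ((1 + \<kappa>) / \<alpha>) * nrm \<phi> * (t m - t (j - 1)) powr (- 3/2)))"
        using k_pos[of j] j m by (intro mult_left_mono) auto
      then show "k j * (b m (v j) (y j) - b j (v j) (y j)) \<le> nrm \<phi> * (k j * N (v j) * (D * sqrt ((1 + \<kappa>) / \<alpha>)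
        * (?w * (t m - t (j - 1)) powr (- 3/2))))" by (simp only: mult_ac)
    qed
  qed
  also have "\<dots> = nrm \<phi> * (?A + ?B)" by (simp only: distrib_left)
  finally have *: "nrm \<phi> * nrm \<phi> \<le> nrm \<phi> * (?A + ?B)" .
  have "0 \<le> ?A + ?B"
  proof (intro add_nonneg_nonneg sum_nonneg mult_nonneg_nonneg divide_nonneg_nonneg)
    fix j assume j: "j \<in> {1..<m}"
    show "0 \<le> \<omega> (t m - t (j - 1))"
      using m j by (intro \<omega>_nonneg) auto
    show "0 \<le> k j" using k_pos[of j] j m by auto
  qed (use nonneg FV N D \<kappa> \<alpha> \<tau> in \<open>auto simp: less_imp_le\<close>)
  then show ?thesis
    by (intro le_of_square_le_mult[OF _ _ *[unfolded \<phi>_def]]) (simp_all add: nonneg \<phi>[unfolded \<phi>_def])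
qed

text \<open>Exchange the order of summation in \<open>pointwise\<close>. The inner sums over \<open>m\<close> are those estimated by \<open>L\<close>
  and \<open>G\<close>, and \<open>energy_L1\<close> bounds the outer sum of the perturbation part.\<close>

theorem maximal_regularity:
  assumes L: "\<And>j. j \<in> {1..M} \<Longrightarrow> (\<Sum>m=j..M. k m / (t m - t (j - 1))) \<le> L"
    and G: "\<And>j. j \<in> {1..M} \<Longrightarrow>
      (\<Sum>m=Suc j..M. k m * (\<omega> (t m - t (j - 1)) * (t m - t (j - 1)) powr (- 3/2))) \<le> G"
    and G0: "G \<ge> 0"
  shows "(\<Sum>m=1..M. k m * nrm (rep (b m) (v m)))
    \<le> (L + D * sqrt ((1 + \<kappa>) / \<alpha>) * G * sqrt (T / \<alpha>)) * S"
proof -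
  let ?g = "\<lambda>m j. \<omega> (t m - t (j - 1)) * (t m - t (j - 1)) powr (- 3/2)"
  let ?c = "D * sqrt ((1 + \<kappa>) / \<alpha>)"
  have c: "?c \<ge> 0" using D \<kappa> \<alpha> by simp
  have swap: "(\<Sum>m=1..M. \<Sum>j=1..m. h m j) = (\<Sum>j=1..M. \<Sum>m=j..M. h m j)"
    "(\<Sum>m=1..M. \<Sum>j=1..<m. h m j) = (\<Sum>j=1..M. \<Sum>m=Suc j..M. h m j)" for h :: "nat \<Rightarrow> nat \<Rightarrow> real"
    by (auto simp: sum.Sigma intro!: sum.reindex_bij_witness[of _ "\<lambda>(a, b). (b, a)" "\<lambda>(a, b). (b, a)"])
  have "(\<Sum>m=1..M. k m * nrm (rep (b m) (v m))) \<le>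
     (\<Sum>m=1..M. k m * ((\<Sum>j=1..m. nrm (F j) / (t m - t (j - 1))) + (\<Sum>j=1..<m. k j * N (v j) * (?c * ?g m j))))"
    by (intro sum_mono mult_left_mono pointwise less_imp_le[OF k_pos]) auto
  also have "\<dots> = (\<Sum>m=1..M. \<Sum>j=1..m. nrm (F j) * (k m / (t m - t (j - 1))))
      + (\<Sum>m=1..M. \<Sum>j=1..<m. ?c * (k j * N (v j)) * (k m * ?g m j))"
    by (simp add: sum.distrib distrib_left sum_distrib_left mult_ac)
  also have "\<dots> = (\<Sum>j=1..M. nrm (F j) * (\<Sum>m=j..M. k m / (t m - t (j - 1))))
      + ?c * (\<Sum>j=1..M. k j * N (v j) * (\<Sum>m=Suc j..M. k m * ?g m j))"
    unfolding swap by (simp add: sum_distrib_left mult_ac)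
  also have "\<dots> \<le> (\<Sum>j=1..M. nrm (F j) * L) + ?c * (\<Sum>j=1..M. k j * N (v j) * G)"
    by (intro add_mono mult_left_mono[OF _ c] sum_mono mult_left_mono[OF L]
        mult_left_mono[OF G] mult_nonneg_nonneg less_imp_le[OF k_pos]) (auto simp: nonneg FV N)
  also have "\<dots> = L * S + ?c * G * (\<Sum>j=1..M. k j * N (v j))"
    by (simp add: S_def sum_distrib_left sum_distrib_right mult_ac)
  also have "\<dots> \<le> L * S + ?c * G * (sqrt (T / \<alpha>) * S)"
    using c G0 by (intro add_left_mono mult_left_mono energy_L1) auto
  finally show ?thesis by (simp add: algebra_simps)
qed

end

section \<open>Two sums over a time mesh\<close>

text \<open>The first summand is 1. For the others, \<open>1 - x \<le> - ln x\<close> with \<open>x = (t\<^sub>m\<^sub>-\<^sub>1 - s) / (t\<^sub>m - s)\<close>, \<open>s = t\<^sub>j\<^sub>-\<^sub>1\<close>,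
  makes the sum telescope.\<close>

lemma log_sum_le:
  fixes t :: "nat \<Rightarrow> real"
  assumes "\<And>m. m < n \<Longrightarrow> t m < t (Suc m)" "1 \<le> j" "j \<le> n"
  shows "(\<Sum>m=j..n. (t m - t (m - 1)) / (t m - t (j - 1)))
    \<le> 1 + ln ((t n - t (j - 1)) / (t j - t (j - 1))) \<and> t j \<le> t n"
  using assms(3,1)
proof (induction n rule: dec_induct)
  case base
  then show ?case using assms(2) by (cases j) auto
next
  case (step n)
  define s where "s = t (j - 1)"
  have pos: "t j - s > 0" using step(4)[of "j - 1"] step(1) assms(2) by (simp add: s_def)
  have n: "t j \<le> t n" "t n < t (Suc n)" using step by auto
  define x where "x = (t n - s) / (t (Suc n) - s)"
  have x: "x > 0" "x \<le> 1" using pos n by (auto simp: x_def)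
  have "(t (Suc n) - t n) / (t (Suc n) - s) = 1 - x"
    using pos n by (simp add: x_def field_simps)
  also have "\<dots> \<le> - ln x" using ln_le_minus_one[OF x(1)] by simp
  also have "\<dots> = ln ((t (Suc n) - s) / (t j - s)) - ln ((t n - s) / (t j - s))"
    using pos n by (simp add: x_def ln_div)
  finally have "(t (Suc n) - t n) / (t (Suc n) - s)
    \<le> ln ((t (Suc n) - s) / (t j - s)) - ln ((t n - s) / (t j - s))" .
  moreover have "(\<Sum>m=j..n. (t m - t (m - 1)) / (t m - s)) \<le> 1 + ln ((t n - s) / (t j - s))"
    using step by (simp add: s_def)
  ultimately have "(\<Sum>m=j..Suc n. (t m - t (m - 1)) / (t m - s)) \<le> 1 + ln ((t (Suc n) - s) / (t j - s))"
    using step(1) by simp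
  then show ?case using n by (simp add: s_def)
qed

text \<open>A right-endpoint Riemann sum of a nonincreasing function is a lower sum. The integrand may be
  unbounded at 0; no value at 0 contributes to the sum.\<close>

lemma right_endpoint_sum_le_integral:
  fixes a :: "nat \<Rightarrow> real" and g :: "real \<Rightarrow> real"
  assumes mono: "\<And>m. m < M \<Longrightarrow> a m \<le> a (Suc m)" and a: "0 \<le> a j" "a M \<le> T" "j \<le> M"
    and g0: "\<And>x. x \<in> {0<..T} \<Longrightarrow> g x \<ge> 0"
    and g: "\<And>x y. 0 < x \<Longrightarrow> x \<le> y \<Longrightarrow> y \<le> T \<Longrightarrow> g y \<le> g x"
    and int: "integrable (lebesgue_on {0<..<T}) g"
  shows "(\<Sum>m=Suc j..M. (a m - a (m - 1)) * g (a m)) \<le> (\<integral>x. g x \<partial>lebesgue_on {0<..<T})"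
proof -
  have aj: "a i \<le> a n" if "i \<le> n" "n \<le> M" for i n
    using that
  proof (induction n rule: dec_induct)
    case (step n)
    then show ?case using mono[of n] by simp
  qed simp
  have pointwise: "(\<Sum>m=Suc j..n. indicator {a (m - 1)<..<a m} x * g (a m)) \<le> indicator {..<a n} x * g x"
    if n: "j \<le> n" "n \<le> M" and x: "x \<in> {0<..<T}" for x n
    using n
  proof (induction n rule: dec_induct)
    case base
    then show ?case using g0 x by simp
  next
    case (step n)
    have IH: "(\<Sum>m=Suc j..n. indicator {a (m - 1)<..<a m} x * g (a m)) \<le> indicator {..<a n} x * g x"
      using step by simp
    have 2: "a n \<le> a (Suc n)" "a (Suc n) \<le> T" using aj[of n "Suc n"] aj[of "Suc n" M] step a by auto
    have "g x \<ge> 0" using g0 x by simp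
    moreover have "x < a (Suc n) \<Longrightarrow> g (a (Suc n)) \<le> g x" using 2 x by (intro g) auto
    moreover have "indicator {..<a n} x * g x \<le> g x" using calculation(1) by (simp add: indicator_def)
    moreover have "x \<le> a n \<Longrightarrow> x < a (Suc n) \<or> x = a n \<and> a (Suc n) = a n" using 2 by auto
    ultimately have "indicator {..<a n} x * g x + indicator {a n<..<a (Suc n)} x * g (a (Suc n))
        \<le> indicator {..<a (Suc n)} x * g x"
      using 2 by (cases "x < a n"; cases "x < a (Suc n)"; cases "a n < x") auto
    moreover have "(\<Sum>m=Suc j..Suc n. indicator {a (m - 1)<..<a m} x * g (a m))
        = (\<Sum>m=Suc j..n. indicator {a (m - 1)<..<a m} x * g (a m))
          + indicator {a n<..<a (Suc n)} x * g (a (Suc n))"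
      using step.hyps by (subst sum.cl_ivl_Suc) simp
    ultimately show ?case using IH by linarith
  qed
  have term_integral: "integrable (lebesgue_on {0<..<T}) (\<lambda>x. indicator {a (m - 1)<..<a m} x * g (a m)) \<and>
      (\<integral>x. indicator {a (m - 1)<..<a m} x * g (a m) \<partial>lebesgue_on {0<..<T}) = (a m - a (m - 1)) * g (a m)"
    if m: "m \<in> {Suc j..M}" for m
  proof -
    have "j \<le> m - 1" "m - 1 \<le> M" using m by auto
    then have b: "0 \<le> a (m - 1)" "a (m - 1) \<le> a m" "a m \<le> T"
      using aj[of j "m - 1"] aj[of "m - 1" m] aj[of m M] a m by auto
    then have sub: "{a (m - 1)<..<a m} \<subseteq> {0<..<T}" by auto
    have "emeasure (lebesgue_on {0<..<T}) {a (m - 1)<..<a m} = ennreal (a m - a (m - 1))"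
      using sub b by (subst emeasure_restrict_space) (auto simp: Int_absorb2)
    then have "measure (lebesgue_on {0<..<T}) {a (m - 1)<..<a m} = a m - a (m - 1)"
      and "emeasure (lebesgue_on {0<..<T}) {a (m - 1)<..<a m} < \<infinity>"
      using b by (auto simp: measure_def)
    moreover have "{a (m - 1)<..<a m} \<in> sets (lebesgue_on {0<..<T})"
      using sub by (auto simp: sets_restrict_space_iff)
    moreover have "{a (m - 1)<..<a m} \<inter> space (lebesgue_on {0<..<T}) = {a (m - 1)<..<a m}"
      using sub by auto
    ultimately show ?thesis by (auto simp: less_top)
  qed
  have "(\<Sum>m=Suc j..M. (a m - a (m - 1)) * g (a m))
      = (\<integral>x. (\<Sum>m=Suc j..M. indicator {a (m - 1)<..<a m} x * g (a m)) \<partial>lebesgue_on {0<..<T})"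
  proof (subst Bochner_Integration.integral_sum)
    show "(\<Sum>m=Suc j..M. (a m - a (m - 1)) * g (a m))
      = (\<Sum>m=Suc j..M. \<integral>x. indicator {a (m - 1)<..<a m} x * g (a m) \<partial>lebesgue_on {0<..<T})"
      using term_integral by (intro sum.cong refl) presburger
  qed (use term_integral in blast)
  also have "\<dots> \<le> (\<integral>x. g x \<partial>lebesgue_on {0<..<T})"
  proof (intro integral_mono int Bochner_Integration.integrable_sum)
    fix x assume "x \<in> space (lebesgue_on {0<..<T})"
    then have x: "x \<in> {0<..<T}" by simp
    have "(\<Sum>m=Suc j..M. indicator {a (m - 1)<..<a m} x * g (a m)) \<le> indicator {..<a M} x * g x"
      using pointwise[OF _ _ x] a by simp
    also have "\<dots> \<le> g x" using g0[of x] x by (auto simp: indicator_def)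
    finally show "(\<Sum>m=Suc j..M. indicator {a (m - 1)<..<a m} x * g (a m)) \<le> g x" .
  qed (use term_integral in auto)
  finally show ?thesis .
qed

section \<open>Smooth functions\<close>

lemma Ck_fun_mono: "Ck_fun (Suc n) f \<Longrightarrow> Ck_fun n f"
proof (induction n arbitrary: f)
  case 0
  then obtain g where "\<And>x. GDERIV f x :> g x" by auto
  then have "f differentiable (at x)" for x
    unfolding gderiv_def by (blast intro: differentiableI)
  then show ?case by (auto intro!: differentiable_imp_continuous_on simp: differentiable_on_def)
next
  case (Suc n)
  from Suc.prems obtain g where "\<And>x. GDERIV f x :> g x" "\<And>i. Ck_fun (Suc n) (\<lambda>x. g x $ i)"
    by (auto simp del: Ck_fun.simps(1) simp: Ck_fun.simps(2)[of "Suc n"])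
  then have "\<And>x. GDERIV f x :> g x" "\<And>i. Ck_fun n (\<lambda>x. g x $ i)" using Suc.IH by blast+
  then show ?case by (subst Ck_fun.simps) blast
qed

lemma Ck_fun_const: "Ck_fun n (\<lambda>x. c)"
proof (induction n arbitrary: c)
  case (Suc n)
  have "GDERIV (\<lambda>x::real^'a. c) x :> 0" for x by (rule GDERIV_const)
  then show ?case using Suc[of 0] by (auto intro!: exI[of _ "\<lambda>x. 0"])
qed simp

lemma Ck_fun_add: "Ck_fun n f \<Longrightarrow> Ck_fun n g \<Longrightarrow> Ck_fun n (\<lambda>x. f x + g x)"
proof (induction n arbitrary: f g)
  case (Suc n)
  then obtain f' g' where "\<And>x. GDERIV f x :> f' x" "\<And>i. Ck_fun n (\<lambda>x. f' x $ i)"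
    "\<And>x. GDERIV g x :> g' x" "\<And>i. Ck_fun n (\<lambda>x. g' x $ i)" by auto
  then show ?case using Suc.IH by (auto intro!: exI[of _ "\<lambda>x. f' x + g' x"] GDERIV_add)
qed (auto intro: continuous_intros)

lemma Ck_fun_mult: "Ck_fun n f \<Longrightarrow> Ck_fun n g \<Longrightarrow> Ck_fun n (\<lambda>x. f x * g x)"
proof (induction n arbitrary: f g)
  case (Suc n)
  then obtain f' g' where *: "\<And>x. GDERIV f x :> f' x" "\<And>i. Ck_fun n (\<lambda>x. f' x $ i)"
    "\<And>x. GDERIV g x :> g' x" "\<And>i. Ck_fun n (\<lambda>x. g' x $ i)" by auto
  then show ?case using Suc.IH Suc.prems[THEN Ck_fun_mono]
    by (auto intro!: exI[of _ "\<lambda>x. f x *\<^sub>R g' x + g x *\<^sub>R f' x"] GDERIV_mult Ck_fun_add)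
qed (auto intro: continuous_intros)

lemma Ck_fun_prod: "finite I \<Longrightarrow> (\<And>i. i \<in> I \<Longrightarrow> Ck_fun n (f i)) \<Longrightarrow> Ck_fun n (\<lambda>x. \<Prod>i\<in>I. f i x)"
  by (induction I rule: finite_induct) (auto intro: Ck_fun_const Ck_fun_mult)

text \<open>The functions \<open>y\<^sup>-\<^sup>n exp (-1/y)\<close>, extended by 0 to \<open>y \<le> 0\<close>. The family over all \<open>n\<close> is closed under
  differentiation up to linear combinations, which proves smoothness of its members by induction.\<close>

definition flat_exp :: "nat \<Rightarrow> real \<Rightarrow> real" where
  "flat_exp n y = (if y > 0 then inverse y ^ n * exp (- inverse y) else 0)"

lemma flat_exp_tendsto_0: "(flat_exp n \<longlongrightarrow> 0) (at_right 0)"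
proof -
  have "((\<lambda>y::real. inverse y ^ n / exp (inverse y)) \<longlongrightarrow> 0) (at_right 0)"
    by (rule filterlim_compose[OF tendsto_power_div_exp_0 filterlim_inverse_at_top_right])
  moreover have "\<forall>\<^sub>F y in at_right (0::real). inverse y ^ n / exp (inverse y) = flat_exp n y"
    using eventually_at_right_less by eventually_elim (simp add: flat_exp_def exp_minus divide_inverse)
  ultimately show ?thesis by (rule Lim_transform_eventually)
qed

lemma flat_exp_DERIV: "DERIV (flat_exp n) y :> flat_exp (n + 2) y - real n * flat_exp (n + 1) y"
proof -
  consider "y < 0" | "y > 0" | "y = 0" by linarith
  then show ?thesis
  proof cases
    case 1
    have "DERIV (\<lambda>_. 0) y :> (0::real)" by simp
    moreover have "\<forall>\<^sub>F x in nhds y. flat_exp n x = 0"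
      using eventually_nhds_in_open[of "{..<0}" y] 1
      by (auto elim!: eventually_mono simp: flat_exp_def)
    ultimately show ?thesis using 1 by (subst DERIV_cong_ev) (auto simp: flat_exp_def)
  next
    case 2
    have n: "n = 0 \<or> n = 1 \<or> (\<exists>l. n = Suc (Suc l))" by (cases n; cases "n - 1") auto
    have "DERIV (\<lambda>y. inverse y ^ n * exp (- inverse y)) y
        :> inverse y ^ (n + 2) * exp (- inverse y) - real n * (inverse y ^ (n + 1) * exp (- inverse y))"
      using 2 n by (auto intro!: derivative_eq_intros simp: power2_eq_square algebra_simps)
    moreover have "\<forall>\<^sub>F x in nhds y. flat_exp n x = inverse x ^ n * exp (- inverse x)"
      using eventually_nhds_in_open[of "{0<..}" y] 2
      by (auto elim!: eventually_mono simp: flat_exp_def)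
    ultimately show ?thesis using 2 by (subst DERIV_cong_ev) (auto simp: flat_exp_def)
  next
    case 3
    have "((\<lambda>h. (flat_exp n h - flat_exp n 0) / h) \<longlongrightarrow> 0) (at 0)"
      unfolding filterlim_at_split
    proof (intro conjI)
      have "\<forall>\<^sub>F h in at_left 0. (flat_exp n h - flat_exp n 0) / h = 0"
        unfolding eventually_at_filter by (simp add: flat_exp_def)
      then show "((\<lambda>h. (flat_exp n h - flat_exp n 0) / h) \<longlongrightarrow> 0) (at_left 0)"
        by (rule tendsto_eventually)
      have "\<forall>\<^sub>F h in at_right (0::real). flat_exp (n + 1) h = (flat_exp n h - flat_exp n 0) / h"
        using eventually_at_right_less by eventually_elim (simp add: flat_exp_def divide_inverse)
      then show "((\<lambda>h. (flat_exp n h - flat_exp n 0) / h) \<longlongrightarrow> 0) (at_right 0)"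
        by (rule Lim_transform_eventually[OF flat_exp_tendsto_0])
    qed
    then show ?thesis using 3 by (simp add: DERIV_def flat_exp_def)
  qed
qed

lemma Ck_fun_flat_exp: "Ck_fun k (\<lambda>x. flat_exp n (c * x $ i + e))"
proof (induction k arbitrary: n)
  case 0
  have "isCont (flat_exp n) y" for y using flat_exp_DERIV by (rule DERIV_isCont)
  then have "continuous_on UNIV (flat_exp n)" by (simp add: continuous_at_imp_continuous_on)
  then show ?case by (auto intro!: continuous_on_compose2[of UNIV "flat_exp n"] continuous_intros)
next
  case (Suc k)
  define f' where "f' y = flat_exp (n + 2) y - real n * flat_exp (n + 1) y" for y
  have 1: "GDERIV (\<lambda>x::real^'a. c * x $ i + e) x :> c *\<^sub>R axis i 1" for x
    unfolding gderiv_def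
    by (auto intro!: derivative_eq_intros simp: inner_axis bounded_linear_vec_nth[THEN bounded_linear_imp_has_derivative])
  have "GDERIV (\<lambda>x::real^'a. flat_exp n (c * x $ i + e)) x :> f' (c * x $ i + e) *\<^sub>R (c *\<^sub>R axis i 1)" for x
    unfolding f'_def by (rule GDERIV_DERIV_compose[OF 1 flat_exp_DERIV])
  moreover have "Ck_fun k (\<lambda>x::real^'a. (f' (c * x $ i + e) *\<^sub>R (c *\<^sub>R axis i 1)) $ j)" for j
  proof -
    have "Ck_fun k (\<lambda>x::real^'a. (flat_exp (n + 2) (c * x $ i + e)
      + (- real n) * flat_exp (n + 1) (c * x $ i + e)) * (c * axis i 1 $ j))"
      by (intro Ck_fun_mult Ck_fun_add Ck_fun_const Suc.IH)
    then show ?thesis by (simp add: f'_def mult.assoc)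
  qed
  ultimately show ?case
    by (auto intro!: exI[of _ "\<lambda>x. f' (c * x $ i + e) *\<^sub>R (c *\<^sub>R axis i 1)"] simp del: vector_scaleR_component scaleR_scaleR)
qed

text \<open>Factors \<open>exp (-1 / ((n + 1) (x\<^sub>i - a\<^sub>i)))\<close> and \<open>exp (-1 / ((n + 1) (b\<^sub>i - x\<^sub>i)))\<close> tend to 1 as \<open>n\<close> grows, so
  these smooth functions with values in \<open>[0, 1]\<close> converge to the indicator of the box. The arguments are
  written as affine functions of \<open>x\<^sub>i\<close>, the form in which \<open>Ck_fun_flat_exp\<close> treats them.\<close>

definition box_bump :: "nat \<Rightarrow> real^'d \<Rightarrow> real^'d \<Rightarrow> real^'d \<Rightarrow> real" where
  "box_bump n a b x = (\<Prod>i\<in>UNIV. flat_exp 0 (real (Suc n) * x $ i + (- real (Suc n) * a $ i))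
     * flat_exp 0 ((- real (Suc n)) * x $ i + real (Suc n) * b $ i))"

lemma box_bump_outside: "x \<notin> box a b \<Longrightarrow> box_bump n a b x = 0"
proof -
  assume "x \<notin> box a b"
  then obtain i where i: "x $ i \<le> a $ i \<or> b $ i \<le> x $ i" by (auto simp: mem_box_cart not_less)
  have "flat_exp 0 (real (Suc n) * x $ i + (- real (Suc n) * a $ i))
     * flat_exp 0 ((- real (Suc n)) * x $ i + real (Suc n) * b $ i) = 0"
    using i
  proof
    assume "x $ i \<le> a $ i"
    then have "real (Suc n) * x $ i \<le> real (Suc n) * a $ i" by (intro mult_left_mono) auto
    then have "\<not> 0 < real (Suc n) * x $ i + (- real (Suc n) * a $ i)"
      by linarith
    then show ?thesis by (simp only: flat_exp_def if_False mult_zero_left)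
  next
    assume "b $ i \<le> x $ i"
    then have "real (Suc n) * b $ i \<le> real (Suc n) * x $ i" by (intro mult_left_mono) auto
    then have "\<not> 0 < (- real (Suc n)) * x $ i + real (Suc n) * b $ i"
      by linarith
    then show ?thesis by (simp only: flat_exp_def if_False mult_zero_right)
  qed
  then show ?thesis unfolding box_bump_def by (intro prod_zero) auto
qed

lemma box_bump_bounds: "0 \<le> box_bump n a b x" "box_bump n a b x \<le> 1"
proof -
  have *: "0 \<le> flat_exp 0 y" "flat_exp 0 y \<le> 1" for y by (auto simp: flat_exp_def)
  show "0 \<le> box_bump n a b x" unfolding box_bump_def
    by (intro prod_nonneg mult_nonneg_nonneg) (rule *)+
  show "box_bump n a b x \<le> 1" unfolding box_bump_def
    by (intro prod_le_1 conjI mult_nonneg_nonneg mult_le_one) (rule *)+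
qed

lemma box_bump_tendsto: "(\<lambda>n. box_bump n a b x) \<longlonglongrightarrow> indicator (box a b) x"
proof (cases "x \<in> box a b")
  case True
  have *: "(\<lambda>n. flat_exp 0 (real (Suc n) * d)) \<longlonglongrightarrow> 1" if "d > 0" for d :: real
  proof -
    have "(\<lambda>n. exp (- (inverse (real (Suc n)) * inverse d))) \<longlonglongrightarrow> exp (- (0 * inverse d))"
      by (intro tendsto_intros LIMSEQ_inverse_real_of_nat)
    moreover have "flat_exp 0 (real (Suc n) * d) = exp (- (inverse (real (Suc n)) * inverse d))" for n
      using that by (simp add: flat_exp_def zero_less_mult_iff del: of_nat_Suc)
    ultimately show ?thesis by simp
  qed
  have "(\<lambda>n. box_bump n a b x) \<longlonglongrightarrow> (\<Prod>i\<in>(UNIV::'a set). 1 * 1)"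
    unfolding box_bump_def
  proof (intro tendsto_prod tendsto_mult)
    fix i
    have i: "a $ i < x $ i" "x $ i < b $ i" using True by (auto simp: mem_box_cart)
    show "(\<lambda>n. flat_exp 0 (real (Suc n) * x $ i + (- real (Suc n) * a $ i))) \<longlonglongrightarrow> 1"
      using *[of "x $ i - a $ i"] i by (simp add: algebra_simps)
    show "(\<lambda>n. flat_exp 0 ((- real (Suc n)) * x $ i + real (Suc n) * b $ i)) \<longlonglongrightarrow> 1"
      using *[of "b $ i - x $ i"] i by (simp add: algebra_simps)
  qed
  then show ?thesis using True by simp
qed (simp add: box_bump_outside)

lemma box_bump_test_fun:
  assumes "cbox a b \<subseteq> \<Omega>"
  shows "box_bump n a b \<in> test_fun \<Omega>"
proof -
  have sub: "closure {x. box_bump n a b x \<noteq> 0} \<subseteq> cbox a b"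
    using box_bump_outside box_subset_cbox by (intro closure_minimal) (auto, blast)
  moreover have "compact (closure {x. box_bump n a b x \<noteq> 0})"
    using sub compact_cbox closed_closure by (metis compact_Int_closed inf.absorb_iff2)
  moreover have "Ck_fun k (box_bump n a b)" for k
    unfolding box_bump_def[abs_def] by (intro Ck_fun_prod Ck_fun_mult Ck_fun_flat_exp) auto
  ultimately show ?thesis using assms by (auto simp: test_fun_def)
qed

section \<open>Functions as vectors and the space of square integrable functions\<close>

text \<open>With pointwise operations the functions on the whole space form a real vector space, so that
  subspaces and spans are available for the function spaces below.\<close>

instantiation "fun" :: (type, real_vector) real_vector
begin

definition scaleR_fun_def: "c *\<^sub>R f = (\<lambda>x. c *\<^sub>R f x)"

instance
  by standard (simp_all add: scaleR_fun_def fun_eq_iff algebra_simps)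

end

lemma scaleR_fun_apply [simp]: "(c *\<^sub>R f) x = c *\<^sub>R f x"
  by (simp add: scaleR_fun_def)

lemma sum_fun_apply: "(\<Sum>i\<in>I. f i) x = (\<Sum>i\<in>I. f i x)"
  by (induction I rule: infinite_finite_induct) simp_all

lemma L2_integrable_mult:
  assumes "u \<in> L2 \<Omega>" "v \<in> L2 \<Omega>"
  shows "integrable (lebesgue_on \<Omega>) (\<lambda>x. u x * v x)"
proof (rule Bochner_Integration.integrable_bound)
  show "integrable (lebesgue_on \<Omega>) (\<lambda>x. (u x)\<^sup>2 + (v x)\<^sup>2)"
    using assms by (auto simp: L2_def)
  show "(\<lambda>x. u x * v x) \<in> borel_measurable (lebesgue_on \<Omega>)"
    using assms by (auto simp: L2_def)
  have "norm (a * b) \<le> norm (a\<^sup>2 + b\<^sup>2)" for a b :: real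
  proof -
    have "0 \<le> (\<bar>a\<bar> - \<bar>b\<bar>)\<^sup>2" "0 \<le> a\<^sup>2" "0 \<le> b\<^sup>2" by auto
    then have "2 * \<bar>a * b\<bar> \<le> a\<^sup>2 + b\<^sup>2" by (simp add: power2_diff abs_mult)
    then show ?thesis by auto
  qed
  then show "AE x in lebesgue_on \<Omega>. norm (u x * v x) \<le> norm ((u x)\<^sup>2 + (v x)\<^sup>2)" by simp
qed

lemma L2_add: "u \<in> L2 \<Omega> \<Longrightarrow> v \<in> L2 \<Omega> \<Longrightarrow> (\<lambda>x. u x + v x) \<in> L2 \<Omega>"
  using L2_integrable_mult[of u \<Omega> v] by (auto simp: L2_def power2_sum mult.assoc)

lemma L2_scale: "u \<in> L2 \<Omega> \<Longrightarrow> (\<lambda>x. c * u x) \<in> L2 \<Omega>"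
  by (auto simp: L2_def power_mult_distrib)

lemma L2_diff: "u \<in> L2 \<Omega> \<Longrightarrow> v \<in> L2 \<Omega> \<Longrightarrow> (\<lambda>x. u x - v x) \<in> L2 \<Omega>"
  using L2_add[of u \<Omega> "\<lambda>x. -1 * v x"] L2_scale[of v \<Omega> "-1"] by simp

lemma L2_zero: "(\<lambda>x. 0) \<in> L2 \<Omega>"
  by (auto simp: L2_def)

lemma subspace_L2: "subspace (L2 \<Omega>)"
  by (auto simp: subspace_def plus_fun_def scaleR_fun_def zero_fun_def L2_zero intro: L2_add L2_scale)

lemma L2_inner_psd: "psd_form (L2 \<Omega>) (L2_inner \<Omega>)"
proof
  show "subspace (L2 \<Omega>)" by (rule subspace_L2)
  show "L2_inner \<Omega> (x + y) z = L2_inner \<Omega> x z + L2_inner \<Omega> y z"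
    if "x \<in> L2 \<Omega>" "y \<in> L2 \<Omega>" "z \<in> L2 \<Omega>" for x y z
    using that unfolding L2_inner_def
    by (simp add: distrib_right L2_integrable_mult)
  show "L2_inner \<Omega> (c *\<^sub>R x) y = c * L2_inner \<Omega> x y" for x y c
    unfolding L2_inner_def by (simp add: mult.assoc)
  show "L2_inner \<Omega> x y = L2_inner \<Omega> y x" for x y
    unfolding L2_inner_def by (simp add: mult.commute)
  show "L2_inner \<Omega> x x \<ge> 0" for x
    unfolding L2_inner_def by (intro Bochner_Integration.integral_nonneg) simp
qed

lemma L2_inner_cong_AE:
  assumes "AE x in lebesgue_on \<Omega>. u x = u' x" "u \<in> L2 \<Omega>" "u' \<in> L2 \<Omega>" "v \<in> L2 \<Omega>"
  shows "L2_inner \<Omega> u v = L2_inner \<Omega> u' v"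
  unfolding L2_inner_def
  by (rule integral_cong_AE) (use assms in \<open>auto simp: L2_def\<close>)

lemma bounded_continuous_L2:
  fixes \<Omega> :: "(real^'d) set"
  assumes "open \<Omega>" "bounded \<Omega>" "continuous_on UNIV f"
  shows "f \<in> L2 \<Omega>"
proof -
  have lm: "\<Omega> \<in> lmeasurable" using assms by (intro lmeasurable_open) auto
  then interpret finite_measure "lebesgue_on \<Omega>" by (rule finite_measure_lebesgue_on)
  have m: "f \<in> borel_measurable (lebesgue_on \<Omega>)"
    using assms(3) by (intro continuous_imp_measurable_on_sets_lebesgue) (use lm continuous_on_subset in auto)
  have "compact (f ` closure \<Omega>)"
    using assms by (intro compact_continuous_image) (auto intro: continuous_on_subset simp: compact_closure)
  then obtain B where B: "\<And>x. x \<in> closure \<Omega> \<Longrightarrow> \<bar>f x\<bar> \<le> B"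
    using compact_imp_bounded by (fastforce simp: bounded_iff)
  have "integrable (lebesgue_on \<Omega>) (\<lambda>x. (f x)\<^sup>2)"
  proof (rule integrable_const_bound[of _ "B\<^sup>2"])
    show "AE x in lebesgue_on \<Omega>. norm ((f x)\<^sup>2) \<le> B\<^sup>2"
      using B closure_subset[of \<Omega>] lm
      by (intro AE_I2) (auto simp: space_restrict_space abs_le_square_iff[symmetric] power2_abs intro: power_mono[of "\<bar>f _\<bar>" B 2, simplified])
  qed (use m in auto)
  with m show ?thesis by (auto simp: L2_def)
qed

lemma L2_integrable:
  fixes \<Omega> :: "(real^'d) set"
  assumes "open \<Omega>" "bounded \<Omega>" "f \<in> L2 \<Omega>"
  shows "integrable (lebesgue_on \<Omega>) f"
  using L2_integrable_mult[OF assms(3) bounded_continuous_L2[OF assms(1,2), of "\<lambda>x. 1"]] by simp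

section \<open>The fundamental lemma of the calculus of variations\<close>

lemma enn2real_eq_imp_eq:
  assumes "a \<noteq> \<infinity>" "b \<noteq> \<infinity>" "enn2real a = enn2real b"
  shows "a = b"
  using assms by (cases a rule: ennreal_cases; cases b rule: ennreal_cases) auto

text \<open>The positive and negative parts of \<open>h\<close> are densities of two measures that agree on open boxes, which
  form an intersection-stable generator of the Borel sets; so they agree, and densities are unique.\<close>

lemma AE_zero_of_box_integrals:
  fixes h :: "'a::euclidean_space \<Rightarrow> real"
  assumes int: "integrable lborel h"
    and box: "\<And>c d. (\<integral>x. indicator (box c d) x * h x \<partial>lborel) = 0"
  shows "AE x in lborel. h x = 0"
proof -
  have m: "h \<in> borel_measurable lborel" using int by auto
  define N where "N s = density lborel (\<lambda>x. ennreal (s * h x))" for s :: real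
  have fin: "(\<integral>\<^sup>+ x. ennreal (s * f x) \<partial>lborel) \<noteq> \<infinity>" if "integrable lborel f" for s and f :: "'a \<Rightarrow> real"
  proof -
    have "integrable lborel (\<lambda>x. s * f x)" using that by simp
    then show ?thesis unfolding real_integrable_def by auto
  qed
  have emN: "emeasure (N s) (box c d) = (\<integral>\<^sup>+ x. ennreal (s * (indicator (box c d) x * h x)) \<partial>lborel)" for s c d
    unfolding N_def using m by (subst emeasure_density) (auto intro!: nn_integral_cong simp: indicator_def)
  have intb: "integrable lborel (\<lambda>x. indicator (box c d) x * h x)" for c d
    using integrable_mult_indicator[OF _ int, of "box c d"] by simp
  have "N 1 = N (-1)"
  proof (rule measure_eqI_generator_eq)
    let ?E = "range (\<lambda>(a, b). box a b::'a set)"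
    show "Int_stable ?E" by (auto simp: Int_stable_def box_Int_box)
    show "?E \<subseteq> Pow UNIV" "sets (N 1) = sigma_sets UNIV ?E" "sets (N (-1)) = sigma_sets UNIV ?E"
      by (simp_all add: borel_eq_box N_def)
    let ?A = "\<lambda>n::nat. box (- (real n *\<^sub>R One)) (real n *\<^sub>R One) :: 'a set"
    show "range ?A \<subseteq> ?E" "(\<Union>i. ?A i) = UNIV" unfolding UN_box_eq_UNIV by auto
    show "emeasure (N 1) (?A i) \<noteq> \<infinity>" for i unfolding emN by (rule fin[OF intb])
    fix X assume "X \<in> ?E"
    then obtain c d where X: "X = box c d" by auto
    let ?f = "\<lambda>x. indicator (box c d) x * h x"
    have "0 = enn2real (\<integral>\<^sup>+ x. ennreal (?f x) \<partial>lborel) - enn2real (\<integral>\<^sup>+ x. ennreal (- ?f x) \<partial>lborel)"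
      using real_lebesgue_integral_def[OF intb[of c d]] box by simp
    then have "enn2real (\<integral>\<^sup>+ x. ennreal (?f x) \<partial>lborel) = enn2real (\<integral>\<^sup>+ x. ennreal (- ?f x) \<partial>lborel)" by simp
    then have "(\<integral>\<^sup>+ x. ennreal (?f x) \<partial>lborel) = (\<integral>\<^sup>+ x. ennreal (- ?f x) \<partial>lborel)"
      using fin[OF intb[of c d], of 1] fin[OF intb[of c d], of "-1"]
      by (intro enn2real_eq_imp_eq) (simp_all only: mult_1 mult_minus1 not_False_eq_True)
    then show "emeasure (N 1) X = emeasure (N (-1)) X" unfolding X emN by simp
  qed
  then have "AE x in lborel. ennreal (h x) = ennreal (- h x)"
    unfolding N_def using m by (subst (asm) sigma_finite_measure.density_unique_iff[OF sigma_finite_lborel]) auto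
  then show ?thesis
  proof eventually_elim
    case (elim x)
    then show ?case by (cases "h x \<ge> 0") (auto simp: ennreal_neg)
  qed
qed

text \<open>Dominated convergence along \<open>box_bump\<close> shows that \<open>g\<close> has integral zero over every box whose closure
  lies in \<open>\<Omega>\<close>. So \<open>g\<close> vanishes almost everywhere on each such box, and countably many of them cover \<open>\<Omega>\<close>.\<close>

lemma fundamental_lemma:
  fixes \<Omega> :: "(real^'d) set"
  assumes "open \<Omega>" and int: "integrable (lebesgue_on \<Omega>) g"
    and test: "\<And>\<phi>. \<phi> \<in> test_fun \<Omega> \<Longrightarrow> (\<integral>x. g x * \<phi> x \<partial>lebesgue_on \<Omega>) = 0"
  shows "AE x in lebesgue_on \<Omega>. g x = 0"
proof -
  have \<Omega>: "\<Omega> \<in> sets lebesgue" using borel_open[OF assms(1)] by auto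
  have g': "integrable lebesgue (\<lambda>x. indicator \<Omega> x * g x)"
    using int integrable_restrict_space[of \<Omega> lebesgue g] \<Omega> by simp
  have box0: "(\<integral>x. indicator (box a b) x * g x \<partial>lebesgue_on \<Omega>) = 0" if "cbox a b \<subseteq> \<Omega>" for a b
  proof -
    have gm: "g \<in> borel_measurable (lebesgue_on \<Omega>)" using int by auto
    have bm: "box_bump n a b \<in> borel_measurable (lebesgue_on \<Omega>)" for n
    proof -
      have "Ck_fun 0 (box_bump n a b)" using box_bump_test_fun[OF that] by (simp only: test_fun_def) blast
      then show ?thesis
        by (intro continuous_imp_measurable_on_sets_lebesgue) (use \<Omega> continuous_on_subset in auto)
    qed
    have im: "(indicator (box a b) :: _ \<Rightarrow> real) \<in> borel_measurable (lebesgue_on \<Omega>)"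
      by (rule borel_measurable_LIMSEQ_real[OF box_bump_tendsto bm])
    have "(\<lambda>n. \<integral>x. box_bump n a b x * g x \<partial>lebesgue_on \<Omega>)
        \<longlonglongrightarrow> (\<integral>x. indicator (box a b) x * g x \<partial>lebesgue_on \<Omega>)"
    proof (rule integral_dominated_convergence[where w = "\<lambda>x. norm (g x)"])
      show "AE x in lebesgue_on \<Omega>. norm (box_bump n a b x * g x) \<le> norm (g x)" for n
        by (intro AE_I2) (auto simp: abs_mult box_bump_bounds intro!: mult_left_le_one_le)
      show "AE x in lebesgue_on \<Omega>. (\<lambda>n. box_bump n a b x * g x) \<longlonglongrightarrow> indicator (box a b) x * g x"
        by (intro AE_I2 tendsto_intros box_bump_tendsto)
    qed (use gm bm im int in auto)
    moreover have "(\<integral>x. box_bump n a b x * g x \<partial>lebesgue_on \<Omega>) = 0" for n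
      using test[OF box_bump_test_fun[OF that, of n]] by (simp add: mult.commute)
    ultimately have "(\<lambda>n::nat. 0) \<longlonglongrightarrow> (\<integral>x. indicator (box a b) x * g x \<partial>lebesgue_on \<Omega>)" by simp
    then show ?thesis by (simp add: LIMSEQ_const_iff)
  qed
  have ae: "AE x in lebesgue. x \<in> box a b \<longrightarrow> g x = 0" if ab: "cbox a b \<subseteq> \<Omega>" for a b
  proof -
    define h0 where "h0 x = indicator (box a b) x * g x" for x
    have h0': "h0 x = indicator (box a b) x * (indicator \<Omega> x * g x)" for x
      using ab box_subset_cbox[of a b] by (auto simp: h0_def indicator_def)
    have h0: "integrable lebesgue h0"
      unfolding h0'[abs_def] using integrable_mult_indicator[OF _ g', of "box a b"] by simp
    obtain h where h: "h \<in> borel_measurable lborel" "AE x in lborel. h0 x = h x"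
      using completion_ex_borel_measurable_real[OF borel_measurable_integrable[OF h0]] by blast
    have h2: "AE x in lebesgue. h0 x = h x" using h(2) by (rule AE_completion)
    have hm: "h \<in> borel_measurable lebesgue" using h(1) by (rule measurable_completion)
    have "integrable lebesgue h"
      using h0 h2 hm by (subst integrable_cong_AE[of h _ h0]) (auto elim: eventually_mono)
    then have hi: "integrable lborel h" using integrable_completion[OF h(1)] by simp
    have "AE x in lborel. h x = 0"
    proof (rule AE_zero_of_box_integrals[OF hi])
      fix c d
      have "(\<integral>x. indicator (box c d) x * h x \<partial>lborel) = (\<integral>x. indicator (box c d) x * h x \<partial>lebesgue)"
        using h(1) by (intro integral_completion[symmetric]) auto
      also have "\<dots> = (\<integral>x. indicator (box c d) x * h0 x \<partial>lebesgue)"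
      proof (intro integral_cong_AE borel_measurable_times hm borel_measurable_integrable[OF h0])
        show "AE x in lebesgue. indicat_real (box c d) x * h x = indicat_real (box c d) x * h0 x"
          using h2 by eventually_elim simp
      qed (auto intro!: borel_measurable_indicator)
      also have "\<dots> = 0"
      proof -
        obtain e f where ef: "box a b \<inter> box c d = box e f" using box_Int_box by blast
        have "(\<integral>x. indicator (box c d) x * h0 x \<partial>lebesgue)
            = (\<integral>x. indicator \<Omega> x *\<^sub>R (indicator (box e f) x * g x) \<partial>lebesgue)"
          unfolding ef[symmetric] h0'
          by (intro Bochner_Integration.integral_cong) (auto simp: indicator_def)
        also have "\<dots> = (\<integral>x. indicator (box e f) x * g x \<partial>lebesgue_on \<Omega>)"
          using \<Omega> by (intro integral_restrict_space[symmetric]) simp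
        also have "\<dots> = 0"
        proof (cases "box e f = {}")
          case False
          have "cbox e f = closure (box e f)" using False by (simp add: closure_box)
          also have "\<dots> \<subseteq> closure (box a b)" using ef by (intro closure_mono) auto
          also have "\<dots> \<subseteq> cbox a b" by (intro closure_minimal box_subset_cbox) auto
          finally show ?thesis using ab by (intro box0) auto
        qed simp
        finally show ?thesis .
      qed
      finally show "(\<integral>x. indicator (box c d) x * h x \<partial>lborel) = 0" .
    qed
    then have "AE x in lebesgue. h x = 0" by (rule AE_completion)
    with h2 show ?thesis by eventually_elim (auto simp: h0_def indicator_def split: if_splits)
  qed
  let ?F = "{box a b | a b. cbox a b \<subseteq> \<Omega>}"
  obtain F where F: "F \<subseteq> ?F" "countable F" "\<Union>F = \<Union>?F"
    using Lindelof[of ?F] by (auto simp: open_box)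
  have cover: "\<Omega> \<subseteq> \<Union>F"
  proof
    fix x assume "x \<in> \<Omega>"
    then obtain a b where "x \<in> box a b" "cbox a b \<subseteq> \<Omega>"
      using open_contains_cbox[OF assms(1)] by metis
    then show "x \<in> \<Union>F" using F(3) by auto
  qed
  have "AE x in lebesgue. \<forall>X\<in>F. x \<in> X \<longrightarrow> g x = 0"
    using F ae by (subst AE_ball_countable) auto
  then have "AE x in lebesgue. x \<in> \<Omega> \<longrightarrow> g x = 0"
    by eventually_elim (use cover in blast)
  then show ?thesis using \<Omega> by (simp add: AE_restrict_space_iff)
qed

section \<open>Weak gradients\<close>

lemma lborel_integral_translate:
  fixes F :: "'a::euclidean_space \<Rightarrow> real"
  assumes "continuous_on UNIV F"
  shows "(\<integral>x. F (x + c) \<partial>lborel) = (\<integral>x. F x \<partial>lborel)"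
proof -
  have "F \<in> borel_measurable borel" using assms by (rule borel_measurable_continuous_onI)
  then have "(\<integral>x. F x \<partial>distr lborel borel ((+) c)) = (\<integral>x. F (c + x) \<partial>lborel)"
    by (intro integral_distr) auto
  then show ?thesis by (simp add: lborel_distr_plus add.commute)
qed

lemma integrable_continuous_compact_support:
  fixes F :: "'a::euclidean_space \<Rightarrow> real"
  assumes "continuous_on UNIV F" "compact K" "\<And>x. x \<notin> K \<Longrightarrow> F x = 0"
  shows "integrable lborel F"
proof -
  have "integrable lborel (\<lambda>x. indicator K x *\<^sub>R F x)"
    using borel_integrable_compact[OF assms(2), of F] assms(1)
    by (simp add: set_integrable_def continuous_on_subset[OF _ subset_UNIV])
  moreover have "(\<lambda>x. indicator K x *\<^sub>R F x) = F" using assms(3) by (auto simp: indicator_def fun_eq_iff)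
  ultimately show ?thesis by simp
qed

lemma GDERIV_zero_outside:
  assumes "\<And>x. GDERIV F x :> G x" "closed K" "\<And>x. x \<notin> K \<Longrightarrow> F x = 0" "x \<notin> K"
  shows "G x = 0"
proof -
  have "\<forall>\<^sub>F y in nhds x. F y = 0"
    using eventually_nhds_in_open[of "- K" x] assms by (auto simp: open_Compl elim: eventually_mono)
  then have "(F has_derivative (\<lambda>h. 0)) (at x)"
    by (intro has_derivative_transform_eventually[of "\<lambda>_. 0", OF has_derivative_const])
      (auto simp: assms(3,4) eventually_at_filter elim: eventually_mono)
  moreover have "(F has_derivative (\<lambda>h. inner h (G x))) (at x)"
    using assms(1) by (simp add: gderiv_def)
  ultimately have "(\<lambda>h. inner h (G x)) = (\<lambda>h. 0)" by (rule has_derivative_unique[THEN sym])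
  then have "inner (G x) (G x) = 0" by metis
  then show ?thesis by simp
qed

text \<open>The integral of a difference quotient is zero by translation invariance. The quotients are dominated,
  by the mean value theorem and the compact support, so their limit has integral zero too. This is
  integration by parts without Fubini.\<close>

lemma integral_partial_derivative_zero:
  fixes F :: "real^'d \<Rightarrow> real"
  assumes G: "\<And>x. GDERIV F x :> G x" and cG: "continuous_on UNIV (\<lambda>x. G x $ i)"
    and K: "compact K" "\<And>x. x \<notin> K \<Longrightarrow> F x = 0"
  shows "(\<integral>x. G x $ i \<partial>lborel) = 0"
proof -
  define e where "e = (axis i 1 :: real^'d)"
  have G0: "x \<notin> K \<Longrightarrow> G x $ i = 0" for x
    using GDERIV_zero_outside[OF G compact_imp_closed[OF K(1)] K(2), of x] by simp
  have cF: "continuous_on UNIV F"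
    using G unfolding gderiv_def
    by (meson differentiableI differentiable_imp_continuous_within continuous_at_imp_continuous_on)
  have "compact ((\<lambda>x. G x $ i) ` K)"
    using cG K(1) by (intro compact_continuous_image) (auto intro: continuous_on_subset)
  then obtain B0 where B0: "\<And>x. x \<in> K \<Longrightarrow> \<bar>G x $ i\<bar> \<le> B0"
    using compact_imp_bounded by (fastforce simp: bounded_iff)
  define B where "B = max B0 0"
  have B: "\<bar>G x $ i\<bar> \<le> B" for x using B0[of x] G0[of x] by (cases "x \<in> K") (auto simp: B_def)
  obtain R where R: "\<And>x. x \<in> K \<Longrightarrow> norm x \<le> R" using compact_imp_bounded[OF K(1)] by (auto simp: bounded_iff)
  have line: "((\<lambda>t. F (x + t *\<^sub>R e)) has_real_derivative G (x + t *\<^sub>R e) $ i) (at t)" for x t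
  proof -
    have "(F has_derivative (\<lambda>h. inner h (G (x + t *\<^sub>R e)))) (at (x + t *\<^sub>R e))"
      using G by (simp add: gderiv_def)
    then have "((\<lambda>t. F (x + t *\<^sub>R e)) has_derivative (\<lambda>s. inner (s *\<^sub>R e) (G (x + t *\<^sub>R e)))) (at t)"
      by (rule has_derivative_compose[rotated]) (auto intro!: derivative_eq_intros)
    then show ?thesis by (simp add: has_field_derivative_def e_def inner_axis' mult.commute[of _ "_ $ _"])
  qed
  define h where "h n = inverse (real (Suc n))" for n
  have h: "0 < h n" "h n \<le> 1" for n by (auto simp: h_def inverse_eq_divide)
  define D where "D n x = (F (x + h n *\<^sub>R e) - F x) / h n" for n x
  have "(\<lambda>n. \<integral>x. D n x \<partial>lborel) \<longlonglongrightarrow> (\<integral>x. G x $ i \<partial>lborel)"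
  proof (rule integral_dominated_convergence[where w = "\<lambda>x. B * indicator (cball 0 (R + 1)) x"])
    show "(\<lambda>x. G x $ i) \<in> borel_measurable lborel"
      using borel_measurable_continuous_onI[OF cG] by simp
    have "F \<in> borel_measurable borel" using cF by (rule borel_measurable_continuous_onI)
    then show "D n \<in> borel_measurable lborel" for n unfolding D_def[abs_def] by measurable
    show "integrable lborel (\<lambda>x. B * indicator (cball 0 (R + 1)) x :: real)"
      by (intro integrable_mult_right integrable_real_indicator) (auto intro: emeasure_bounded_finite simp del: infinity_ennreal_def)
    show "AE x in lborel. (\<lambda>n. D n x) \<longlonglongrightarrow> G x $ i"
    proof (intro AE_I2)
      fix x
      have "((\<lambda>s. (F (x + s *\<^sub>R e) - F x) / s) \<longlongrightarrow> G x $ i) (at 0)"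
        using line[of x 0] by (simp add: DERIV_def)
      moreover have "filterlim h (at 0) sequentially"
        using LIMSEQ_inverse_real_of_nat h(1)
        by (auto simp: filterlim_at h_def[abs_def] eventually_sequentially)
      ultimately show "(\<lambda>n. D n x) \<longlonglongrightarrow> G x $ i"
        unfolding D_def by (rule filterlim_compose)
    qed
    show "AE x in lborel. norm (D n x) \<le> B * indicator (cball 0 (R + 1)) x" for n
    proof (intro AE_I2)
      fix x
      obtain s where s: "0 < s" "s < h n" "F (x + h n *\<^sub>R e) - F (x + 0 *\<^sub>R e) = (h n - 0) * G (x + s *\<^sub>R e) $ i"
        using MVT2[OF h(1)[of n] line[of x]] by blast
      then have D: "D n x = G (x + s *\<^sub>R e) $ i" using h(1)[of n] by (simp add: D_def)
      show "norm (D n x) \<le> B * indicator (cball 0 (R + 1)) x"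
      proof (cases "x \<in> cball 0 (R + 1)")
        case True
        then show ?thesis using B D by simp
      next
        case False
        then have "norm x > R + 1" by simp
        moreover have "norm x \<le> norm (x + s *\<^sub>R e) + norm (s *\<^sub>R e)"
          using norm_triangle_ineq4[of "x + s *\<^sub>R e" "s *\<^sub>R e"] by simp
        moreover have "norm (s *\<^sub>R e) \<le> 1" using s h(2)[of n] by (simp add: e_def)
        ultimately have "x + s *\<^sub>R e \<notin> K" using R[of "x + s *\<^sub>R e"] by auto
        then show ?thesis using D G0 False by simp
      qed
    qed
  qed
  moreover have "(\<integral>x. D n x \<partial>lborel) = 0" for n
  proof -
    have i1: "integrable lborel F" using cF K by (rule integrable_continuous_compact_support)
    have i2: "integrable lborel (\<lambda>x. F (x + h n *\<^sub>R e))"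
    proof (rule integrable_continuous_compact_support)
      show "continuous_on UNIV (\<lambda>x. F (x + h n *\<^sub>R e))"
        by (rule continuous_on_compose2[OF cF]) (auto intro: continuous_intros)
      show "compact ((\<lambda>x. x - h n *\<^sub>R e) ` K)" using K(1) by (intro compact_continuous_image continuous_intros)
      show "F (x + h n *\<^sub>R e) = 0" if "x \<notin> (\<lambda>x. x - h n *\<^sub>R e) ` K" for x
        using that by (intro K(2)) (auto simp: image_iff)
    qed
    have "(\<integral>x. D n x \<partial>lborel) = ((\<integral>x. F (x + h n *\<^sub>R e) \<partial>lborel) - (\<integral>x. F x \<partial>lborel)) / h n"
      unfolding D_def using i1 i2 by simp
    then show ?thesis using lborel_integral_translate[OF cF] by simp
  qed
  ultimately have "(\<lambda>n::nat. 0) \<longlonglongrightarrow> (\<integral>x. G x $ i \<partial>lborel)" by simp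
  then show ?thesis by (simp add: LIMSEQ_const_iff)
qed

lemma test_fun_gradient:
  assumes "\<phi> \<in> test_fun \<Omega>"
  obtains g where "\<And>x. GDERIV \<phi> x :> g x" "\<And>i. continuous_on UNIV (\<lambda>x. g x $ i)"
    "\<And>x i. frechet_derivative \<phi> (at x) (axis i 1) = g x $ i"
proof -
  have "Ck_fun (Suc 0) \<phi>" using assms by (simp only: test_fun_def) blast
  then obtain g where g: "\<And>x. GDERIV \<phi> x :> g x" "\<And>i. continuous_on UNIV (\<lambda>x. g x $ i)" by auto
  have "frechet_derivative \<phi> (at x) (axis i 1) = g x $ i" for x i
  proof -
    have "(\<phi> has_derivative (\<lambda>h. inner h (g x))) (at x)" using g(1) by (simp add: gderiv_def)
    then have "frechet_derivative \<phi> (at x) = (\<lambda>h. inner h (g x))" by (rule frechet_derivative_at[symmetric])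
    then show ?thesis by (simp add: inner_axis')
  qed
  then show ?thesis by (rule that[OF g])
qed

lemma test_fun_continuous:
  assumes "\<phi> \<in> test_fun \<Omega>"
  shows "continuous_on UNIV \<phi>"
proof -
  have "Ck_fun 0 \<phi>" using assms by (simp only: test_fun_def) blast
  then show ?thesis by simp
qed

lemma test_fun_lincomb:
  assumes "\<phi> \<in> test_fun \<Omega>" "\<psi> \<in> test_fun \<Omega>"
  shows "(\<lambda>x. \<phi> x + c * \<psi> x) \<in> test_fun \<Omega>"
proof -
  have *: "closure {x. \<phi> x + c * \<psi> x \<noteq> 0} \<subseteq> closure {x. \<phi> x \<noteq> 0} \<union> closure {x. \<psi> x \<noteq> 0}"
    unfolding closure_Un[symmetric] by (intro closure_mono) auto
  have "compact (closure {x. \<phi> x \<noteq> 0} \<union> closure {x. \<psi> x \<noteq> 0})"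
    using assms by (auto simp: test_fun_def)
  then have "compact ((closure {x. \<phi> x \<noteq> 0} \<union> closure {x. \<psi> x \<noteq> 0}) \<inter> closure {x. \<phi> x + c * \<psi> x \<noteq> 0})"
    by (rule compact_Int_closed) (rule closed_closure)
  then have "compact (closure {x. \<phi> x + c * \<psi> x \<noteq> 0})"
    by (simp only: Int_absorb1[OF *])
  moreover have "Ck_fun n (\<lambda>x. \<phi> x + c * \<psi> x)" for n
    using assms by (intro Ck_fun_add Ck_fun_mult Ck_fun_const) (auto simp: test_fun_def)
  ultimately show ?thesis using * assms by (auto simp: test_fun_def)
qed

context
  fixes \<Omega> :: "(real^'d) set"
  assumes \<Omega>: "open \<Omega>" "bounded \<Omega>"
begin

lemma test_fun_L2: "\<phi> \<in> test_fun \<Omega> \<Longrightarrow> \<phi> \<in> L2 \<Omega>"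
  by (intro bounded_continuous_L2 \<Omega> test_fun_continuous)

lemma test_fun_deriv_L2: "\<phi> \<in> test_fun \<Omega> \<Longrightarrow> (\<lambda>x. frechet_derivative \<phi> (at x) (axis i 1)) \<in> L2 \<Omega>"
  by (erule test_fun_gradient) (auto intro!: bounded_continuous_L2 \<Omega>)

text \<open>This is what makes \<open>weak_grad\<close>, a choice from all weak gradients, linear up to null sets.\<close>

lemma has_weak_gradient_unique:
  assumes "has_weak_gradient \<Omega> u g" "has_weak_gradient \<Omega> u h"
  shows "AE x in lebesgue_on \<Omega>. g x = h x"
proof -
  have "AE x in lebesgue_on \<Omega>. g x $ i - h x $ i = 0" for i
  proof (rule fundamental_lemma[OF \<Omega>(1)])
    have L: "(\<lambda>x. g x $ i) \<in> L2 \<Omega>" "(\<lambda>x. h x $ i) \<in> L2 \<Omega>"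
      using assms by (auto simp: has_weak_gradient_def)
    then show "integrable (lebesgue_on \<Omega>) (\<lambda>x. g x $ i - h x $ i)"
      by (intro L2_integrable \<Omega> L2_diff)
    fix \<phi> assume \<phi>: "\<phi> \<in> test_fun \<Omega>"
    have "(\<integral>x. g x $ i * \<phi> x \<partial>lebesgue_on \<Omega>) = (\<integral>x. h x $ i * \<phi> x \<partial>lebesgue_on \<Omega>)"
      using assms \<phi> by (simp add: has_weak_gradient_def)
    then show "(\<integral>x. (g x $ i - h x $ i) * \<phi> x \<partial>lebesgue_on \<Omega>) = 0"
      using L2_integrable_mult[OF L(1) test_fun_L2[OF \<phi>]] L2_integrable_mult[OF L(2) test_fun_L2[OF \<phi>]]
      by (simp add: left_diff_distrib)
  qed
  then have "AE x in lebesgue_on \<Omega>. \<forall>i\<in>UNIV. g x $ i - h x $ i = 0"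
    by (intro AE_finite_allI) auto
  then show ?thesis by eventually_elim (simp add: vec_eq_iff)
qed

lemma has_weak_gradient_lincomb:
  assumes "u \<in> L2 \<Omega>" "v \<in> L2 \<Omega>" "has_weak_gradient \<Omega> u g" "has_weak_gradient \<Omega> v h"
  shows "has_weak_gradient \<Omega> (\<lambda>x. u x + c * v x) (\<lambda>x. g x + c *\<^sub>R h x)"
  unfolding has_weak_gradient_def
proof (intro conjI allI ballI)
  fix i
  have L: "(\<lambda>x. g x $ i) \<in> L2 \<Omega>" "(\<lambda>x. h x $ i) \<in> L2 \<Omega>"
    using assms by (auto simp: has_weak_gradient_def)
  then show "(\<lambda>x. (g x + c *\<^sub>R h x) $ i) \<in> L2 \<Omega>"
    using L2_add[OF L(1) L2_scale[OF L(2), of c]] by simp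
  fix \<phi> assume \<phi>: "\<phi> \<in> test_fun \<Omega>"
  note d = test_fun_deriv_L2[OF \<phi>, of i] and p = test_fun_L2[OF \<phi>]
  note I = L2_integrable_mult[OF assms(1) d] L2_integrable_mult[OF assms(2) d]
    L2_integrable_mult[OF L(1) p] L2_integrable_mult[OF L(2) p]
  have "(\<integral>x. (u x + c * v x) * frechet_derivative \<phi> (at x) (axis i 1) \<partial>lebesgue_on \<Omega>)
    = (\<integral>x. u x * frechet_derivative \<phi> (at x) (axis i 1) \<partial>lebesgue_on \<Omega>)
      + c * (\<integral>x. v x * frechet_derivative \<phi> (at x) (axis i 1) \<partial>lebesgue_on \<Omega>)"
    using I by (simp add: distrib_right mult.assoc)
  also have "\<dots> = - (\<integral>x. g x $ i * \<phi> x \<partial>lebesgue_on \<Omega>) - c * (\<integral>x. h x $ i * \<phi> x \<partial>lebesgue_on \<Omega>)"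
    using assms \<phi> by (simp add: has_weak_gradient_def)
  also have "\<dots> = - (\<integral>x. (g x + c *\<^sub>R h x) $ i * \<phi> x \<partial>lebesgue_on \<Omega>)"
    using I by (simp add: distrib_right mult.assoc)
  finally show "(\<integral>x. (u x + c * v x) * frechet_derivative \<phi> (at x) (axis i 1) \<partial>lebesgue_on \<Omega>)
    = - (\<integral>x. (g x + c *\<^sub>R h x) $ i * \<phi> x \<partial>lebesgue_on \<Omega>)" .
qed

lemma weak_grad: "u \<in> H1 \<Omega> \<Longrightarrow> has_weak_gradient \<Omega> u (weak_grad \<Omega> u)"
proof -
  assume "u \<in> H1 \<Omega>"
  then have "\<exists>g. has_weak_gradient \<Omega> u g" by (simp add: H1_def)
  from someI_ex[OF this] show ?thesis unfolding weak_grad_def .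
qed

lemma H1_L2: "u \<in> H1 \<Omega> \<Longrightarrow> u \<in> L2 \<Omega>"
  by (simp add: H1_def)

lemma weak_grad_L2: "u \<in> H1 \<Omega> \<Longrightarrow> (\<lambda>x. weak_grad \<Omega> u x $ i) \<in> L2 \<Omega>"
  using weak_grad by (simp add: has_weak_gradient_def)

lemma H1_lincomb:
  assumes "u \<in> H1 \<Omega>" "v \<in> H1 \<Omega>"
  shows "u + c *\<^sub>R v \<in> H1 \<Omega>"
    and "AE x in lebesgue_on \<Omega>. weak_grad \<Omega> (u + c *\<^sub>R v) x = weak_grad \<Omega> u x + c *\<^sub>R weak_grad \<Omega> v x"
proof -
  have eq: "u + c *\<^sub>R v = (\<lambda>x. u x + c * v x)" by auto
  have w: "has_weak_gradient \<Omega> (u + c *\<^sub>R v) (\<lambda>x. weak_grad \<Omega> u x + c *\<^sub>R weak_grad \<Omega> v x)"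
    unfolding eq using assms by (intro has_weak_gradient_lincomb weak_grad H1_L2)
  have "u + c *\<^sub>R v \<in> L2 \<Omega>"
    unfolding eq using assms by (intro L2_add L2_scale H1_L2)
  with w show "u + c *\<^sub>R v \<in> H1 \<Omega>" by (auto simp: H1_def)
  from has_weak_gradient_unique[OF weak_grad[OF this] w]
  show "AE x in lebesgue_on \<Omega>. weak_grad \<Omega> (u + c *\<^sub>R v) x = weak_grad \<Omega> u x + c *\<^sub>R weak_grad \<Omega> v x" .
qed

lemma H1_zero: "0 \<in> H1 \<Omega>"
proof -
  have "has_weak_gradient \<Omega> 0 (\<lambda>x. 0)"
    by (auto simp: has_weak_gradient_def L2_zero)
  then show ?thesis using L2_zero by (auto simp: H1_def zero_fun_def)
qed

lemma subspace_H1: "subspace (H1 \<Omega>)"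
  by (rule subspace_lincombI[OF H1_zero H1_lincomb(1)])

text \<open>The classical gradient is a weak gradient: apply \<open>integral_partial_derivative_zero\<close> to the product
  \<open>\<phi> \<psi>\<close>, whose support is contained in that of \<open>\<phi>\<close>. The approximations in the definition of \<open>H10\<close> are thus
  measured in a norm that really satisfies the triangle inequality.\<close>

lemma test_fun_H1:
  assumes \<phi>: "\<phi> \<in> test_fun \<Omega>"
  shows "\<phi> \<in> H1 \<Omega>"
proof -
  obtain g where g: "\<And>x. GDERIV \<phi> x :> g x" "\<And>i. continuous_on UNIV (\<lambda>x. g x $ i)"
    "\<And>x i. frechet_derivative \<phi> (at x) (axis i 1) = g x $ i" using test_fun_gradient[OF \<phi>] by blast
  have "has_weak_gradient \<Omega> \<phi> g"
    unfolding has_weak_gradient_def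
  proof (intro conjI allI ballI)
    fix i
    show gL: "(\<lambda>x. g x $ i) \<in> L2 \<Omega>" using g(2) by (intro bounded_continuous_L2 \<Omega>)
    fix \<psi> assume \<psi>: "\<psi> \<in> test_fun \<Omega>"
    obtain h where h: "\<And>x. GDERIV \<psi> x :> h x" "\<And>i. continuous_on UNIV (\<lambda>x. h x $ i)"
      "\<And>x i. frechet_derivative \<psi> (at x) (axis i 1) = h x $ i" using test_fun_gradient[OF \<psi>] by blast
    have hL: "(\<lambda>x. h x $ i) \<in> L2 \<Omega>" using h(2) by (intro bounded_continuous_L2 \<Omega>)
    define K where "K = closure {x. \<phi> x \<noteq> 0}"
    have K: "compact K" "K \<subseteq> \<Omega>" using \<phi> by (auto simp: K_def test_fun_def)
    have \<phi>0: "\<phi> x = 0" if "x \<notin> K" for x using that closure_subset[of "{x. \<phi> x \<noteq> 0}"] by (auto simp: K_def)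
    define G where "G x = \<phi> x *\<^sub>R h x + \<psi> x *\<^sub>R g x" for x
    have G: "GDERIV (\<lambda>x. \<phi> x * \<psi> x) x :> G x" for x
      unfolding G_def by (rule GDERIV_mult[OF g(1) h(1)])
    have cG: "continuous_on UNIV (\<lambda>x. G x $ i)"
    proof -
      have "continuous_on UNIV (\<lambda>x. \<phi> x * h x $ i + \<psi> x * g x $ i)"
        by (intro continuous_on_add continuous_on_mult g(2) h(2) test_fun_continuous[OF \<phi>]
            test_fun_continuous[OF \<psi>])
      then show ?thesis by (simp add: G_def)
    qed
    have "(\<integral>x. G x $ i \<partial>lborel) = 0"
      using G cG K(1) by (rule integral_partial_derivative_zero) (simp add: \<phi>0)
    moreover have "(\<integral>x. G x $ i \<partial>lebesgue_on \<Omega>) = (\<integral>x. G x $ i \<partial>lborel)"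
    proof -
      have G0: "G x = 0" if "x \<notin> \<Omega>" for x
        using GDERIV_zero_outside[OF G compact_imp_closed[OF K(1)]] \<phi>0 that K(2) by auto
      have "(\<integral>x. G x $ i \<partial>lebesgue_on \<Omega>) = (\<integral>x. indicator \<Omega> x *\<^sub>R (G x $ i) \<partial>lebesgue)"
        using borel_open[OF \<Omega>(1)] by (intro integral_restrict_space) auto
      also have "\<dots> = (\<integral>x. G x $ i \<partial>lebesgue)"
        using G0 by (intro Bochner_Integration.integral_cong) (auto simp: indicator_def)
      also have "\<dots> = (\<integral>x. G x $ i \<partial>lborel)"
        using borel_measurable_continuous_onI[OF cG] by (intro integral_completion) auto
      finally show ?thesis .
    qed
    ultimately have "(\<integral>x. \<phi> x * h x $ i + g x $ i * \<psi> x \<partial>lebesgue_on \<Omega>) = 0"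
      by (simp add: G_def mult.commute)
    then show "(\<integral>x. \<phi> x * frechet_derivative \<psi> (at x) (axis i 1) \<partial>lebesgue_on \<Omega>)
        = - (\<integral>x. g x $ i * \<psi> x \<partial>lebesgue_on \<Omega>)"
      using L2_integrable_mult[OF test_fun_L2[OF \<phi>] hL] L2_integrable_mult[OF gL test_fun_L2[OF \<psi>]]
      by (simp add: h(3))
  qed
  then show ?thesis using test_fun_L2[OF \<phi>] by (auto simp: H1_def)
qed

definition H1_inner :: "(real^'d \<Rightarrow> real) \<Rightarrow> (real^'d \<Rightarrow> real) \<Rightarrow> real" where
  "H1_inner u v = L2_inner \<Omega> u v
    + (\<Sum>i\<in>UNIV. L2_inner \<Omega> (\<lambda>x. weak_grad \<Omega> u x $ i) (\<lambda>x. weak_grad \<Omega> v x $ i))"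

lemma weak_grad_inner_lincomb:
  assumes "u \<in> H1 \<Omega>" "v \<in> H1 \<Omega>" "w \<in> L2 \<Omega>"
  shows "L2_inner \<Omega> (\<lambda>x. weak_grad \<Omega> (u + c *\<^sub>R v) x $ i) w
    = L2_inner \<Omega> (\<lambda>x. weak_grad \<Omega> u x $ i) w + c * L2_inner \<Omega> (\<lambda>x. weak_grad \<Omega> v x $ i) w"
proof -
  interpret L: psd_form "L2 \<Omega>" "L2_inner \<Omega>" by (rule L2_inner_psd)
  let ?u = "\<lambda>x. weak_grad \<Omega> u x $ i" and ?v = "\<lambda>x. weak_grad \<Omega> v x $ i"
  have L: "?u \<in> L2 \<Omega>" "?v \<in> L2 \<Omega>" using assms by (auto intro: weak_grad_L2)
  have "AE x in lebesgue_on \<Omega>. weak_grad \<Omega> (u + c *\<^sub>R v) x $ i = (?u + c *\<^sub>R ?v) x"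
    using H1_lincomb(2)[OF assms(1,2), of c] by eventually_elim simp
  then have "L2_inner \<Omega> (\<lambda>x. weak_grad \<Omega> (u + c *\<^sub>R v) x $ i) w = L2_inner \<Omega> (?u + c *\<^sub>R ?v) w"
    using L assms by (intro L2_inner_cong_AE weak_grad_L2 H1_lincomb) auto
  then show ?thesis using L assms by (simp add: L.bilinear)
qed

lemma H1_inner_psd: "psd_form (H1 \<Omega>) H1_inner"
proof -
  interpret L: psd_form "L2 \<Omega>" "L2_inner \<Omega>" by (rule L2_inner_psd)
  have lin: "H1_inner (u + c *\<^sub>R v) w = H1_inner u w + c * H1_inner v w"
    if "u \<in> H1 \<Omega>" "v \<in> H1 \<Omega>" "w \<in> H1 \<Omega>" for u v w c
    using that unfolding H1_inner_def
    by (simp add: weak_grad_inner_lincomb weak_grad_L2 L.bilinear H1_L2 sum.distrib sum_distrib_left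
        algebra_simps)
  show ?thesis
  proof (rule psd_form_lincombI)
    show "subspace (H1 \<Omega>)" by (rule subspace_H1)
    show "H1_inner (u + c *\<^sub>R v) w = H1_inner u w + c * H1_inner v w"
      if "u \<in> H1 \<Omega>" "v \<in> H1 \<Omega>" "w \<in> H1 \<Omega>" for u v w c using that by (rule lin)
    show "H1_inner x y = H1_inner y x" if "x \<in> H1 \<Omega>" "y \<in> H1 \<Omega>" for x y
      using that unfolding H1_inner_def
      by (intro arg_cong2[of _ _ _ _ "(+)"] sum.cong L.sym H1_L2 weak_grad_L2) auto
    show "0 \<le> H1_inner x x" if "x \<in> H1 \<Omega>" for x
      using that unfolding H1_inner_def by (intro add_nonneg_nonneg sum_nonneg L.nonneg H1_L2 weak_grad_L2)
  qed
qed

lemma H1_norm_eq: "u \<in> H1 \<Omega> \<Longrightarrow> H1_norm \<Omega> u = sqrt (H1_inner u u)"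
proof -
  interpret L: psd_form "L2 \<Omega>" "L2_inner \<Omega>" by (rule L2_inner_psd)
  assume "u \<in> H1 \<Omega>"
  then have "(L2_norm \<Omega> u)\<^sup>2 = L2_inner \<Omega> u u"
    "(L2_norm \<Omega> (\<lambda>x. weak_grad \<Omega> u x $ i))\<^sup>2 = L2_inner \<Omega> (\<lambda>x. weak_grad \<Omega> u x $ i) (\<lambda>x. weak_grad \<Omega> u x $ i)" for i
    using L.nonneg[OF H1_L2] L.nonneg[OF weak_grad_L2] by (auto simp: L2_norm_def)
  then show ?thesis by (simp add: H1_norm_def H1_inner_def)
qed

lemma subspace_H10: "subspace (H10 \<Omega>)"
proof -
  interpret H: psd_form "H1 \<Omega>" H1_inner by (rule H1_inner_psd)
  have zero: "(\<lambda>x. 0) \<in> test_fun \<Omega>" by (auto simp: test_fun_def Ck_fun_const)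
  have lin: "u + c *\<^sub>R v \<in> H10 \<Omega>" if u: "u \<in> H10 \<Omega>" and v: "v \<in> H10 \<Omega>" for u v c
    unfolding H10_def
  proof (intro CollectI conjI allI impI)
    show "u + c *\<^sub>R v \<in> H1 \<Omega>" using u v by (auto simp: H10_def)
    fix \<epsilon> :: real assume \<epsilon>: "\<epsilon> > 0"
    define \<delta> where "\<delta> = \<epsilon> / (1 + \<bar>c\<bar>)"
    have \<delta>: "\<delta> > 0" "(1 + \<bar>c\<bar>) * \<delta> = \<epsilon>" using \<epsilon> by (auto simp: \<delta>_def field_simps)
    obtain \<phi> \<psi> where *: "\<phi> \<in> test_fun \<Omega>" "H1_norm \<Omega> (\<lambda>x. u x - \<phi> x) < \<delta>"
      "\<psi> \<in> test_fun \<Omega>" "H1_norm \<Omega> (\<lambda>x. v x - \<psi> x) < \<delta>"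
      using u v \<delta> by (auto simp: H10_def) blast
    define a b where "a = u - \<phi>" and "b = v - \<psi>"
    have ab: "a \<in> H1 \<Omega>" "b \<in> H1 \<Omega>" using u v * test_fun_H1 by (auto simp: a_def b_def H10_def)
    have n: "sqrt (H1_inner a a) < \<delta>" "sqrt (H1_inner b b) < \<delta>"
      using * ab by (auto simp: H1_norm_eq[symmetric] a_def b_def fun_diff_def)
    have "(\<lambda>x. (u + c *\<^sub>R v) x - (\<phi> x + c * \<psi> x)) = a + c *\<^sub>R b"
      by (auto simp: a_def b_def algebra_simps)
    then have "H1_norm \<Omega> (\<lambda>x. (u + c *\<^sub>R v) x - (\<phi> x + c * \<psi> x)) = sqrt (H1_inner (a + c *\<^sub>R b) (a + c *\<^sub>R b))"
      using ab by (simp add: H1_norm_eq)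
    also have "\<dots> \<le> sqrt (H1_inner a a) + sqrt (H1_inner (c *\<^sub>R b) (c *\<^sub>R b))"
      using ab by (intro H.triangle) auto
    also have "\<dots> = sqrt (H1_inner a a) + \<bar>c\<bar> * sqrt (H1_inner b b)" using ab by (simp add: H.norm_scale)
    also have "\<dots> < \<delta> + \<bar>c\<bar> * \<delta>" using n by (intro add_less_le_mono mult_left_mono) auto
    also have "\<dots> = \<epsilon>" using \<delta> by (simp add: algebra_simps)
    finally show "\<exists>\<phi>\<in>test_fun \<Omega>. H1_norm \<Omega> (\<lambda>x. (u + c *\<^sub>R v) x - \<phi> x) < \<epsilon>"
      using test_fun_lincomb[OF *(1,3), of c] by (intro bexI[of _ "\<lambda>x. \<phi> x + c * \<psi> x"])
  qed
  have z: "0 \<in> H10 \<Omega>"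
    unfolding H10_def
  proof (intro CollectI conjI allI impI)
    fix \<epsilon> :: real assume "\<epsilon> > 0"
    have eq: "(\<lambda>x. (0::real^'d \<Rightarrow> real) x - 0) = 0" by auto
    have "H1_norm \<Omega> (\<lambda>x. (0::real^'d \<Rightarrow> real) x - 0) = 0"
      unfolding eq by (simp add: H1_norm_eq H1_zero H.zero_left)
    then show "\<exists>\<phi>\<in>test_fun \<Omega>. H1_norm \<Omega> (\<lambda>x. 0 x - \<phi> x) < \<epsilon>"
      using zero \<open>\<epsilon> > 0\<close> by (intro bexI[of _ "\<lambda>x. 0"]) auto
  qed (rule H1_zero)
  from z lin show ?thesis by (rule subspace_lincombI)
qed

end

section \<open>Finite element spaces\<close>

lemma polys_upto_lincomb:
  assumes "p \<in> polys_upto r" "q \<in> polys_upto r"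
  shows "(\<lambda>x. p x + c * q x) \<in> polys_upto r"
proof -
  obtain b d where "\<And>x. p x = (\<Sum>\<nu> | (\<Sum>i\<in>UNIV. \<nu> i) \<le> r. b \<nu> * (\<Prod>i\<in>UNIV. x $ i ^ \<nu> i))"
    "\<And>x. q x = (\<Sum>\<nu> | (\<Sum>i\<in>UNIV. \<nu> i) \<le> r. d \<nu> * (\<Prod>i\<in>UNIV. x $ i ^ \<nu> i))"
    using assms by (auto simp: polys_upto_def)
  then have "p x + c * q x = (\<Sum>\<nu> | (\<Sum>i\<in>UNIV. \<nu> i) \<le> r. (b \<nu> + c * d \<nu>) * (\<Prod>i\<in>UNIV. x $ i ^ \<nu> i))" for x
    by (simp add: distrib_right sum.distrib sum_distrib_left mult.assoc)
  then show ?thesis by (auto simp: polys_upto_def)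
qed

lemma polys_upto_zero: "(\<lambda>x. 0) \<in> polys_upto r"
  by (auto simp: polys_upto_def intro!: exI[of _ "\<lambda>_. 0"])

lemma polys_upto_continuous: "p \<in> polys_upto r \<Longrightarrow> continuous_on UNIV p"
proof -
  assume "p \<in> polys_upto r"
  then obtain b where "p = (\<lambda>x. \<Sum>\<nu> | (\<Sum>i\<in>UNIV. \<nu> i) \<le> r. b \<nu> * (\<Prod>i\<in>UNIV. x $ i ^ \<nu> i))"
    by (auto simp: polys_upto_def fun_eq_iff)
  then show ?thesis by (auto intro!: continuous_intros)
qed

lemma finite_multiindices: "finite {\<nu> :: 'd::finite \<Rightarrow> nat. (\<Sum>i\<in>UNIV. \<nu> i) \<le> r}"
proof (rule finite_subset)
  show "{\<nu> :: 'd \<Rightarrow> nat. (\<Sum>i\<in>UNIV. \<nu> i) \<le> r} \<subseteq> PiE UNIV (\<lambda>_. {..r})"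
  proof
    fix \<nu> :: "'d \<Rightarrow> nat" assume "\<nu> \<in> {\<nu>. (\<Sum>i\<in>UNIV. \<nu> i) \<le> r}"
    then have "\<nu> i \<le> r" for i using member_le_sum[of i UNIV \<nu>] by auto
    then show "\<nu> \<in> PiE UNIV (\<lambda>_. {..r})" by auto
  qed
qed (simp add: finite_PiE)

text \<open>A simplex of full dimension is determined by its interior, so that almost everywhere statements pass to
  all of its points.\<close>

lemma full_simplex_closure_interior:
  fixes \<tau> :: "(real^'d) set"
  assumes "int CARD('d) simplex \<tau>"
  shows "closure (interior \<tau>) = \<tau>"
proof -
  have c: "convex \<tau>" "closed \<tau>" using assms by (auto intro: convex_simplex closed_simplex)
  have ad: "aff_dim \<tau> = int DIM(real^'d)" using aff_dim_simplex[OF assms] by simp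
  then have "affine hull \<tau> = UNIV" by (rule aff_dim_eq_full[THEN iffD1])
  then have "rel_interior \<tau> = interior \<tau>" by (rule rel_interior_interior)
  moreover have "\<tau> \<noteq> {}" using ad by auto
  ultimately have "interior \<tau> \<noteq> {}" using rel_interior_eq_empty[OF c(1)] by simp
  then show ?thesis using c convex_closure_interior[OF c(1)] by simp
qed

context
  fixes \<Omega> :: "(real^'d) set" and \<T> :: "(real^'d) set set" and r :: nat
  assumes \<Omega>: "open \<Omega>" "bounded \<Omega>" and \<T>: "conformal_triangulation \<Omega> \<T>"
begin

lemma finite_triangulation: "finite \<T>" and triangulation_cover: "\<Union>\<T> = closure \<Omega>"
  using \<T> by (auto simp: conformal_triangulation_def triangulation_def)

lemma fe_space_H1: "fe_space \<Omega> r \<T> \<subseteq> H1 \<Omega>"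
  by (auto simp: fe_space_def H10_def)

lemma fe_space_L2: "fe_space \<Omega> r \<T> \<subseteq> L2 \<Omega>"
  using fe_space_H1 by (auto simp: H1_def)

lemma subspace_fe_space: "subspace (fe_space \<Omega> r \<T>)"
proof -
  have lin: "u + c *\<^sub>R v \<in> fe_space \<Omega> r \<T>" if u: "u \<in> fe_space \<Omega> r \<T>" and v: "v \<in> fe_space \<Omega> r \<T>" for u v c
    unfolding fe_space_def
  proof (intro CollectI conjI ballI allI impI)
    show "u + c *\<^sub>R v \<in> H10 \<Omega>"
      using u v subspace_H10[OF \<Omega>] by (auto simp: fe_space_def intro: subspace_add subspace_scale)
    fix \<tau> assume "\<tau> \<in> \<T>"
    then obtain p q where pq: "p \<in> polys_upto r" "q \<in> polys_upto r" "\<forall>x\<in>\<tau>. u x = p x" "\<forall>x\<in>\<tau>. v x = q x"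
      using u v unfolding fe_space_def by blast
    then show "\<exists>p\<in>polys_upto r. \<forall>x\<in>\<tau>. (u + c *\<^sub>R v) x = p x"
      using polys_upto_lincomb[OF pq(1,2), of c] by (intro bexI[of _ "\<lambda>x. p x + c * q x"]) auto
  qed (use u v in \<open>auto simp: fe_space_def\<close>)
  have z: "0 \<in> fe_space \<Omega> r \<T>"
    unfolding fe_space_def
  proof (intro CollectI conjI ballI allI impI)
    show "0 \<in> H10 \<Omega>" using subspace_H10[OF \<Omega>] by (rule subspace_0)
    show "\<exists>p\<in>polys_upto r. \<forall>x\<in>\<tau>. 0 x = p x" for \<tau>
      using polys_upto_zero by (intro bexI[of _ "\<lambda>x. 0"]) auto
  qed simp
  from z lin show ?thesis by (rule subspace_lincombI)
qed

text \<open>On a simplex \<open>\<tau>\<close> the function is a polynomial that vanishes almost everywhere, hence everywhere, on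
  the open set \<open>interior \<tau> \<inter> \<Omega>\<close>. That set is dense in \<open>\<tau>\<close>, because \<open>\<tau>\<close> lies in the closure of \<open>\<Omega>\<close>.\<close>

lemma fe_space_zero_if_AE:
  assumes v: "v \<in> fe_space \<Omega> r \<T>" and ae: "AE x in lebesgue_on \<Omega>. v x = 0"
  shows "v = 0"
proof
  fix x
  show "v x = 0 x"
  proof (cases "x \<in> closure \<Omega>")
    case False
    then show ?thesis using v by (simp add: fe_space_def)
  next
    case True
    then obtain \<tau> where \<tau>: "\<tau> \<in> \<T>" "x \<in> \<tau>" using triangulation_cover by auto
    then obtain p where p: "p \<in> polys_upto r" "\<And>y. y \<in> \<tau> \<Longrightarrow> v y = p y"
      using v unfolding fe_space_def by blast
    have closed: "closed {y. p y = 0}"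
      using polys_upto_continuous[OF p(1)] by (intro closed_Collect_eq) auto
    have cl: "closure (interior \<tau>) = \<tau>"
      using \<T> \<tau>(1) by (intro full_simplex_closure_interior) (auto simp: conformal_triangulation_def)
    have "AE y in lebesgue. y \<in> \<Omega> \<longrightarrow> v y = 0"
      using ae borel_open[OF \<Omega>(1)] by (simp add: AE_restrict_space_iff)
    then have "AE y \<in> interior \<tau> \<inter> \<Omega> in lebesgue. y \<in> {y. p y = 0}"
      by eventually_elim (use p(2) interior_subset[of \<tau>] in auto)
    from mem_closed_if_AE_lebesgue_open[OF open_Int[OF open_interior \<Omega>(1)] closed this]
    have "interior \<tau> \<inter> \<Omega> \<subseteq> {y. p y = 0}" by blast
    then have "closure (interior \<tau> \<inter> \<Omega>) \<subseteq> {y. p y = 0}" using closed by (rule closure_minimal)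
    moreover have "interior \<tau> \<subseteq> closure (interior \<tau> \<inter> \<Omega>)"
    proof -
      have "interior \<tau> \<subseteq> closure \<Omega>" using \<tau>(1) triangulation_cover interior_subset[of \<tau>] by auto
      then show ?thesis using open_Int_closure_subset[of "interior \<tau>" \<Omega>] by auto
    qed
    ultimately have "closure (interior \<tau>) \<subseteq> {y. p y = 0}" using closed by (intro closure_minimal) auto
    then show ?thesis using cl \<tau> p(2) by auto
  qed
qed

text \<open>Simplices overlap in faces, so each point is first assigned to one simplex containing it. The monomials
  cut off to these pieces span a space that contains all finite element functions.\<close>

lemma fe_space_finite_dim: "\<exists>S. finite S \<and> fe_space \<Omega> r \<T> \<subseteq> span S"
proof -
  define \<sigma> where "\<sigma> x = (SOME \<tau>. \<tau> \<in> \<T> \<and> x \<in> \<tau>)" for x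
  have \<sigma>: "\<sigma> x \<in> \<T> \<and> x \<in> \<sigma> x" if "x \<in> closure \<Omega>" for x
  proof -
    have "\<exists>\<tau>. \<tau> \<in> \<T> \<and> x \<in> \<tau>" using that triangulation_cover by blast
    from someI_ex[OF this] show ?thesis by (simp add: \<sigma>_def)
  qed
  define I where "I = {\<nu> :: 'd \<Rightarrow> nat. (\<Sum>i\<in>UNIV. \<nu> i) \<le> r}"
  have I: "finite I" unfolding I_def by (rule finite_multiindices)
  \<comment> \<open>monomial \<open>\<nu>\<close> on the piece assigned to \<open>\<tau>\<close>\<close>
  define G where "G = (\<lambda>(\<nu>, \<tau>) x. if x \<in> closure \<Omega> \<and> \<sigma> x = \<tau> then \<Prod>i\<in>UNIV. x $ i ^ \<nu> i else 0 :: real)"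
  have "v \<in> span (G ` (I \<times> \<T>))" if v: "v \<in> fe_space \<Omega> r \<T>" for v
  proof -
    have "\<forall>\<tau>\<in>\<T>. \<exists>b. \<forall>x\<in>\<tau>. v x = (\<Sum>\<nu>\<in>I. b \<nu> * (\<Prod>i\<in>UNIV. x $ i ^ \<nu> i))"
    proof
      fix \<tau> assume "\<tau> \<in> \<T>"
      then obtain p where p: "p \<in> polys_upto r" "\<forall>y\<in>\<tau>. v y = p y" using v unfolding fe_space_def by blast
      then obtain b where "\<forall>x. p x = (\<Sum>\<nu>\<in>I. b \<nu> * (\<Prod>i\<in>UNIV. x $ i ^ \<nu> i))"
        unfolding polys_upto_def I_def by blast
      then show "\<exists>b. \<forall>x\<in>\<tau>. v x = (\<Sum>\<nu>\<in>I. b \<nu> * (\<Prod>i\<in>UNIV. x $ i ^ \<nu> i))" using p by (intro exI[of _ b]) auto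
    qed
    then obtain b where b: "\<And>\<tau> x. \<tau> \<in> \<T> \<Longrightarrow> x \<in> \<tau> \<Longrightarrow> v x = (\<Sum>\<nu>\<in>I. b \<tau> \<nu> * (\<Prod>i\<in>UNIV. x $ i ^ \<nu> i))"
      by (auto simp: bchoice_iff)
    have "v = (\<Sum>\<nu>\<in>I. \<Sum>\<tau>\<in>\<T>. b \<tau> \<nu> *\<^sub>R G (\<nu>, \<tau>))"
    proof
      fix x
      show "v x = (\<Sum>\<nu>\<in>I. \<Sum>\<tau>\<in>\<T>. b \<tau> \<nu> *\<^sub>R G (\<nu>, \<tau>)) x"
      proof (cases "x \<in> closure \<Omega>")
        case False
        then show ?thesis using v by (simp add: sum_fun_apply G_def fe_space_def)
      next
        case True
        have "(\<Sum>\<tau>\<in>\<T>. b \<tau> \<nu> * G (\<nu>, \<tau>) x) = b (\<sigma> x) \<nu> * (\<Prod>i\<in>UNIV. x $ i ^ \<nu> i)" for \<nu>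
        proof -
          have "(\<Sum>\<tau>\<in>\<T>. b \<tau> \<nu> * G (\<nu>, \<tau>) x)
              = (\<Sum>\<tau>\<in>\<T>. if \<tau> = \<sigma> x then b (\<sigma> x) \<nu> * (\<Prod>i\<in>UNIV. x $ i ^ \<nu> i) else 0)"
            using True by (intro sum.cong) (auto simp: G_def)
          then show ?thesis using \<sigma>[OF True] finite_triangulation by simp
        qed
        then show ?thesis using b[of "\<sigma> x" x] \<sigma>[OF True] by (simp add: sum_fun_apply)
      qed
    qed
    also have "\<dots> \<in> span (G ` (I \<times> \<T>))" by (intro span_sum span_scale span_base) auto
    finally show ?thesis .
  qed
  then show ?thesis using I finite_triangulation by (intro exI[of _ "G ` (I \<times> \<T>)"]) auto
qed

lemma fe_space_fd_inner: "fd_inner (fe_space \<Omega> r \<T>) (L2_inner \<Omega>)"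
proof -
  interpret psd_form "fe_space \<Omega> r \<T>" "L2_inner \<Omega>"
    using L2_inner_psd fe_space_L2 subspace_fe_space by (rule psd_form_subset)
  show ?thesis
  proof
    show "v = 0" if v: "v \<in> fe_space \<Omega> r \<T>" "L2_inner \<Omega> v v = 0" for v
    proof (rule fe_space_zero_if_AE[OF v(1)])
      have "v \<in> L2 \<Omega>" using v fe_space_L2 by auto
      then have "AE x in lebesgue_on \<Omega>. v x * v x = 0"
        using v(2) integral_nonneg_eq_0_iff_AE[OF L2_integrable_mult[of v \<Omega> v]]
        by (simp add: L2_inner_def)
      then show "AE x in lebesgue_on \<Omega>. v x = 0" by eventually_elim simp
    qed
    show "\<exists>S. finite S \<and> fe_space \<Omega> r \<T> \<subseteq> span S" by (rule fe_space_finite_dim)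
  qed
qed

end

section \<open>Time slices of the coefficients\<close>

lemma borel_measurable_AE_lebesgue_on:
  fixes f g :: "'a::euclidean_space \<Rightarrow> real"
  assumes "S \<in> sets lebesgue" "g \<in> borel_measurable (lebesgue_on S)"
    and "AE x in lebesgue_on S. g x = f x"
  shows "f \<in> borel_measurable (lebesgue_on S)"
proof -
  have "(\<lambda>x. if x \<in> S then g x else 0) \<in> borel_measurable lebesgue"
    using assms by (simp add: borel_measurable_if)
  moreover have "AE x in lebesgue. (if x \<in> S then g x else 0) = (if x \<in> S then f x else 0)"
    using assms by (auto simp: AE_restrict_space_iff elim!: eventually_mono)
  ultimately have "(\<lambda>x. if x \<in> S then f x else 0) \<in> borel_measurable lebesgue"
    by (rule borel_measurable_AE)
  then show ?thesis using assms by (simp add: borel_measurable_if)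
qed

text \<open>Null sets of the completed product measure lie in Borel null sets, almost all of whose slices are
  null.\<close>

lemma AE_slices:
  fixes J :: "'a::euclidean_space set" and \<Omega> :: "'b::euclidean_space set"
  assumes "open J" "open \<Omega>" "AE z in lebesgue_on (J \<times> \<Omega>). P (fst z) (snd z)"
  shows "AE t in lebesgue_on J. AE x in lebesgue_on \<Omega>. P t x"
proof -
  have S: "J \<times> \<Omega> \<in> sets lebesgue" "J \<in> sets lebesgue" "\<Omega> \<in> sets lebesgue"
    using borel_open[OF open_Times[OF assms(1,2)]] borel_open[OF assms(1)] borel_open[OF assms(2)] by auto
  have "AE z in lebesgue. z \<in> J \<times> \<Omega> \<longrightarrow> P (fst z) (snd z)"
    using assms(3) S by (simp add: AE_restrict_space_iff)
  then have "AE z in (lborel \<Otimes>\<^sub>M lborel). z \<in> J \<times> \<Omega> \<longrightarrow> P (fst z) (snd z)"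
    by (simp only: AE_completion_iff lborel_prod)
  from lborel_pair.AE_pair[OF this]
  have "AE t in lborel. AE x in lborel. (t, x) \<in> J \<times> \<Omega> \<longrightarrow> P t x" by simp
  then have "AE t in lebesgue. AE x in lebesgue. (t, x) \<in> J \<times> \<Omega> \<longrightarrow> P t x"
    by (simp only: AE_completion_iff)
  then have "AE t in lebesgue. t \<in> J \<longrightarrow> (AE x in lebesgue. x \<in> \<Omega> \<longrightarrow> P t x)"
    by eventually_elim auto
  then show ?thesis using S by (simp add: AE_restrict_space_iff)
qed

text \<open>A Lebesgue measurable function agrees almost everywhere with a Borel function, all of whose slices are
  Borel.\<close>

lemma measurable_slices:
  fixes J :: "'a::euclidean_space set" and \<Omega> :: "'b::euclidean_space set" and F :: "'a \<Rightarrow> 'b \<Rightarrow> real"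
  assumes "open J" "open \<Omega>" "(\<lambda>z. F (fst z) (snd z)) \<in> borel_measurable (lebesgue_on (J \<times> \<Omega>))"
  shows "AE t in lebesgue_on J. F t \<in> borel_measurable (lebesgue_on \<Omega>)"
proof -
  have S: "J \<times> \<Omega> \<in> sets lebesgue" "\<Omega> \<in> sets lebesgue"
    using borel_open[OF open_Times[OF assms(1,2)]] borel_open[OF assms(2)] by auto
  have "(\<lambda>z. if z \<in> J \<times> \<Omega> then F (fst z) (snd z) else 0) \<in> borel_measurable lebesgue"
    using assms S by (simp only: borel_measurable_if)
  then obtain h where h: "h \<in> borel_measurable lborel"
    "AE z in lborel. (if z \<in> J \<times> \<Omega> then F (fst z) (snd z) else 0) = h z"
    using completion_ex_borel_measurable_real by blast
  have "AE z in lebesgue_on (J \<times> \<Omega>). F (fst z) (snd z) = h (fst z, snd z)"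
    using AE_completion[OF h(2)] S by (auto simp: AE_restrict_space_iff elim!: eventually_mono)
  from AE_slices[OF assms(1,2) this]
  show ?thesis
  proof eventually_elim
    case (elim t)
    have "h \<in> borel_measurable (borel \<Otimes>\<^sub>M borel)" using h(1) by (simp add: borel_prod)
    then have "(\<lambda>x. h (t, x)) \<in> borel_measurable lborel" by simp
    then have "(\<lambda>x. h (t, x)) \<in> borel_measurable (lebesgue_on \<Omega>)"
      by (intro measurable_restrict_space1 measurable_completion)
    then show ?case
    proof (rule borel_measurable_AE_lebesgue_on[OF S(2)])
      show "AE x in lebesgue_on \<Omega>. h (t, x) = F t x"
        using elim by eventually_elim simp
    qed
  qed
qed

text \<open>What the space-time conditions say at a single time, with one exceptional null set for all indices and
  all vectors.\<close>

definition regular_slice ::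
  "(real^'d) set \<Rightarrow> real \<Rightarrow> real \<Rightarrow> ('d \<Rightarrow> 'd \<Rightarrow> real \<Rightarrow> real^'d \<Rightarrow> real) \<Rightarrow> real \<Rightarrow> bool" where
  "regular_slice \<Omega> \<alpha> B a s \<longleftrightarrow>
     (\<forall>i j. a i j s \<in> borel_measurable (lebesgue_on \<Omega>)) \<and>
     (AE x in lebesgue_on \<Omega>. (\<forall>i j. \<bar>a i j s x\<bar> \<le> B) \<and> (\<forall>i j. a i j s x = a j i s x) \<and>
        (\<forall>\<xi>. \<alpha> * (norm \<xi>)\<^sup>2 \<le> (\<Sum>i\<in>UNIV. \<Sum>j\<in>UNIV. a i j s x * \<xi> $ i * \<xi> $ j)))"

text \<open>The exceptional null set may depend on \<open>\<xi>\<close>. A countable dense set of vectors removes this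
  dependence, since both sides are continuous in \<open>\<xi>\<close>.\<close>

lemma ellipticity_all_vectors:
  fixes c :: "'d::finite \<Rightarrow> 'd \<Rightarrow> 'a \<Rightarrow> real"
  assumes "\<forall>\<xi> :: real^'d. AE z in M. (\<Sum>i\<in>UNIV. \<Sum>j\<in>UNIV. c i j z * \<xi> $ i * \<xi> $ j) \<ge> \<alpha> * (norm \<xi>)\<^sup>2"
  shows "AE z in M. \<forall>\<xi> :: real^'d. \<alpha> * (norm \<xi>)\<^sup>2 \<le> (\<Sum>i\<in>UNIV. \<Sum>j\<in>UNIV. c i j z * \<xi> $ i * \<xi> $ j)"
proof -
  obtain D :: "(real^'d) set" where D: "countable D" "\<And>X. open X \<Longrightarrow> X \<noteq> {} \<Longrightarrow> \<exists>d\<in>D. d \<in> X"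
    using countable_dense_setE by blast
  have dense: "closure D = UNIV"
  proof (rule ccontr)
    assume "closure D \<noteq> UNIV"
    then obtain d where "d \<in> D" "d \<in> - closure D" using D(2)[of "- closure D"] by auto
    then show False using closure_subset by auto
  qed
  have "AE z in M. \<forall>\<xi>\<in>D. \<alpha> * (norm \<xi>)\<^sup>2 \<le> (\<Sum>i\<in>UNIV. \<Sum>j\<in>UNIV. c i j z * \<xi> $ i * \<xi> $ j)"
    using assms D(1) by (subst AE_ball_countable) auto
  then show ?thesis
  proof eventually_elim
    case (elim z)
    have "closed {\<xi> :: real^'d. \<alpha> * (norm \<xi>)\<^sup>2 \<le> (\<Sum>i\<in>UNIV. \<Sum>j\<in>UNIV. c i j z * \<xi> $ i * \<xi> $ j)}"
      by (intro closed_Collect_le continuous_intros)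
    then have "closure D \<subseteq> {\<xi> :: real^'d. \<alpha> * (norm \<xi>)\<^sup>2 \<le> (\<Sum>i\<in>UNIV. \<Sum>j\<in>UNIV. c i j z * \<xi> $ i * \<xi> $ j)}"
      using elim by (intro closure_minimal) auto
    then show ?case using dense by auto
  qed
qed

lemma AE_regular_slices:
  assumes "open \<Omega>" and a: "admissible_coeffs \<Omega> T \<alpha> \<omega> a"
  shows "\<exists>B. AE t in lebesgue_on {0<..<T}. regular_slice \<Omega> \<alpha> B a t"
proof -
  let ?S = "{0<..<T} \<times> \<Omega>"
  obtain B where B: "\<forall>i j. AE z in lebesgue_on ?S. \<bar>a i j (fst z) (snd z)\<bar> \<le> B"
    using a by (auto simp: admissible_coeffs_def)
  have meas: "AE t in lebesgue_on {0<..<T}. \<forall>i\<in>UNIV. \<forall>j\<in>UNIV. a i j t \<in> borel_measurable (lebesgue_on \<Omega>)"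
    using a assms(1) by (intro AE_finite_allI measurable_slices) (auto simp: admissible_coeffs_def)
  have "AE z in lebesgue_on ?S. \<forall>\<xi>. \<alpha> * (norm \<xi>)\<^sup>2 \<le>
      (\<Sum>i\<in>UNIV. \<Sum>j\<in>UNIV. a i j (fst z) (snd z) * \<xi> $ i * \<xi> $ j)"
    using a by (intro ellipticity_all_vectors) (simp add: admissible_coeffs_def)
  moreover have "AE z in lebesgue_on ?S. \<forall>i\<in>UNIV. \<forall>j\<in>UNIV. \<bar>a i j (fst z) (snd z)\<bar> \<le> B"
    using B by (intro AE_finite_allI) auto
  moreover have "AE z in lebesgue_on ?S. \<forall>i\<in>UNIV. \<forall>j\<in>UNIV. a i j (fst z) (snd z) = a j i (fst z) (snd z)"
    using a by (intro AE_finite_allI) (auto simp: admissible_coeffs_def)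
  ultimately have "AE z in lebesgue_on ?S. (\<forall>i j. \<bar>a i j (fst z) (snd z)\<bar> \<le> B) \<and>
      (\<forall>i j. a i j (fst z) (snd z) = a j i (fst z) (snd z)) \<and>
      (\<forall>\<xi>. \<alpha> * (norm \<xi>)\<^sup>2 \<le> (\<Sum>i\<in>UNIV. \<Sum>j\<in>UNIV. a i j (fst z) (snd z) * \<xi> $ i * \<xi> $ j))"
    by eventually_elim blast
  from AE_slices[OF open_greaterThanLessThan assms(1) this] meas
  have "AE t in lebesgue_on {0<..<T}. regular_slice \<Omega> \<alpha> B a t"
    by eventually_elim (simp add: regular_slice_def)
  then show ?thesis ..
qed

text \<open>By Fubini almost every time is regular. Such times are dense, and continuity in time carries all
  conditions, including measurability, over to every other time as pointwise limits.\<close>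

lemma regular_slices:
  assumes "open \<Omega>" "T > 0" and a: "admissible_coeffs \<Omega> T \<alpha> \<omega> a"
  shows "\<exists>B. \<forall>s\<in>{0..T}. regular_slice \<Omega> \<alpha> B a s"
proof -
  have \<Omega>: "\<Omega> \<in> sets lebesgue" using borel_open[OF assms(1)] by auto
  obtain B where B: "AE t in lebesgue_on {0<..<T}. regular_slice \<Omega> \<alpha> B a t"
    using AE_regular_slices[OF assms(1) a] by blast
  define R where "R = {t \<in> {0<..<T}. regular_slice \<Omega> \<alpha> B a t}"
  have "AE t in lebesgue. t \<in> {0<..<T} \<longrightarrow> t \<in> closure R"
    using B closure_subset[of R] by (auto simp: AE_restrict_space_iff R_def elim!: eventually_mono)
  then have "{0<..<T} \<subseteq> closure R"
    using mem_closed_if_AE_lebesgue_open[OF open_greaterThanLessThan closed_closure] by blast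
  then have "closure {0<..<T} \<subseteq> closure R" by (intro closure_minimal) auto
  then have dense: "{0..T} \<subseteq> closure R" using assms(2) by (simp add: closure_greaterThanLessThan)
  have "regular_slice \<Omega> \<alpha> B a s" if s: "s \<in> {0..T}" for s
  proof -
    obtain \<sigma> where \<sigma>: "\<And>n. \<sigma> n \<in> R" "\<sigma> \<longlonglongrightarrow> s"
      using subsetD[OF dense s] unfolding closure_sequential by blast
    have reg: "regular_slice \<Omega> \<alpha> B a (\<sigma> n)" and in01: "\<sigma> n \<in> {0..T}" for n
      using \<sigma>(1)[of n] by (auto simp: R_def)
    have "AE x in lebesgue_on \<Omega>. \<forall>i\<in>UNIV. \<forall>j\<in>UNIV. continuous_on {0..T} (\<lambda>t. a i j t x)"
      using a by (intro AE_finite_allI) (auto simp: admissible_coeffs_def)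
    then have lim: "AE x in lebesgue_on \<Omega>. \<forall>i j. (\<lambda>n. a i j (\<sigma> n) x) \<longlonglongrightarrow> a i j s x"
      by eventually_elim (use \<sigma>(2) s in01 in \<open>auto simp: continuous_on_sequentially o_def\<close>)
    have meas: "a i j s \<in> borel_measurable (lebesgue_on \<Omega>)" for i j
    proof (rule borel_measurable_AE_lebesgue_on[OF \<Omega>])
      show "(\<lambda>x. lim (\<lambda>n. a i j (\<sigma> n) x)) \<in> borel_measurable (lebesgue_on \<Omega>)"
        using reg by (intro borel_measurable_lim_metric) (simp add: regular_slice_def)
      show "AE x in lebesgue_on \<Omega>. lim (\<lambda>n. a i j (\<sigma> n) x) = a i j s x"
        using lim by eventually_elim (simp add: limI)
    qed
    have "AE x in lebesgue_on \<Omega>. \<forall>n. (\<forall>i j. \<bar>a i j (\<sigma> n) x\<bar> \<le> B) \<and> (\<forall>i j. a i j (\<sigma> n) x = a j i (\<sigma> n) x) \<and>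
        (\<forall>\<xi>. \<alpha> * (norm \<xi>)\<^sup>2 \<le> (\<Sum>i\<in>UNIV. \<Sum>j\<in>UNIV. a i j (\<sigma> n) x * \<xi> $ i * \<xi> $ j))"
      using reg by (subst AE_all_countable) (auto simp: regular_slice_def)
    with lim have "AE x in lebesgue_on \<Omega>. (\<forall>i j. \<bar>a i j s x\<bar> \<le> B) \<and> (\<forall>i j. a i j s x = a j i s x) \<and>
        (\<forall>\<xi>. \<alpha> * (norm \<xi>)\<^sup>2 \<le> (\<Sum>i\<in>UNIV. \<Sum>j\<in>UNIV. a i j s x * \<xi> $ i * \<xi> $ j))"
    proof eventually_elim
      case (elim x)
      show ?case
      proof (intro conjI allI)
        fix i j
        have "(\<lambda>n. \<bar>a i j (\<sigma> n) x\<bar>) \<longlonglongrightarrow> \<bar>a i j s x\<bar>" using elim(1) by (intro tendsto_rabs) auto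
        then show "\<bar>a i j s x\<bar> \<le> B" using elim(2) by (intro LIMSEQ_le_const2) auto
        have "(\<lambda>n. a j i (\<sigma> n) x) = (\<lambda>n. a i j (\<sigma> n) x)" using elim(2) by auto
        then have "(\<lambda>n. a i j (\<sigma> n) x) \<longlonglongrightarrow> a j i s x" using elim(1) by metis
        with elim(1) show "a i j s x = a j i s x" by (blast intro: LIMSEQ_unique)
      next
        fix \<xi> :: "real^'a"
        have "(\<lambda>n. \<Sum>i\<in>UNIV. \<Sum>j\<in>UNIV. a i j (\<sigma> n) x * \<xi> $ i * \<xi> $ j) \<longlonglongrightarrow>
            (\<Sum>i\<in>UNIV. \<Sum>j\<in>UNIV. a i j s x * \<xi> $ i * \<xi> $ j)"
          using elim(1) by (intro tendsto_intros) auto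
        then show "\<alpha> * (norm \<xi>)\<^sup>2 \<le> (\<Sum>i\<in>UNIV. \<Sum>j\<in>UNIV. a i j s x * \<xi> $ i * \<xi> $ j)"
          using elim(2) by (intro LIMSEQ_le_const) auto
      qed
    qed
    with meas show ?thesis by (simp add: regular_slice_def)
  qed
  then show ?thesis by blast
qed

section \<open>The elliptic forms and their time averages\<close>

lemma L2_mult_bounded:
  assumes "f \<in> borel_measurable (lebesgue_on \<Omega>)" "AE x in lebesgue_on \<Omega>. \<bar>f x\<bar> \<le> B" "u \<in> L2 \<Omega>"
  shows "(\<lambda>x. f x * u x) \<in> L2 \<Omega>"
proof -
  have m: "u \<in> borel_measurable (lebesgue_on \<Omega>)" using assms by (simp add: L2_def)
  have "integrable (lebesgue_on \<Omega>) (\<lambda>x. (f x * u x)\<^sup>2)"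
  proof (rule Bochner_Integration.integrable_bound)
    show "integrable (lebesgue_on \<Omega>) (\<lambda>x. B\<^sup>2 * (u x)\<^sup>2)" using assms by (simp add: L2_def)
    show "AE x in lebesgue_on \<Omega>. norm ((f x * u x)\<^sup>2) \<le> norm (B\<^sup>2 * (u x)\<^sup>2)"
      using assms(2)
    proof eventually_elim
      case (elim x)
      then have "(f x)\<^sup>2 \<le> B\<^sup>2" using abs_le_square_iff[of "f x" B] by auto
      then show ?case by (simp add: power_mult_distrib mult_right_mono)
    qed
  qed (use assms m in auto)
  then show ?thesis using assms m by (simp add: L2_def)
qed

lemma L2_abs: "u \<in> L2 \<Omega> \<Longrightarrow> (\<lambda>x. \<bar>u x\<bar>) \<in> L2 \<Omega>"
  by (auto simp: L2_def)

lemma integral_abs_mult_le: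
  assumes "u \<in> L2 \<Omega>" "v \<in> L2 \<Omega>"
  shows "(\<integral>x. \<bar>u x\<bar> * \<bar>v x\<bar> \<partial>lebesgue_on \<Omega>) \<le> L2_norm \<Omega> u * L2_norm \<Omega> v"
proof -
  interpret L: psd_form "L2 \<Omega>" "L2_inner \<Omega>" by (rule L2_inner_psd)
  have "L2_inner \<Omega> (\<lambda>x. \<bar>w x\<bar>) (\<lambda>x. \<bar>w x\<bar>) = L2_inner \<Omega> w w" for w
    by (simp add: L2_inner_def abs_mult[symmetric])
  then show ?thesis
    using L.Cauchy_Schwarz[OF L2_abs[OF assms(1)] L2_abs[OF assms(2)]] by (simp add: L2_norm_def L2_inner_def)
qed

definition grad_norm :: "(real^'d) set \<Rightarrow> (real^'d \<Rightarrow> real) \<Rightarrow> real" where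
  "grad_norm \<Omega> u = sqrt (\<Sum>i\<in>UNIV. (L2_norm \<Omega> (\<lambda>x. weak_grad \<Omega> u x $ i))\<^sup>2)"

lemma partial_le_grad_norm: "L2_norm \<Omega> (\<lambda>x. weak_grad \<Omega> u x $ i) \<le> grad_norm \<Omega> u"
  unfolding grad_norm_def by (intro real_le_rsqrt member_le_sum) auto

lemma grad_norm_nonneg: "grad_norm \<Omega> u \<ge> 0"
  by (simp add: grad_norm_def sum_nonneg)

context
  fixes \<Omega> :: "(real^'d) set"
  assumes \<Omega>: "open \<Omega>" "bounded \<Omega>"
begin

lemma regular_slice_form:
  assumes c: "regular_slice \<Omega> \<alpha> B a s" and u: "u \<in> H1 \<Omega>" and v: "v \<in> H1 \<Omega>"
  shows "(\<lambda>x. a i j s x * weak_grad \<Omega> v x $ j) \<in> L2 \<Omega>"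
    and "integrable (lebesgue_on \<Omega>) (\<lambda>x. a i j s x * weak_grad \<Omega> u x $ i * weak_grad \<Omega> v x $ j)"
    and "a_form \<Omega> a s u v =
      (\<Sum>i\<in>UNIV. \<Sum>j\<in>UNIV. L2_inner \<Omega> (\<lambda>x. weak_grad \<Omega> u x $ i) (\<lambda>x. a i j s x * weak_grad \<Omega> v x $ j))"
proof -
  have bd: "AE x in lebesgue_on \<Omega>. \<bar>a i j s x\<bar> \<le> B" for i j
    using c unfolding regular_slice_def by (auto elim: eventually_mono)
  have 1: "(\<lambda>x. a i j s x * weak_grad \<Omega> v x $ j) \<in> L2 \<Omega>" for i j
    using c bd by (intro L2_mult_bounded weak_grad_L2[OF \<Omega> v]) (auto simp: regular_slice_def)
  have 2: "integrable (lebesgue_on \<Omega>) (\<lambda>x. a i j s x * weak_grad \<Omega> u x $ i * weak_grad \<Omega> v x $ j)" for i j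
    using L2_integrable_mult[OF weak_grad_L2[OF \<Omega> u, of i] 1[of i j]] by (simp add: mult_ac)
  show "(\<lambda>x. a i j s x * weak_grad \<Omega> v x $ j) \<in> L2 \<Omega>" by (rule 1)
  show "integrable (lebesgue_on \<Omega>) (\<lambda>x. a i j s x * weak_grad \<Omega> u x $ i * weak_grad \<Omega> v x $ j)" by (rule 2)
  show "a_form \<Omega> a s u v =
      (\<Sum>i\<in>UNIV. \<Sum>j\<in>UNIV. L2_inner \<Omega> (\<lambda>x. weak_grad \<Omega> u x $ i) (\<lambda>x. a i j s x * weak_grad \<Omega> v x $ j))"
    using 2 by (simp add: a_form_def L2_inner_def mult_ac)
qed

lemma a_form_coercive:
  assumes c: "regular_slice \<Omega> \<alpha> B a s" and u: "u \<in> H1 \<Omega>"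
  shows "\<alpha> * (grad_norm \<Omega> u)\<^sup>2 \<le> a_form \<Omega> a s u u"
proof -
  interpret L: psd_form "L2 \<Omega>" "L2_inner \<Omega>" by (rule L2_inner_psd)
  let ?g = "\<lambda>x. weak_grad \<Omega> u x"
  have gi: "integrable (lebesgue_on \<Omega>) (\<lambda>x. ?g x $ i * ?g x $ i)" for i
    using weak_grad_L2[OF \<Omega> u] by (intro L2_integrable_mult)
  have "(grad_norm \<Omega> u)\<^sup>2 = (\<Sum>i\<in>UNIV. L2_inner \<Omega> (\<lambda>x. ?g x $ i) (\<lambda>x. ?g x $ i))"
    using L.nonneg[OF weak_grad_L2[OF \<Omega> u]] by (simp add: grad_norm_def L2_norm_def sum_nonneg)
  also have "\<dots> = (\<integral>x. (\<Sum>i\<in>UNIV. ?g x $ i * ?g x $ i) \<partial>lebesgue_on \<Omega>)"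
    using gi by (simp add: L2_inner_def)
  finally have "\<alpha> * (grad_norm \<Omega> u)\<^sup>2 = (\<integral>x. \<alpha> * (\<Sum>i\<in>UNIV. ?g x $ i * ?g x $ i) \<partial>lebesgue_on \<Omega>)"
    by simp
  also have "\<dots> \<le> a_form \<Omega> a s u u"
    unfolding a_form_def
  proof (rule integral_mono_AE)
    show "integrable (lebesgue_on \<Omega>) (\<lambda>x. \<alpha> * (\<Sum>i\<in>UNIV. ?g x $ i * ?g x $ i))"
      using gi by (intro integrable_mult_right Bochner_Integration.integrable_sum)
    show "integrable (lebesgue_on \<Omega>) (\<lambda>x. \<Sum>i\<in>UNIV. \<Sum>j\<in>UNIV. a i j s x * ?g x $ i * ?g x $ j)"
      by (intro Bochner_Integration.integrable_sum regular_slice_form(2)[OF c u u])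
    have "AE x in lebesgue_on \<Omega>. \<forall>\<xi>. \<alpha> * (norm \<xi>)\<^sup>2 \<le> (\<Sum>i\<in>UNIV. \<Sum>j\<in>UNIV. a i j s x * \<xi> $ i * \<xi> $ j)"
      using c unfolding regular_slice_def by (auto elim: eventually_mono)
    then show "AE x in lebesgue_on \<Omega>. \<alpha> * (\<Sum>i\<in>UNIV. ?g x $ i * ?g x $ i)
        \<le> (\<Sum>i\<in>UNIV. \<Sum>j\<in>UNIV. a i j s x * ?g x $ i * ?g x $ j)"
    proof eventually_elim
      case (elim x)
      have "(norm (?g x))\<^sup>2 = (\<Sum>i\<in>UNIV. ?g x $ i * ?g x $ i)"
        by (simp add: power2_norm_eq_inner inner_vec_def)
      with elim[rule_format, of "?g x"] show ?case by simp
    qed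
  qed
  finally show ?thesis .
qed

lemma a_form_psd:
  assumes c: "regular_slice \<Omega> \<alpha> B a s" and "\<alpha> \<ge> 0"
  shows "psd_form (H1 \<Omega>) (a_form \<Omega> a s)"
proof -
  have lin: "a_form \<Omega> a s (u + e *\<^sub>R v) w = a_form \<Omega> a s u w + e * a_form \<Omega> a s v w"
    if "u \<in> H1 \<Omega>" "v \<in> H1 \<Omega>" "w \<in> H1 \<Omega>" for u v w e
    using that by (simp add: regular_slice_form[OF c] H1_lincomb[OF \<Omega>]
        weak_grad_inner_lincomb[OF \<Omega>] sum.distrib sum_distrib_left)
  show ?thesis
  proof (rule psd_form_lincombI)
    show "subspace (H1 \<Omega>)" by (rule subspace_H1[OF \<Omega>])
    show "a_form \<Omega> a s (u + e *\<^sub>R v) w = a_form \<Omega> a s u w + e * a_form \<Omega> a s v w"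
      if "u \<in> H1 \<Omega>" "v \<in> H1 \<Omega>" "w \<in> H1 \<Omega>" for u v w e using that by (rule lin)
    show "a_form \<Omega> a s x y = a_form \<Omega> a s y x" if xy: "x \<in> H1 \<Omega>" "y \<in> H1 \<Omega>" for x y
    proof -
      have "AE z in lebesgue_on \<Omega>. \<forall>i j. a i j s z = a j i s z"
        using c unfolding regular_slice_def by (auto elim: eventually_mono)
      then have "AE z in lebesgue_on \<Omega>.
          (\<Sum>i\<in>UNIV. \<Sum>j\<in>UNIV. a i j s z * weak_grad \<Omega> x z $ i * weak_grad \<Omega> y z $ j)
          = (\<Sum>i\<in>UNIV. \<Sum>j\<in>UNIV. a i j s z * weak_grad \<Omega> y z $ i * weak_grad \<Omega> x z $ j)"
      proof eventually_elim
        case (elim z)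
        then show ?case
          by (subst sum.swap) (intro sum.cong refl, simp add: mult_ac)
      qed
      then show ?thesis
        unfolding a_form_def using xy
        by (intro integral_cong_AE borel_measurable_integrable Bochner_Integration.integrable_sum
            regular_slice_form(2)[OF c])
    qed
    show "0 \<le> a_form \<Omega> a s x x" if "x \<in> H1 \<Omega>" for x
      using a_form_coercive[OF c that] assms(2) by (meson mult_nonneg_nonneg order_trans zero_le_power2)
  qed
qed

text \<open>The constant is crude: each of the \<open>d\<^sup>2\<close> pairs of partial derivatives is bounded by the product of the
  full gradient norms.\<close>

lemma a_form_modulus:
  assumes c: "regular_slice \<Omega> \<alpha> B a s" "regular_slice \<Omega> \<alpha> B a s'"
    and u: "u \<in> H1 \<Omega>" and v: "v \<in> H1 \<Omega>"
    and w: "\<And>i j. AE x in lebesgue_on \<Omega>. \<bar>a i j s x - a i j s' x\<bar> \<le> w" "w \<ge> 0"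
  shows "\<bar>a_form \<Omega> a s u v - a_form \<Omega> a s' u v\<bar> \<le> (real CARD('d))\<^sup>2 * w * grad_norm \<Omega> u * grad_norm \<Omega> v"
proof -
  let ?u = "\<lambda>i x. weak_grad \<Omega> u x $ i" and ?v = "\<lambda>i x. weak_grad \<Omega> v x $ i"
  note I = regular_slice_form(2)[OF c(1) u v] regular_slice_form(2)[OF c(2) u v]
  have "a_form \<Omega> a s u v - a_form \<Omega> a s' u v =
      (\<Sum>i\<in>UNIV. \<Sum>j\<in>UNIV. (\<integral>x. (a i j s x - a i j s' x) * ?u i x * ?v j x \<partial>lebesgue_on \<Omega>))"
    using I by (simp add: a_form_def sum_subtractf left_diff_distrib)
  also have "\<bar>\<dots>\<bar> \<le> (\<Sum>i\<in>(UNIV::'d set). \<Sum>j\<in>(UNIV::'d set). w * (grad_norm \<Omega> u * grad_norm \<Omega> v))"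
  proof (rule order_trans[OF sum_abs sum_mono], rule order_trans[OF sum_abs sum_mono])
    fix i j :: 'd
    have L: "?u i \<in> L2 \<Omega>" "?v j \<in> L2 \<Omega>" using u v by (auto intro: weak_grad_L2[OF \<Omega>])
    have "\<bar>\<integral>x. (a i j s x - a i j s' x) * ?u i x * ?v j x \<partial>lebesgue_on \<Omega>\<bar>
        \<le> (\<integral>x. \<bar>(a i j s x - a i j s' x) * ?u i x * ?v j x\<bar> \<partial>lebesgue_on \<Omega>)"
      by (rule integral_abs_bound)
    also have "\<dots> \<le> (\<integral>x. w * (\<bar>?u i x\<bar> * \<bar>?v j x\<bar>) \<partial>lebesgue_on \<Omega>)"
    proof (rule integral_mono_AE)
      show "integrable (lebesgue_on \<Omega>) (\<lambda>x. \<bar>(a i j s x - a i j s' x) * ?u i x * ?v j x\<bar>)"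
        using I[of i j] by (intro integrable_abs) (simp add: left_diff_distrib)
      show "integrable (lebesgue_on \<Omega>) (\<lambda>x. w * (\<bar>?u i x\<bar> * \<bar>?v j x\<bar>))"
        by (intro integrable_mult_right L2_integrable_mult L2_abs L)
      show "AE x in lebesgue_on \<Omega>. \<bar>(a i j s x - a i j s' x) * ?u i x * ?v j x\<bar> \<le> w * (\<bar>?u i x\<bar> * \<bar>?v j x\<bar>)"
        using w(1)[of i j] by eventually_elim (simp add: abs_mult mult.assoc mult_right_mono)
    qed
    also have "\<dots> = w * (\<integral>x. \<bar>?u i x\<bar> * \<bar>?v j x\<bar> \<partial>lebesgue_on \<Omega>)" by simp
    also have "\<dots> \<le> w * (L2_norm \<Omega> (?u i) * L2_norm \<Omega> (?v j))"
      using w(2) by (intro mult_left_mono integral_abs_mult_le L)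
    also have "\<dots> \<le> w * (grad_norm \<Omega> u * grad_norm \<Omega> v)"
      using w(2) psd_form.nonneg[OF L2_inner_psd L(2)]
      by (intro mult_left_mono mult_mono partial_le_grad_norm grad_norm_nonneg) (auto simp: L2_norm_def)
    finally show "\<bar>\<integral>x. (a i j s x - a i j s' x) * ?u i x * ?v j x \<partial>lebesgue_on \<Omega>\<bar>
        \<le> w * (grad_norm \<Omega> u * grad_norm \<Omega> v)" .
  qed
  also have "\<dots> = (real CARD('d))\<^sup>2 * w * grad_norm \<Omega> u * grad_norm \<Omega> v"
    by (simp add: power2_eq_square)
  finally show ?thesis .
qed

lemma a_form_continuous:
  assumes a: "admissible_coeffs \<Omega> T \<alpha> \<omega> a"
    and reg: "\<And>s. s \<in> {0..T} \<Longrightarrow> regular_slice \<Omega> \<alpha> B a s"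
    and u: "u \<in> H1 \<Omega>" and v: "v \<in> H1 \<Omega>"
  shows "continuous_on {0..T} (\<lambda>s. a_form \<Omega> a s u v)"
  unfolding continuous_on_sequentially o_def
proof (intro allI ballI impI)
  fix \<sigma> s assume s: "s \<in> {0..T}" and "(\<forall>n. \<sigma> n \<in> {0..T}) \<and> \<sigma> \<longlonglongrightarrow> s"
  then have \<sigma>: "\<And>n. \<sigma> n \<in> {0..T}" "\<sigma> \<longlonglongrightarrow> s" by auto
  let ?u = "\<lambda>i x. weak_grad \<Omega> u x $ i" and ?v = "\<lambda>i x. weak_grad \<Omega> v x $ i"
  let ?I = "\<lambda>s i j. \<integral>x. a i j s x * ?u i x * ?v j x \<partial>lebesgue_on \<Omega>"
  have eq: "a_form \<Omega> a s u v = (\<Sum>i\<in>UNIV. \<Sum>j\<in>UNIV. ?I s i j)" if "s \<in> {0..T}" for s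
    using regular_slice_form(2)[OF reg[OF that] u v] by (simp add: a_form_def)
  have "(\<lambda>n. \<Sum>i\<in>UNIV. \<Sum>j\<in>UNIV. ?I (\<sigma> n) i j) \<longlonglongrightarrow> (\<Sum>i\<in>UNIV. \<Sum>j\<in>UNIV. ?I s i j)"
  proof (intro tendsto_sum)
    fix i j
    have L: "?u i \<in> L2 \<Omega>" "?v j \<in> L2 \<Omega>" using u v by (auto intro: weak_grad_L2[OF \<Omega>])
    show "(\<lambda>n. ?I (\<sigma> n) i j) \<longlonglongrightarrow> ?I s i j"
    proof (rule integral_dominated_convergence[where w = "\<lambda>x. B * (\<bar>?u i x\<bar> * \<bar>?v j x\<bar>)"])
      show "(\<lambda>x. a i j s x * ?u i x * ?v j x) \<in> borel_measurable (lebesgue_on \<Omega>)"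
        using regular_slice_form(2)[OF reg[OF s] u v] by (rule borel_measurable_integrable)
      show "(\<lambda>x. a i j (\<sigma> n) x * ?u i x * ?v j x) \<in> borel_measurable (lebesgue_on \<Omega>)" for n
        using regular_slice_form(2)[OF reg[OF \<sigma>(1)] u v] by (rule borel_measurable_integrable)
      show "integrable (lebesgue_on \<Omega>) (\<lambda>x. B * (\<bar>?u i x\<bar> * \<bar>?v j x\<bar>))"
        by (intro integrable_mult_right L2_integrable_mult L2_abs L)
      have "AE x in lebesgue_on \<Omega>. continuous_on {0..T} (\<lambda>t. a i j t x)"
        using a by (simp add: admissible_coeffs_def)
      then show "AE x in lebesgue_on \<Omega>. (\<lambda>n. a i j (\<sigma> n) x * ?u i x * ?v j x) \<longlonglongrightarrow> a i j s x * ?u i x * ?v j x"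
        by eventually_elim (use s \<sigma> in \<open>auto simp: continuous_on_sequentially o_def intro!: tendsto_mult_right\<close>)
      show "AE x in lebesgue_on \<Omega>. norm (a i j (\<sigma> n) x * ?u i x * ?v j x) \<le> B * (\<bar>?u i x\<bar> * \<bar>?v j x\<bar>)" for n
      proof -
        have "AE x in lebesgue_on \<Omega>. \<bar>a i j (\<sigma> n) x\<bar> \<le> B"
          using reg[OF \<sigma>(1)[of n]] unfolding regular_slice_def by (auto elim: eventually_mono)
        then show ?thesis by eventually_elim (simp add: abs_mult mult.assoc mult_right_mono)
      qed
    qed
  qed
  then show "(\<lambda>n. a_form \<Omega> a (\<sigma> n) u v) \<longlonglongrightarrow> a_form \<Omega> a s u v"
    using eq \<sigma>(1) s by simp
qed

end

lemma integrable_lebesgue_on_subset: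
  fixes f :: "'a::euclidean_space \<Rightarrow> real"
  assumes "integrable (lebesgue_on S) f" "R \<subseteq> S" "R \<in> sets lebesgue" "S \<in> sets lebesgue"
  shows "integrable (lebesgue_on R) f"
proof -
  have "integrable lebesgue (\<lambda>x. indicator S x *\<^sub>R f x)"
    using assms by (simp add: integrable_restrict_space)
  then have "integrable lebesgue (\<lambda>x. indicator R x *\<^sub>R (indicator S x *\<^sub>R f x))"
    by (rule integrable_mult_indicator[OF assms(3)])
  moreover have "(\<lambda>x. indicator R x *\<^sub>R (indicator S x *\<^sub>R f x)) = (\<lambda>x. indicator R x *\<^sub>R f x)"
    using assms(2) by (intro HOL.ext) (auto simp: indicator_def)
  ultimately show ?thesis using assms by (simp add: integrable_restrict_space)
qed

definition interval_avg :: "real \<Rightarrow> real \<Rightarrow> (real \<Rightarrow> real) \<Rightarrow> real" where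
  "interval_avg p q f = 1 / (q - p) * (\<integral>s. f s \<partial>lebesgue_on {p<..q})"

lemma interval_avg_const: "p < q \<Longrightarrow> interval_avg p q (\<lambda>_. c) = c"
proof -
  assume pq: "p < q"
  have "measure (lebesgue_on {p<..q}) {p<..q} = q - p"
    using pq by (subst measure_restrict_space) auto
  then show ?thesis using pq by (simp add: interval_avg_def)
qed

lemma interval_avg_mono:
  assumes "p < q" "integrable (lebesgue_on {p<..q}) f" "integrable (lebesgue_on {p<..q}) g"
    "\<And>s. s \<in> {p<..q} \<Longrightarrow> f s \<le> g s"
  shows "interval_avg p q f \<le> interval_avg p q g"
  unfolding interval_avg_def using assms by (intro mult_left_mono integral_mono) auto

lemma interval_avg_lincomb:
  assumes "integrable (lebesgue_on {p<..q}) f" "integrable (lebesgue_on {p<..q}) g"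
  shows "interval_avg p q (\<lambda>s. f s + c * g s) = interval_avg p q f + c * interval_avg p q g"
  using assms by (simp add: interval_avg_def algebra_simps)

lemma integrable_const_Ioc: "integrable (lebesgue_on {p<..q::real}) (\<lambda>_. c :: real)"
proof -
  have "continuous_on {p..q} (\<lambda>_. c)" by simp
  then have "integrable (lebesgue_on {p..q}) (\<lambda>_. c)" by (rule continuous_imp_integrable_real)
  then show ?thesis by (rule integrable_lebesgue_on_subset) auto
qed

text \<open>The fully discrete setting for a subspace \<open>V\<close> of \<open>H\<^sup>1\<close>. Boundary values, the triangulation and the
  polynomial degree enter only through \<open>V\<close>.\<close>

locale space_time_discretization = fd_inner V "L2_inner \<Omega>"
  for V and \<Omega> :: "(real^'d) set" +
  fixes T \<alpha> B :: real and \<omega> :: "real \<Rightarrow> real" and a :: "'d \<Rightarrow> 'd \<Rightarrow> real \<Rightarrow> real^'d \<Rightarrow> real"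
    and M :: nat and t :: "nat \<Rightarrow> real"
  assumes \<Omega>: "open \<Omega>" "bounded \<Omega>" and T: "T > 0" and \<alpha>: "\<alpha> > 0"
    and \<omega>_nonneg: "s \<in> {0..T} \<Longrightarrow> \<omega> s \<ge> 0" and \<omega>_mono: "mono_on {0..T} \<omega>"
    and coeffs: "admissible_coeffs \<Omega> T \<alpha> \<omega> a"
    and slices: "s \<in> {0..T} \<Longrightarrow> regular_slice \<Omega> \<alpha> B a s"
    and V_H1: "V \<subseteq> H1 \<Omega>"
    and mesh: "time_mesh T M t"
begin

lemma V_L2: "V \<subseteq> L2 \<Omega>"
  using V_H1 by (auto simp: H1_def)

lemma mesh_mono: "i \<le> j \<Longrightarrow> j \<le> M \<Longrightarrow> t i \<le> t j"
proof (induction j rule: dec_induct)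
  case (step n)
  then have "t n < t (Suc n)" using mesh by (auto simp: time_mesh_def)
  then show ?case using step by simp
qed simp

lemma cell_bounds:
  assumes "m \<in> {1..M}"
  shows "0 \<le> t (m - 1)" "t (m - 1) < t m" "t m \<le> T"
proof -
  have "m - 1 < M" "Suc (m - 1) = m" using assms by auto
  then show "t (m - 1) < t m" using mesh by (metis time_mesh_def)
  have "m - 1 \<le> M" using assms by auto
  then show "0 \<le> t (m - 1)" using mesh_mono[of 0 "m - 1"] mesh by (simp add: time_mesh_def)
  show "t m \<le> T" using mesh_mono[of m M] mesh assms by (simp add: time_mesh_def)
qed

lemma cell_subset: "m \<in> {1..M} \<Longrightarrow> time_cell t m \<subseteq> {0..T}"
  using cell_bounds[of m] by (auto simp: time_cell_def)

definition avg_form :: "nat \<Rightarrow> (real^'d \<Rightarrow> real) \<Rightarrow> (real^'d \<Rightarrow> real) \<Rightarrow> real" where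
  "avg_form m u v = interval_avg (t (m - 1)) (t m) (\<lambda>s. a_form \<Omega> a s u v)"

lemma a_form_V: "s \<in> {0..T} \<Longrightarrow> psd_form V (a_form \<Omega> a s)"
  using psd_form_subset[OF a_form_psd[OF \<Omega> slices] V_H1 subspace_V] \<alpha> by simp

lemma a_form_integrable:
  assumes "m \<in> {1..M}" "u \<in> V" "v \<in> V"
  shows "integrable (lebesgue_on {t (m - 1)<..t m}) (\<lambda>s. a_form \<Omega> a s u v)"
proof -
  have "continuous_on {0..T} (\<lambda>s. a_form \<Omega> a s u v)"
    using assms V_H1 by (intro a_form_continuous[OF \<Omega> coeffs slices]) auto
  then have "integrable (lebesgue_on {0..T}) (\<lambda>s. a_form \<Omega> a s u v)"
    by (rule continuous_imp_integrable_real)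
  moreover have "{t (m - 1)<..t m} \<subseteq> {0..T}" using cell_subset[OF assms(1)] by (simp only: time_cell_def)
  ultimately show ?thesis by (rule integrable_lebesgue_on_subset) auto
qed

lemma avg_form_psd:
  assumes m: "m \<in> {1..M}"
  shows "psd_form V (avg_form m)"
proof -
  have cell: "s \<in> {0..T}" if "s \<in> {t (m - 1)<..t m}" for s
    using cell_subset[OF m] that by (auto simp: time_cell_def)
  have lin: "avg_form m (x + c *\<^sub>R y) z = avg_form m x z + c * avg_form m y z"
    if V: "x \<in> V" "y \<in> V" "z \<in> V" for x y z c
  proof -
    have "avg_form m (x + c *\<^sub>R y) z =
        interval_avg (t (m - 1)) (t m) (\<lambda>s. a_form \<Omega> a s x z + c * a_form \<Omega> a s y z)"
      unfolding avg_form_def interval_avg_def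
    proof (intro arg_cong2[of _ _ _ _ "(*)"] refl Bochner_Integration.integral_cong)
      fix s assume "s \<in> space (lebesgue_on {t (m - 1)<..t m})"
      then have "s \<in> {0..T}" using cell by simp
      then interpret s: psd_form V "a_form \<Omega> a s" by (rule a_form_V)
      show "a_form \<Omega> a s (x + c *\<^sub>R y) z = a_form \<Omega> a s x z + c * a_form \<Omega> a s y z"
        using V by (simp add: s.bilinear)
    qed
    then show ?thesis
      unfolding avg_form_def
      using interval_avg_lincomb[OF a_form_integrable[OF m V(1,3)] a_form_integrable[OF m V(2,3)]] by metis
  qed
  show ?thesis
  proof (rule psd_form_lincombI)
    show "subspace V" by (rule subspace_V)
    show "avg_form m (x + c *\<^sub>R y) z = avg_form m x z + c * avg_form m y z"
      if "x \<in> V" "y \<in> V" "z \<in> V" for x y z c using that by (rule lin)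
    show "avg_form m x y = avg_form m y x" if V: "x \<in> V" "y \<in> V" for x y
      unfolding avg_form_def interval_avg_def
      using V by (intro arg_cong2[of _ _ _ _ "(*)"] refl Bochner_Integration.integral_cong
          psd_form.sym[OF a_form_V[OF cell]]) auto
    show "0 \<le> avg_form m x x" if V: "x \<in> V" for x
      unfolding avg_form_def interval_avg_def using V cell_bounds[OF m]
      by (intro mult_nonneg_nonneg Bochner_Integration.integral_nonneg psd_form.nonneg[OF a_form_V[OF cell]]) auto
  qed
qed

lemma avg_form_coercive:
  assumes m: "m \<in> {1..M}" and u: "u \<in> V"
  shows "\<alpha> * (grad_norm \<Omega> u)\<^sup>2 \<le> avg_form m u u"
proof -
  have "\<alpha> * (grad_norm \<Omega> u)\<^sup>2 = interval_avg (t (m - 1)) (t m) (\<lambda>_. \<alpha> * (grad_norm \<Omega> u)\<^sup>2)"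
    using cell_bounds[OF m] by (simp add: interval_avg_const)
  also have "\<dots> \<le> avg_form m u u"
    unfolding avg_form_def using cell_bounds[OF m] cell_subset[OF m] V_H1 u
    by (intro interval_avg_mono integrable_const_Ioc a_form_integrable[OF m u u] a_form_coercive[OF \<Omega> slices])
      (auto simp: time_cell_def)
  finally show ?thesis .
qed

text \<open>Times in cells \<open>j < m\<close> differ by at most \<open>t\<^sub>m - t\<^sub>j\<^sub>-\<^sub>1\<close>; averaging over both cells preserves the bound.\<close>

lemma avg_form_modulus:
  assumes jm: "1 \<le> j" "j < m" "m \<le> M" and V: "u \<in> V" "v \<in> V"
  shows "\<bar>avg_form m u v - avg_form j u v\<bar>
    \<le> (real CARD('d))\<^sup>2 * \<omega> (t m - t (j - 1)) * grad_norm \<Omega> u * grad_norm \<Omega> v"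
proof -
  have m: "m \<in> {1..M}" and j: "j \<in> {1..M}" using jm by auto
  define E where "E = (real CARD('d))\<^sup>2 * \<omega> (t m - t (j - 1)) * grad_norm \<Omega> u * grad_norm \<Omega> v"
  let ?A = "\<lambda>s. a_form \<Omega> a s u v"
  note cm = cell_bounds[OF m] and cj = cell_bounds[OF j]
  have tj: "t j \<le> t (m - 1)" using jm by (intro mesh_mono) auto
  have E: "\<bar>?A s - ?A s'\<bar> \<le> E" if s: "s \<in> {t (m - 1)<..t m}" "s' \<in> {t (j - 1)<..t j}" for s s'
  proof -
    have r: "s \<in> {0..T}" "s' \<in> {0..T}" "\<bar>s - s'\<bar> \<in> {0..T}" "t m - t (j - 1) \<in> {0..T}"
      "\<bar>s - s'\<bar> \<le> t m - t (j - 1)"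
      using s cm cj tj by auto
    then have mono: "\<omega> \<bar>s - s'\<bar> \<le> \<omega> (t m - t (j - 1))" using \<omega>_mono by (auto simp: mono_on_def)
    have "AE x in lebesgue_on \<Omega>. \<bar>a i l s x - a i l s' x\<bar> \<le> \<omega> (t m - t (j - 1))" for i l
    proof -
      have "AE x in lebesgue_on \<Omega>. \<bar>a i l s x - a i l s' x\<bar> \<le> \<omega> \<bar>s - s'\<bar>"
        using coeffs r(1,2) unfolding admissible_coeffs_def by blast
      then show ?thesis using mono by (auto elim: eventually_mono)
    qed
    then show ?thesis unfolding E_def
      using V V_H1 \<omega>_nonneg[OF r(4)] by (intro a_form_modulus[OF \<Omega> slices[OF r(1)] slices[OF r(2)]]) auto
  qed
  have I: "integrable (lebesgue_on {t (m - 1)<..t m}) ?A" "integrable (lebesgue_on {t (j - 1)<..t j}) ?A"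
    by (rule a_form_integrable[OF m V] a_form_integrable[OF j V])+
  have 1: "avg_form m u v - E \<le> ?A s' \<and> ?A s' \<le> avg_form m u v + E" if s': "s' \<in> {t (j - 1)<..t j}" for s'
  proof -
    have le: "?A s \<le> ?A s' + E" "?A s' - E \<le> ?A s" if "s \<in> {t (m - 1)<..t m}" for s
      using E[OF that s'] by auto
    have "avg_form m u v \<le> interval_avg (t (m - 1)) (t m) (\<lambda>_. ?A s' + E)"
      unfolding avg_form_def using cm by (intro interval_avg_mono I integrable_const_Ioc le)
    moreover have "interval_avg (t (m - 1)) (t m) (\<lambda>_. ?A s' - E) \<le> avg_form m u v"
      unfolding avg_form_def using cm by (intro interval_avg_mono I integrable_const_Ioc le)
    ultimately show ?thesis using cm by (simp add: interval_avg_const)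
  qed
  have "interval_avg (t (j - 1)) (t j) (\<lambda>_. avg_form m u v - E) \<le> avg_form j u v"
    unfolding avg_form_def[of j] using cj 1 by (intro interval_avg_mono I integrable_const_Ioc) auto
  moreover have "avg_form j u v \<le> interval_avg (t (j - 1)) (t j) (\<lambda>_. avg_form m u v + E)"
    unfolding avg_form_def[of j] using cj 1 by (intro interval_avg_mono I integrable_const_Ioc) auto
  ultimately have "\<bar>avg_form m u v - avg_form j u v\<bar> \<le> E"
    using cj by (simp add: interval_avg_const abs_le_iff)
  then show ?thesis by (simp add: E_def)
qed

lemma A_disc_eq:
  assumes "s \<in> {0..T}" "v \<in> V"
  shows "A_disc \<Omega> a V s v = rep (a_form \<Omega> a s) v"
  unfolding A_disc_def
proof (rule the_equality)
  show "rep (a_form \<Omega> a s) v \<in> V \<and> (\<forall>\<phi>\<in>V. L2_inner \<Omega> (rep (a_form \<Omega> a s) v) \<phi> = a_form \<Omega> a s v \<phi>)"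
    using rep[OF a_form_V[OF assms(1)] assms(2)] by auto
  fix w assume "w \<in> V \<and> (\<forall>\<phi>\<in>V. L2_inner \<Omega> w \<phi> = a_form \<Omega> a s v \<phi>)"
  then show "w = rep (a_form \<Omega> a s) v"
    using rep[OF a_form_V[OF assms(1)] assms(2)] by (intro ext) auto
qed

text \<open>In an orthonormal basis the coefficients of \<open>A\<^sub>h(s) v\<close> are \<open>a(s; v, e)\<close>, so the pointwise time average has
  the averaged form as coefficients.\<close>

lemma A_disc_avg_eq:
  assumes m: "m \<in> {1..M}" and v: "v \<in> V"
  shows "A_disc_avg \<Omega> a V t m v = rep (avg_form m) v"
proof
  fix x
  obtain E where E: "finite E" "E \<subseteq> V" "\<And>w. w \<in> V \<Longrightarrow> w = (\<Sum>e\<in>E. L2_inner \<Omega> w e *\<^sub>R e)"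
    by (rule orthonormal_basis) auto
  have pt: "rep b v x = (\<Sum>e\<in>E. b v e * e x)" if "psd_form V b" for b
  proof -
    have "rep b v = (\<Sum>e\<in>E. b v e *\<^sub>R e)"
      using E(3)[OF rep_mem[OF that v]] E(2) rep_eq[OF that v] by (simp add: subset_iff cong: sum.cong)
    then show ?thesis by (simp add: sum_fun_apply)
  qed
  have "(\<integral>s. A_disc \<Omega> a V s v x \<partial>lebesgue_on (time_cell t m))
      = (\<integral>s. (\<Sum>e\<in>E. a_form \<Omega> a s v e * e x) \<partial>lebesgue_on (time_cell t m))"
    using cell_subset[OF m]
    by (intro Bochner_Integration.integral_cong) (auto simp: A_disc_eq v pt a_form_V)
  also have "\<dots> = (\<Sum>e\<in>E. (\<integral>s. a_form \<Omega> a s v e \<partial>lebesgue_on (time_cell t m)) * e x)"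
    using a_form_integrable[OF m v] E(2) by (subst Bochner_Integration.integral_sum) (auto simp: time_cell_def)
  finally have "A_disc_avg \<Omega> a V t m v x = (\<Sum>e\<in>E. avg_form m v e * e x)"
    by (simp add: A_disc_avg_def avg_form_def interval_avg_def time_step_def time_cell_def sum_divide_distrib)
  then show "A_disc_avg \<Omega> a V t m v x = rep (avg_form m) v x" using pt[OF avg_form_psd[OF m]] by simp
qed

lemma L2_proj_props:
  assumes u: "u \<in> L2 \<Omega>"
  shows "L2_proj \<Omega> V u \<in> V" "\<And>\<phi>. \<phi> \<in> V \<Longrightarrow> L2_inner \<Omega> (L2_proj \<Omega> V u) \<phi> = L2_inner \<Omega> u \<phi>"
    "L2_norm \<Omega> (L2_proj \<Omega> V u) \<le> L2_norm \<Omega> u"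
proof -
  interpret L: psd_form "L2 \<Omega>" "L2_inner \<Omega>" by (rule L2_inner_psd)
  have VL: "\<phi> \<in> V \<Longrightarrow> \<phi> \<in> L2 \<Omega>" for \<phi> using V_L2 by auto
  obtain w where w: "w \<in> V" "\<And>\<phi>. \<phi> \<in> V \<Longrightarrow> L2_inner \<Omega> w \<phi> = L2_inner \<Omega> u \<phi>"
    using Riesz[of "L2_inner \<Omega> u"] VL u by (auto simp: L.bilinear)
  have diff: "L2_inner \<Omega> (\<lambda>x. u x - z x) \<phi> = L2_inner \<Omega> u \<phi> - L2_inner \<Omega> z \<phi>" if "z \<in> V" "\<phi> \<in> V" for z \<phi>
    using L.diff_left[of u z \<phi>] u that VL by (simp add: fun_diff_def)
  have eq: "L2_proj \<Omega> V u = w"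
    unfolding L2_proj_def
  proof (rule the_equality)
    show "w \<in> V \<and> (\<forall>\<phi>\<in>V. L2_inner \<Omega> (\<lambda>x. u x - w x) \<phi> = 0)" using w diff by auto
    fix z assume "z \<in> V \<and> (\<forall>\<phi>\<in>V. L2_inner \<Omega> (\<lambda>x. u x - z x) \<phi> = 0)"
    then show "z = w" using w diff by (intro ext) auto
  qed
  show "L2_proj \<Omega> V u \<in> V" "\<And>\<phi>. \<phi> \<in> V \<Longrightarrow> L2_inner \<Omega> (L2_proj \<Omega> V u) \<phi> = L2_inner \<Omega> u \<phi>"
    using w eq by auto
  have "L2_norm \<Omega> w * L2_norm \<Omega> w = L2_inner \<Omega> w w" using nonneg[OF w(1)] by (simp add: L2_norm_def)
  also have "\<dots> \<le> L2_norm \<Omega> u * L2_norm \<Omega> w"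
    using L.Cauchy_Schwarz[OF u VL[OF w(1)]] w(2)[OF w(1)] by (simp add: L2_norm_def)
  finally have le: "L2_norm \<Omega> w * L2_norm \<Omega> w \<le> L2_norm \<Omega> w * L2_norm \<Omega> u"
    by (simp only: mult.commute[of "L2_norm \<Omega> u"])
  then show "L2_norm \<Omega> (L2_proj \<Omega> V u) \<le> L2_norm \<Omega> u"
    unfolding eq
    by (intro le_of_square_le_mult[OF _ _ le]) (simp_all add: L2_norm_def nonneg[OF w(1)] L.nonneg[OF u])
qed

end

section \<open>The load and the tested scheme\<close>

text \<open>Along the approximating simple functions the functional takes finitely many values on measurable sets,
  and its Lipschitz continuity transfers their convergence.\<close>

lemma Linf_L2_measurable_functional:
  assumes J: "J \<in> sets lebesgue" and f: "f \<in> Linf_L2 \<Omega> J"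
    and h: "\<And>v w. v \<in> L2 \<Omega> \<Longrightarrow> w \<in> L2 \<Omega> \<Longrightarrow> \<bar>h v - h w\<bar> \<le> c * L2_norm \<Omega> (\<lambda>x. v x - w x)"
  shows "(\<lambda>s. h (f s) :: real) \<in> borel_measurable (lebesgue_on J)"
proof -
  obtain \<sigma> where \<sigma>: "\<And>n. simple_fun_L2 \<Omega> J (\<sigma> n)"
    "AE s in lebesgue_on J. (\<lambda>n::nat. L2_norm \<Omega> (\<lambda>x. \<sigma> n s x - f s x)) \<longlonglongrightarrow> 0"
    using f by (auto simp: Linf_L2_def)
  have fL: "AE s in lebesgue_on J. f s \<in> L2 \<Omega>" using f by (simp add: Linf_L2_def)
  have meas: "(\<lambda>s. h (\<sigma> n s)) \<in> borel_measurable (lebesgue_on J)" for n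
  proof -
    have fin: "finite (\<sigma> n ` J)" using \<sigma>(1)[of n] by (simp add: simple_fun_L2_def)
    have "(\<lambda>s. \<Sum>w\<in>\<sigma> n ` J. h w * indicator {s \<in> J. \<sigma> n s = w} s) \<in> borel_measurable (lebesgue_on J)"
    proof (intro borel_measurable_sum borel_measurable_times borel_measurable_const borel_measurable_indicator)
      fix w assume "w \<in> \<sigma> n ` J"
      then have "{s \<in> J. \<sigma> n s = w} \<in> sets lebesgue" using \<sigma>(1)[of n] unfolding simple_fun_L2_def by blast
      then show "{s \<in> J. \<sigma> n s = w} \<in> sets (lebesgue_on J)" using J by (auto simp: sets_restrict_space_iff)
    qed
    moreover have "(\<Sum>w\<in>\<sigma> n ` J. h w * indicator {s \<in> J. \<sigma> n s = w} s) = h (\<sigma> n s)" if "s \<in> J" for s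
    proof -
      have "(\<Sum>w\<in>\<sigma> n ` J. h w * indicator {s \<in> J. \<sigma> n s = w} s)
          = (\<Sum>w\<in>\<sigma> n ` J. if w = \<sigma> n s then h (\<sigma> n s) else 0)"
        using that by (intro sum.cong) (auto simp: indicator_def)
      then show ?thesis using that fin by simp
    qed
    ultimately show ?thesis by (subst measurable_cong[of _ _ "\<lambda>s. \<Sum>w\<in>\<sigma> n ` J. h w * indicator {s \<in> J. \<sigma> n s = w} s"]) auto
  qed
  show ?thesis
  proof (rule borel_measurable_AE_lebesgue_on[OF J])
    show "(\<lambda>s. lim (\<lambda>n. h (\<sigma> n s))) \<in> borel_measurable (lebesgue_on J)"
      using meas by (rule borel_measurable_lim_metric)
    have "AE s in lebesgue_on J. s \<in> J" using J by (intro AE_I2) simp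
    with \<sigma>(2) fL show "AE s in lebesgue_on J. lim (\<lambda>n. h (\<sigma> n s)) = h (f s)"
    proof eventually_elim
      case (elim s)
      have \<sigma>L: "\<sigma> n s \<in> L2 \<Omega>" for n using \<sigma>(1)[of n] elim(3) by (auto simp: simple_fun_L2_def)
      have "(\<lambda>n. c * L2_norm \<Omega> (\<lambda>x. \<sigma> n s x - f s x)) \<longlonglongrightarrow> c * 0"
        using elim(1) by (intro tendsto_mult_left)
      then have lim0: "(\<lambda>n. c * L2_norm \<Omega> (\<lambda>x. \<sigma> n s x - f s x)) \<longlonglongrightarrow> 0" by simp
      have "\<forall>\<^sub>F n in sequentially. norm (h (\<sigma> n s) - h (f s)) \<le> c * L2_norm \<Omega> (\<lambda>x. \<sigma> n s x - f s x)"
        using h[OF \<sigma>L elim(2)] by (intro always_eventually allI) (simp only: real_norm_def)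
      then have "(\<lambda>n. h (\<sigma> n s) - h (f s)) \<longlonglongrightarrow> 0" using lim0 by (rule Lim_null_comparison)
      then have "(\<lambda>n. h (\<sigma> n s)) \<longlonglongrightarrow> h (f s)" by (simp only: LIM_zero_iff)
      then show ?case by (rule limI)
    qed
  qed
qed

lemma L2_inner_Lipschitz:
  assumes "v \<in> L2 \<Omega>" "w \<in> L2 \<Omega>" "\<phi> \<in> L2 \<Omega>"
  shows "\<bar>L2_inner \<Omega> v \<phi> - L2_inner \<Omega> w \<phi>\<bar> \<le> L2_norm \<Omega> \<phi> * L2_norm \<Omega> (\<lambda>x. v x - w x)"
proof -
  interpret L: psd_form "L2 \<Omega>" "L2_inner \<Omega>" by (rule L2_inner_psd)
  have vw: "v - w \<in> L2 \<Omega>" using assms by auto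
  have "L2_inner \<Omega> v \<phi> - L2_inner \<Omega> w \<phi> = L2_inner \<Omega> (v - w) \<phi>" using assms by (simp add: L.bilinear)
  moreover have "L2_inner \<Omega> (v - w) \<phi> \<le> L2_norm \<Omega> (v - w) * L2_norm \<Omega> \<phi>"
    using L.Cauchy_Schwarz[OF vw assms(3)] by (simp add: L2_norm_def)
  moreover have "- L2_inner \<Omega> (v - w) \<phi> \<le> L2_norm \<Omega> (v - w) * L2_norm \<Omega> \<phi>"
  proof -
    have "L2_inner \<Omega> ((-1) *\<^sub>R (v - w)) \<phi> \<le> sqrt (L2_inner \<Omega> ((-1) *\<^sub>R (v - w)) ((-1) *\<^sub>R (v - w))) * sqrt (L2_inner \<Omega> \<phi> \<phi>)"
      by (intro L.Cauchy_Schwarz L.mem(3) vw assms(3))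
    then show ?thesis using vw assms L.norm_scale[OF vw, of "-1"] L.scale_left[OF vw assms(3), of "-1"]
      by (simp add: L2_norm_def)
  qed
  ultimately show ?thesis by (simp add: fun_diff_def abs_le_iff mult.commute)
qed

lemma L2_norm_Lipschitz:
  assumes "v \<in> L2 \<Omega>" "w \<in> L2 \<Omega>"
  shows "\<bar>L2_norm \<Omega> v - L2_norm \<Omega> w\<bar> \<le> 1 * L2_norm \<Omega> (\<lambda>x. v x - w x)"
proof -
  interpret L: psd_form "L2 \<Omega>" "L2_inner \<Omega>" by (rule L2_inner_psd)
  have vw: "v - w \<in> L2 \<Omega>" using assms by auto
  have "L2_norm \<Omega> v \<le> L2_norm \<Omega> (v - w) + L2_norm \<Omega> w"
    using L.triangle[OF vw assms(2)] by (simp add: L2_norm_def)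
  moreover have "L2_norm \<Omega> w \<le> L2_norm \<Omega> (v - w) + L2_norm \<Omega> v"
    using L.triangle[OF L.mem(3)[OF vw, of "-1"] assms(1)] L.norm_scale[OF vw, of "-1"]
    by (simp add: L2_norm_def)
  ultimately show ?thesis by (simp add: fun_diff_def abs_le_iff)
qed

lemma Linf_L2_integrable:
  assumes f: "f \<in> Linf_L2 \<Omega> {0<..<T}"
  shows "integrable (lebesgue_on {0<..<T}) (\<lambda>s. L2_norm \<Omega> (f s))"
    and "\<phi> \<in> L2 \<Omega> \<Longrightarrow> integrable (lebesgue_on {0<..<T}) (\<lambda>s. L2_inner \<Omega> (f s) \<phi>)"
    and "\<phi> \<in> L2 \<Omega> \<Longrightarrow> AE s in lebesgue_on {0<..<T}. \<bar>L2_inner \<Omega> (f s) \<phi>\<bar> \<le> L2_norm \<Omega> (f s) * L2_norm \<Omega> \<phi>"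
proof -
  have J: "{0<..<T} \<in> sets lebesgue" by simp
  interpret finite_measure "lebesgue_on {0<..<T}"
    by (rule finite_measure_lebesgue_on) (metis box_real(1) lmeasurable_box)
  obtain B where B: "AE s in lebesgue_on {0<..<T}. L2_norm \<Omega> (f s) \<le> B"
    using f by (auto simp: Linf_L2_def)
  have fL: "AE s in lebesgue_on {0<..<T}. f s \<in> L2 \<Omega>" using f by (simp add: Linf_L2_def)
  have pos: "L2_norm \<Omega> w \<ge> 0" for w
    by (auto simp: L2_norm_def L2_inner_def intro!: Bochner_Integration.integral_nonneg)
  show 1: "integrable (lebesgue_on {0<..<T}) (\<lambda>s. L2_norm \<Omega> (f s))"
  proof (rule integrable_const_bound[of _ B])
    show "(\<lambda>s. L2_norm \<Omega> (f s)) \<in> borel_measurable (lebesgue_on {0<..<T})"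
      using L2_norm_Lipschitz by (rule Linf_L2_measurable_functional[OF J f])
  qed (use B pos in auto)
  show 2: "AE s in lebesgue_on {0<..<T}. \<bar>L2_inner \<Omega> (f s) \<phi>\<bar> \<le> L2_norm \<Omega> (f s) * L2_norm \<Omega> \<phi>"
    if \<phi>: "\<phi> \<in> L2 \<Omega>" for \<phi>
    using fL
  proof eventually_elim
    case (elim s)
    have "L2_inner \<Omega> (\<lambda>x. 0) \<phi> = 0" by (simp add: L2_inner_def)
    then show ?case using L2_inner_Lipschitz[OF elim L2_zero \<phi>] by (simp add: mult.commute)
  qed
  show "integrable (lebesgue_on {0<..<T}) (\<lambda>s. L2_inner \<Omega> (f s) \<phi>)" if \<phi>: "\<phi> \<in> L2 \<Omega>"
  proof (rule Bochner_Integration.integrable_bound)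
    show "integrable (lebesgue_on {0<..<T}) (\<lambda>s. L2_norm \<Omega> (f s) * L2_norm \<Omega> \<phi>)" using 1 by simp
    show "(\<lambda>s. L2_inner \<Omega> (f s) \<phi>) \<in> borel_measurable (lebesgue_on {0<..<T})"
      using L2_inner_Lipschitz[OF _ _ \<phi>] by (rule Linf_L2_measurable_functional[OF J f])
    show "AE s in lebesgue_on {0<..<T}. norm (L2_inner \<Omega> (f s) \<phi>) \<le> norm (L2_norm \<Omega> (f s) * L2_norm \<Omega> \<phi>)"
      using 2[OF \<phi>] by eventually_elim (simp add: abs_mult pos)
  qed
qed

context space_time_discretization
begin

definition load :: "(real \<Rightarrow> real^'d \<Rightarrow> real) \<Rightarrow> nat \<Rightarrow> (real^'d \<Rightarrow> real) \<Rightarrow> real" where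
  "load f m \<phi> = (\<integral>s. indicator (time_cell t m) s * L2_inner \<Omega> (f s) \<phi> \<partial>lebesgue_on {0<..<T})"

definition cell_norm :: "(real \<Rightarrow> real^'d \<Rightarrow> real) \<Rightarrow> nat \<Rightarrow> real" where
  "cell_norm f m = (\<integral>s. indicator (time_cell t m) s * L2_norm \<Omega> (f s) \<partial>lebesgue_on {0<..<T})"

lemma integrable_on_cell:
  assumes "integrable (lebesgue_on {0<..<T}) g"
  shows "integrable (lebesgue_on {0<..<T}) (\<lambda>s. indicator (time_cell t m) s * g s :: real)"
proof -
  have "time_cell t m \<inter> {0<..<T} \<in> sets (lebesgue_on {0<..<T})"
    by (simp add: sets_restrict_space_iff time_cell_def)
  then have "integrable (lebesgue_on {0<..<T}) (\<lambda>s. indicator (time_cell t m \<inter> {0<..<T}) s *\<^sub>R g s)"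
    using assms by (rule integrable_mult_indicator)
  then show ?thesis
    by (rule Bochner_Integration.integrable_cong[THEN iffD1, rotated 2]) (auto simp: indicator_def)
qed

text \<open>The Riesz vector of the load on one cell. Testing it with itself bounds its norm by the integral of
  \<open>\<parallel>f(s)\<parallel>\<close> over the cell.\<close>

lemma load_representation:
  assumes f: "f \<in> Linf_L2 \<Omega> {0<..<T}"
  shows "\<exists>F\<in>V. (\<forall>\<phi>\<in>V. L2_inner \<Omega> F \<phi> = load f m \<phi>) \<and> L2_norm \<Omega> F \<le> cell_norm f m"
proof -
  interpret L: psd_form "L2 \<Omega>" "L2_inner \<Omega>" by (rule L2_inner_psd)
  let ?J = "lebesgue_on {0<..<T}"
  have VL: "\<phi> \<in> V \<Longrightarrow> \<phi> \<in> L2 \<Omega>" for \<phi> using V_L2 by auto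
  have fL: "AE s in ?J. f s \<in> L2 \<Omega>" using f by (simp add: Linf_L2_def)
  have I: "integrable ?J (\<lambda>s. indicator (time_cell t m) s * L2_inner \<Omega> (f s) \<phi>)" if "\<phi> \<in> V" for \<phi>
    using Linf_L2_integrable(2)[OF f VL[OF that]] by (rule integrable_on_cell)
  have lin: "load f m (x + c *\<^sub>R y) = load f m x + c * load f m y" if xy: "x \<in> V" "y \<in> V" for x y c
  proof -
    have "load f m (x + c *\<^sub>R y) = (\<integral>s. indicator (time_cell t m) s * L2_inner \<Omega> (f s) x
        + c * (indicator (time_cell t m) s * L2_inner \<Omega> (f s) y) \<partial>?J)"
      unfolding load_def
    proof (rule integral_cong_AE)
      show "AE s in ?J. indicator (time_cell t m) s * L2_inner \<Omega> (f s) (x + c *\<^sub>R y)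
        = indicator (time_cell t m) s * L2_inner \<Omega> (f s) x + c * (indicator (time_cell t m) s * L2_inner \<Omega> (f s) y)"
        using fL by eventually_elim (use xy VL in \<open>simp add: L.bilinear algebra_simps\<close>)
      show "(\<lambda>s. indicator (time_cell t m) s * L2_inner \<Omega> (f s) (x + c *\<^sub>R y)) \<in> borel_measurable ?J"
        using xy by (intro borel_measurable_integrable I) auto
    qed (use xy I in auto)
    then show ?thesis using I xy by (simp add: load_def)
  qed
  have l0: "load f m 0 = 0" by (simp add: load_def L2_inner_def)
  obtain F where F: "F \<in> V" "\<And>\<phi>. \<phi> \<in> V \<Longrightarrow> L2_inner \<Omega> F \<phi> = load f m \<phi>"
  proof -
    have "\<exists>w\<in>V. \<forall>z\<in>V. L2_inner \<Omega> w z = load f m z"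
    proof (rule Riesz)
      show "load f m (x + y) = load f m x + load f m y" if "x \<in> V" "y \<in> V" for x y
        using lin[OF that, of 1] by simp
      show "load f m (c *\<^sub>R x) = c * load f m x" if "x \<in> V" for c x
        using lin[of 0 x c] that l0 by simp
    qed
    then show ?thesis using that by blast
  qed
  have "L2_norm \<Omega> F * L2_norm \<Omega> F = load f m F" using F nonneg[OF F(1)] by (simp add: L2_norm_def)
  also have "\<dots> \<le> (\<integral>s. indicator (time_cell t m) s * L2_norm \<Omega> (f s) * L2_norm \<Omega> F \<partial>?J)"
    unfolding load_def
  proof (rule integral_mono_AE)
    show "integrable ?J (\<lambda>s. indicator (time_cell t m) s * L2_norm \<Omega> (f s) * L2_norm \<Omega> F)"
      by (intro integrable_mult_left integrable_on_cell Linf_L2_integrable[OF f])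
    show "AE s in ?J. indicator (time_cell t m) s * L2_inner \<Omega> (f s) F
        \<le> indicator (time_cell t m) s * L2_norm \<Omega> (f s) * L2_norm \<Omega> F"
      using Linf_L2_integrable(3)[OF f VL[OF F(1)]]
      by eventually_elim (auto simp: indicator_def)
  qed (rule I[OF F(1)])
  also have "\<dots> = L2_norm \<Omega> F * cell_norm f m" by (simp add: cell_norm_def)
  finally have le: "L2_norm \<Omega> F * L2_norm \<Omega> F \<le> L2_norm \<Omega> F * cell_norm f m" .
  have "0 \<le> cell_norm f m"
    unfolding cell_norm_def L2_norm_def L2_inner_def by (intro Bochner_Integration.integral_nonneg) auto
  then have "L2_norm \<Omega> F \<le> cell_norm f m"
    by (intro le_of_square_le_mult[OF _ _ le]) (simp_all add: L2_norm_def nonneg[OF F(1)])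
  with F show ?thesis by blast
qed

lemma cell_disjoint:
  assumes "m \<in> {1..M}" "n \<in> {1..M}" "s \<in> time_cell t m" "s \<in> time_cell t n"
  shows "m = n"
proof (rule ccontr)
  assume "m \<noteq> n"
  then consider "m \<le> n - 1" | "n \<le> m - 1" by linarith
  then show False
  proof cases
    case 1
    have "n - 1 \<le> M" using assms by auto
    then show False using mesh_mono[OF 1] assms(3,4) by (auto simp: time_cell_def)
  next
    case 2
    have "m - 1 \<le> M" using assms by auto
    then show False using mesh_mono[OF 2] assms(3,4) by (auto simp: time_cell_def)
  qed
qed

lemma sum_cell_norm:
  assumes f: "f \<in> Linf_L2 \<Omega> {0<..<T}"
  shows "(\<Sum>m=1..M. cell_norm f m) \<le> L1_L2_norm \<Omega> {0<..<T} f"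
proof -
  let ?J = "lebesgue_on {0<..<T}"
  have I: "integrable ?J (\<lambda>s. indicator (time_cell t m) s * L2_norm \<Omega> (f s))" for m
    by (intro integrable_on_cell Linf_L2_integrable[OF f])
  have "(\<Sum>m=1..M. cell_norm f m) = (\<integral>s. (\<Sum>m=1..M. indicator (time_cell t m) s * L2_norm \<Omega> (f s)) \<partial>?J)"
    unfolding cell_norm_def using I by (subst Bochner_Integration.integral_sum) auto
  also have "\<dots> \<le> (\<integral>s. L2_norm \<Omega> (f s) \<partial>?J)"
  proof (intro integral_mono Bochner_Integration.integrable_sum I Linf_L2_integrable(1)[OF f])
    fix s
    have "(\<Sum>m=1..n. indicator (time_cell t m) s) = (indicator {t 0<..t n} s :: real)" if "n \<le> M" for n
      using that
    proof (induction n)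
      case (Suc n)
      then show ?case using mesh_mono[of 0 n] mesh_mono[of n "Suc n"] by (auto simp: indicator_def time_cell_def)
    qed simp
    then have "(\<Sum>m=1..M. indicator (time_cell t m) s * L2_norm \<Omega> (f s)) = indicator {t 0<..t M} s * L2_norm \<Omega> (f s)"
      by (simp only: sum_distrib_right[symmetric] order.refl)
    also have "\<dots> \<le> L2_norm \<Omega> (f s)"
      by (auto simp: indicator_def L2_norm_def L2_inner_def intro!: Bochner_Integration.integral_nonneg)
    finally show "(\<Sum>m=1..M. indicator (time_cell t m) s * L2_norm \<Omega> (f s)) \<le> L2_norm \<Omega> (f s)" .
  qed
  finally show ?thesis by (simp add: L1_L2_norm_def)
qed

lemma a_form_zero_right: "a_form \<Omega> a s u 0 = 0"
proof -
  have "has_weak_gradient \<Omega> 0 (\<lambda>x. 0)"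
    by (auto simp: has_weak_gradient_def L2_zero)
  with weak_grad[OF \<Omega> H1_zero[OF \<Omega>]] have "AE x in lebesgue_on \<Omega>. weak_grad \<Omega> 0 x = 0"
    by (rule has_weak_gradient_unique[OF \<Omega>])
  then have "AE x in lebesgue_on \<Omega>.
      (\<Sum>i\<in>UNIV. \<Sum>j\<in>UNIV. a i j s x * weak_grad \<Omega> u x $ i * weak_grad \<Omega> 0 x $ j) = 0"
    by eventually_elim simp
  then show ?thesis unfolding a_form_def by (rule integral_eq_zero_AE)
qed

text \<open>The test function equal to \<open>\<phi>\<close> on the \<open>m\<close>-th cell and zero on the others isolates one time step.\<close>

lemma tested_scheme:
  assumes u: "fully_discrete_solution \<Omega> T a M t V f u0 u"
    and m: "m \<in> {1..M}" and \<phi>: "\<phi> \<in> V"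
  shows "time_step t m * avg_form m (u (t m)) \<phi>
      + (if m = 1 then L2_inner \<Omega> (u (t 1)) \<phi> else L2_inner \<Omega> (u (t m) - u (t (m - 1))) \<phi>)
    = load f m \<phi> + (if m = 1 then L2_inner \<Omega> u0 \<phi> else 0)"
proof -
  define \<psi> where "\<psi> s = (if s \<in> time_cell t m then \<phi> else 0)" for s
  have right: "t n \<in> time_cell t n" if "n \<in> {1..M}" for n using cell_bounds[OF that] by (simp add: time_cell_def)
  have \<psi>_at: "\<psi> s = (if n = m then \<phi> else 0)" if "n \<in> {1..M}" "s \<in> time_cell t n" for n s
    using that cell_disjoint[OF m that(1), of s] by (auto simp: \<psi>_def)
  have \<psi>t: "\<psi> (t n) = (if n = m then \<phi> else 0)" if "n \<in> {1..M}" for n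
    using \<psi>_at[OF that right[OF that]] .
  have "\<psi> \<in> X_space M t V"
    unfolding X_space_def
  proof (intro CollectI ballI conjI)
    fix n assume n: "n \<in> {1..M}"
    show "\<psi> (t n) \<in> V" using \<psi>t[OF n] \<phi> by simp
    show "\<psi> s = \<psi> (t n)" if "s \<in> time_cell t n" for s using \<psi>_at[OF n that] \<psi>t[OF n] by simp
  qed
  then have eq: "(\<integral>s. a_form \<Omega> a s (u s) (\<psi> s) \<partial>lebesgue_on {0<..<T})
        + (\<Sum>n = 2..M. L2_inner \<Omega> (\<lambda>x. u (t n) x - u (t (n - 1)) x) (\<psi> (t n)))
        + L2_inner \<Omega> (u (t 1)) (\<psi> (t 1))
        = (\<integral>s. L2_inner \<Omega> (f s) (\<psi> s) \<partial>lebesgue_on {0<..<T}) + L2_inner \<Omega> u0 (\<psi> (t 1))"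
    using u by (simp add: fully_discrete_solution_def)
  have uX: "u (t m) \<in> V" "\<And>s. s \<in> time_cell t m \<Longrightarrow> u s = u (t m)"
    using u m by (auto simp: fully_discrete_solution_def X_space_def)
  have z: "L2_inner \<Omega> w 0 = 0" for w by (simp add: L2_inner_def)
  have M1: "1 \<in> {1..M}" using m by auto
  have s1: "(\<integral>s. a_form \<Omega> a s (u s) (\<psi> s) \<partial>lebesgue_on {0<..<T}) = time_step t m * avg_form m (u (t m)) \<phi>"
  proof -
    let ?g = "\<lambda>s. a_form \<Omega> a s (u (t m)) \<phi>"
    note cb = cell_bounds[OF m]
    have "(\<integral>s. a_form \<Omega> a s (u s) (\<psi> s) \<partial>lebesgue_on {0<..<T})
        = (\<integral>s. indicator {0<..<T} s *\<^sub>R (indicator (time_cell t m) s * ?g s) \<partial>lebesgue)"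
      by (subst integral_restrict_space)
        (auto simp: \<psi>_def uX(2) a_form_zero_right indicator_def intro!: Bochner_Integration.integral_cong)
    also have "\<dots> = (\<integral>s. indicator (time_cell t m) s *\<^sub>R ?g s \<partial>lebesgue)"
    proof (rule integral_cong_AE)
      have g: "(\<lambda>s. indicator (time_cell t m) s *\<^sub>R ?g s) \<in> borel_measurable lebesgue"
        using a_form_integrable[OF m uX(1) \<phi>, THEN borel_measurable_integrable]
        by (subst (asm) borel_measurable_restrict_space_iff) (auto simp: time_cell_def)
      then show "(\<lambda>s. indicator (time_cell t m) s *\<^sub>R ?g s) \<in> borel_measurable lebesgue" .
      have i: "(indicator {0<..<T} :: real \<Rightarrow> real) \<in> borel_measurable lebesgue"
        by (intro borel_measurable_indicator) simp
      show "(\<lambda>s. indicator {0<..<T} s *\<^sub>R (indicator (time_cell t m) s * ?g s)) \<in> borel_measurable lebesgue"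
        using borel_measurable_times[OF i g] by simp
      \<comment> \<open>The last cell contains the end point \<open>T\<close>, which the open interval \<open>(0, T)\<close> omits.\<close>
      have "AE s in lebesgue. s \<noteq> T" by (intro AE_completion AE_lborel_singleton)
      then show "AE s in lebesgue. indicator {0<..<T} s *\<^sub>R (indicator (time_cell t m) s * ?g s)
          = indicator (time_cell t m) s *\<^sub>R ?g s"
        by eventually_elim (use cb in \<open>auto simp: indicator_def time_cell_def\<close>)
    qed
    also have "\<dots> = (\<integral>s. ?g s \<partial>lebesgue_on (time_cell t m))"
      by (subst integral_restrict_space) (auto simp: time_cell_def)
    also have "\<dots> = time_step t m * avg_form m (u (t m)) \<phi>"
      using cb by (simp add: avg_form_def interval_avg_def time_cell_def time_step_def)
    finally show ?thesis .
  qed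
  have s2: "(\<integral>s. L2_inner \<Omega> (f s) (\<psi> s) \<partial>lebesgue_on {0<..<T}) = load f m \<phi>"
    unfolding load_def by (intro Bochner_Integration.integral_cong) (auto simp: \<psi>_def z indicator_def)
  have s3: "(\<Sum>n = 2..M. L2_inner \<Omega> (\<lambda>x. u (t n) x - u (t (n - 1)) x) (\<psi> (t n)))
      = (if m = 1 then 0 else L2_inner \<Omega> (u (t m) - u (t (m - 1))) \<phi>)"
  proof -
    have "(\<Sum>n = 2..M. L2_inner \<Omega> (\<lambda>x. u (t n) x - u (t (n - 1)) x) (\<psi> (t n)))
       = (\<Sum>n = 2..M. if n = m then L2_inner \<Omega> (u (t m) - u (t (m - 1))) \<phi> else 0)"
      by (intro sum.cong) (auto simp: \<psi>t z fun_diff_def)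
    then show ?thesis using m by auto
  qed
  show ?thesis using eq s1 s2 s3 \<psi>t[OF M1] z by (auto split: if_splits)
qed

end

section \<open>The estimate\<close>

text \<open>From \<open>k\<^sub>m\<^sub>i\<^sub>n \<ge> c k\<^sup>\<beta>\<close> one gets \<open>ln (T / k\<^sub>m\<^sub>i\<^sub>n) \<le> \<beta> ln (T / k) + (1 - \<beta>) ln T - ln c\<close>. The constants are absorbed
  since \<open>k \<le> T/4\<close> and \<open>e \<le> 4\<close> give \<open>ln (T / k) \<ge> 1\<close>.\<close>

lemma ln_ratio_min_step:
  fixes T k k' c \<beta> :: real
  assumes "T > 0" "c > 0" "\<beta> > 0" "0 < k" "k \<le> T / 4" "c * k powr \<beta> \<le> k'"
  shows "1 \<le> ln (T / k)" "ln (T / k') \<le> (\<beta> + \<bar>1 - \<beta>\<bar> * \<bar>ln T\<bar> + \<bar>ln c\<bar>) * ln (T / k)"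
proof -
  have "4 \<le> T / k" using assms by (simp add: field_simps)
  with exp_le have "exp 1 \<le> T / k" by linarith
  then show 1: "1 \<le> ln (T / k)" using assms by (subst ln_ge_iff) auto
  have k': "0 < c * k powr \<beta>" using assms by simp
  then have k'0: "k' > 0" using assms by linarith
  have "ln (T / k') = ln T - ln k'" using assms k'0 by (simp add: ln_div)
  also have "\<dots> \<le> ln T - ln (c * k powr \<beta>)" using assms k' k'0 by simp
  also have "\<dots> = \<beta> * ln (T / k) + (1 - \<beta>) * ln T - ln c"
    using assms by (simp add: ln_mult ln_powr ln_div algebra_simps)
  also have "\<dots> \<le> \<beta> * ln (T / k) + \<bar>1 - \<beta>\<bar> * \<bar>ln T\<bar> * 1 + \<bar>ln c\<bar> * 1"
  proof -
    have "(1 - \<beta>) * ln T \<le> \<bar>1 - \<beta>\<bar> * \<bar>ln T\<bar>" by (metis abs_ge_self abs_mult)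
    then show ?thesis by (simp add: abs_le_iff)
  qed
  also have "\<dots> \<le> \<beta> * ln (T / k) + \<bar>1 - \<beta>\<bar> * \<bar>ln T\<bar> * ln (T / k) + \<bar>ln c\<bar> * ln (T / k)"
    using 1 by (intro add_mono mult_left_mono order.refl) auto
  finally show "ln (T / k') \<le> (\<beta> + \<bar>1 - \<beta>\<bar> * \<bar>ln T\<bar> + \<bar>ln c\<bar>) * ln (T / k)"
    by (simp add: algebra_simps)
qed

context space_time_discretization
begin

lemma log_sum_bound:
  assumes j: "j \<in> {1..M}" and k: "0 < k" "\<And>m. m \<in> {1..M} \<Longrightarrow> k \<le> time_step t m"
  shows "(\<Sum>m=j..M. (t m - t (m - 1)) / (t m - t (j - 1))) \<le> 1 + ln (T / k)"
proof -
  note cb = cell_bounds[OF j]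
  have tM: "t M = T" "\<And>m. m < M \<Longrightarrow> t m < t (Suc m)" using mesh by (auto simp: time_mesh_def)
  have "(\<Sum>m=j..M. (t m - t (m - 1)) / (t m - t (j - 1))) \<le> 1 + ln ((t M - t (j - 1)) / (t j - t (j - 1)))"
    using log_sum_le[of M t j] tM j by auto
  also have "ln ((t M - t (j - 1)) / (t j - t (j - 1))) \<le> ln (T / k)"
  proof (subst ln_le_cancel_iff)
    show "(t M - t (j - 1)) / (t j - t (j - 1)) \<le> T / k"
      using cb k(2)[OF j] k(1) T tM(1) by (intro frac_le) (auto simp: time_step_def)
  qed (use cb k T tM in auto)
  finally show ?thesis by simp
qed

text \<open>Instantiates the time stepping scheme. The sources are the load vectors, with the projection of the
  initial value added to the first one; the factor 2 accounts for the jumps.\<close>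

theorem discrete_maximal_regularity:
  assumes dini: "dini_modulus T \<omega>" and \<kappa>: "\<kappa> > 0"
    and ratio: "\<And>m. m \<in> {1..M - 1} \<Longrightarrow> inverse \<kappa> \<le> time_step t m / time_step t (m + 1) \<and>
        time_step t m / time_step t (m + 1) \<le> \<kappa>"
    and k: "0 < k" "\<And>m. m \<in> {1..M} \<Longrightarrow> k \<le> time_step t m"
    and f: "f \<in> Linf_L2 \<Omega> {0<..<T}" and u0: "u0 \<in> L2 \<Omega>"
    and u: "fully_discrete_solution \<Omega> T a M t V f u0 u"
  defines "K \<equiv> (real CARD('d))\<^sup>2 * sqrt ((1 + \<kappa>) / \<alpha>)
      * (\<integral>s. \<omega> s * s powr (- (3/2)) \<partial>lebesgue_on {0<..<T}) * sqrt (T / \<alpha>)"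
  shows "(\<Sum>m = 1..M. time_step t m * L2_norm \<Omega> (A_disc_avg \<Omega> a V t m (u (t m)))
            + L2_norm \<Omega> (jump \<Omega> t V u0 u (m - 1)))
     \<le> (2 * (1 + ln (T / k) + K) + 1) * (L1_L2_norm \<Omega> {0<..<T} f + L2_norm \<Omega> u0)"
proof -
  interpret L: psd_form "L2 \<Omega>" "L2_inner \<Omega>" by (rule L2_inner_psd)
  have VL: "\<phi> \<in> V \<Longrightarrow> \<phi> \<in> L2 \<Omega>" for \<phi> using V_L2 by auto
  have tmesh: "t 0 = 0" "t M = T" "\<And>m. m < M \<Longrightarrow> t m < t (Suc m)" using mesh by (auto simp: time_mesh_def)
  have M1: "1 \<in> {1..M}" using tmesh T by (cases "M = 0") auto
  have norm_nn: "L2_norm \<Omega> w \<ge> 0" if "w \<in> V" for w using nonneg[OF that] by (simp add: L2_norm_def)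
  have ts: "time_step t m > 0" if "m \<in> {1..M}" for m using cell_bounds[OF that] by (simp add: time_step_def)
  have uV: "u (t m) \<in> V" if "m \<in> {1..M}" for m using u that by (auto simp: fully_discrete_solution_def X_space_def)
  define P where "P = L2_proj \<Omega> V u0"
  have P: "P \<in> V" "\<And>\<phi>. \<phi> \<in> V \<Longrightarrow> L2_inner \<Omega> P \<phi> = L2_inner \<Omega> u0 \<phi>" "L2_norm \<Omega> P \<le> L2_norm \<Omega> u0"
    unfolding P_def using L2_proj_props[OF u0] by auto
  obtain F0 where F0: "\<And>m. F0 m \<in> V" "\<And>m \<phi>. \<phi> \<in> V \<Longrightarrow> L2_inner \<Omega> (F0 m) \<phi> = load f m \<phi>"
    "\<And>m. L2_norm \<Omega> (F0 m) \<le> cell_norm f m"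
    using load_representation[OF f] by metis
  define F where "F m = F0 m + (if m = 1 then P else 0)" for m
  define v where "v m = (if m \<in> {1..M} then u (t m) else 0)" for m
  have vV: "v m \<in> V" and FV: "F m \<in> V" for m using uV F0(1) P(1) by (auto simp: v_def F_def)
  define k' where "k' m = t m - t (m - 1)" for m
  have scheme: "v m + k' m *\<^sub>R rep (avg_form m) (v m) = v (m - 1) + F m" if m: "m \<in> {1..M}" for m
  proof (rule ext)
    note psd = avg_form_psd[OF m]
    show "v m + k' m *\<^sub>R rep (avg_form m) (v m) \<in> V" "v (m - 1) + F m \<in> V"
      using vV FV rep_mem[OF psd] by auto
    fix \<phi> assume \<phi>: "\<phi> \<in> V"
    have "L2_inner \<Omega> (v m + k' m *\<^sub>R rep (avg_form m) (v m)) \<phi>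
        = L2_inner \<Omega> (u (t m)) \<phi> + time_step t m * avg_form m (u (t m)) \<phi>"
      using \<phi> m vV uV rep[OF psd] by (simp add: bilinear v_def k'_def time_step_def)
    also have "\<dots> = L2_inner \<Omega> (v (m - 1)) \<phi> + L2_inner \<Omega> (F m) \<phi>"
    proof (cases "m = 1")
      case True
      then show ?thesis using tested_scheme[OF u m \<phi>] F0 P \<phi>
        by (simp add: v_def F_def bilinear zero_left)
    next
      case False
      then have "m - 1 \<in> {1..M}" using m by auto
      then show ?thesis using False tested_scheme[OF u m \<phi>] F0 \<phi> uV m
        by (simp add: v_def F_def bilinear)
    qed
    also have "\<dots> = L2_inner \<Omega> (v (m - 1) + F m) \<phi>" using \<phi> vV FV by (simp add: bilinear)
    finally show "L2_inner \<Omega> (v m + k' m *\<^sub>R rep (avg_form m) (v m)) \<phi> = L2_inner \<Omega> (v (m - 1) + F m) \<phi>" .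
  qed
  define G where "G = (\<integral>s. \<omega> s * s powr (- (3/2)) \<partial>lebesgue_on {0<..<T})"
  have G0: "G \<ge> 0"
    unfolding G_def using \<omega>_nonneg by (intro Bochner_Integration.integral_nonneg) auto
  interpret ts: time_stepping V "L2_inner \<Omega>" M t T \<kappa> \<alpha> "(real CARD('d))\<^sup>2" \<omega> avg_form "grad_norm \<Omega>" v F k'
  proof (rule time_stepping.intro[OF fd_inner_axioms], rule time_stepping_axioms.intro)
    show "t 0 = 0" "t M = T" by (rule tmesh)+
    show "t m < t (Suc m)" if "m < M" for m using that by (rule tmesh)
    show "k' m = t m - t (m - 1)" for m by (simp add: k'_def)
    show "k' m \<le> \<kappa> * k' (Suc m) \<and> k' (Suc m) \<le> \<kappa> * k' m" if "1 \<le> m" "m < M" for m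
      using ratio[of m] ts[of m] ts[of "m + 1"] that \<kappa> by (auto simp: time_step_def k'_def field_simps)
    show "\<kappa> > 0" "\<alpha> > 0" "(real CARD('d))\<^sup>2 \<ge> 0" using \<kappa> \<alpha> by auto
    show "s \<in> {0..T} \<Longrightarrow> \<omega> s \<ge> 0" for s by (rule \<omega>_nonneg)
    show "m \<in> {1..M} \<Longrightarrow> psd_form V (avg_form m)" for m by (rule avg_form_psd)
    show "grad_norm \<Omega> x \<ge> 0" for x by (rule grad_norm_nonneg)
    show "m \<in> {1..M} \<Longrightarrow> x \<in> V \<Longrightarrow> \<alpha> * (grad_norm \<Omega> x)\<^sup>2 \<le> avg_form m x x" for m x
      by (rule avg_form_coercive)
    show "\<bar>avg_form m x y - avg_form j x y\<bar>
        \<le> (real CARD('d))\<^sup>2 * \<omega> (t m - t (j - 1)) * grad_norm \<Omega> x * grad_norm \<Omega> y"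
      if "1 \<le> j" "j < m" "m \<le> M" "x \<in> V" "y \<in> V" for j m x y
      using that by (rule avg_form_modulus)
    show "v 0 = 0" by (simp add: v_def)
    show "m \<in> {1..M} \<Longrightarrow> v m + k' m *\<^sub>R rep (avg_form m) (v m) = v (m - 1) + F m" for m
      by (rule scheme)
  qed (auto intro: vV FV)
  have L: "(\<Sum>m=j..M. k' m / (t m - t (j - 1))) \<le> 1 + ln (T / k)" if "j \<in> {1..M}" for j
    unfolding k'_def using log_sum_bound[OF that k] by simp
  have G: "(\<Sum>m=Suc j..M. k' m * (\<omega> (t m - t (j - 1)) * (t m - t (j - 1)) powr (- 3/2))) \<le> G"
    if j: "j \<in> {1..M}" for j
  proof -
    let ?a = "\<lambda>i. t i - t (j - 1)" and ?g = "\<lambda>s. \<omega> s * s powr (- (3/2))"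
    note cb = cell_bounds[OF j]
    have g: "?g y \<le> ?g x" if "0 < x" "x \<le> y" "y \<le> T" for x y
    proof -
      have "\<omega> y / y powr (3/2) \<le> \<omega> x / x powr (3/2)"
      proof -
        have "monotone_on {0<..T} (\<le>) (\<ge>) (\<lambda>t. \<omega> t / t powr (3/2))"
          using dini by (simp only: dini_modulus_def)
        then show ?thesis using that by (elim monotone_onD) auto
      qed
      then show ?thesis by (simp only: powr_minus divide_inverse)
    qed
    have "(\<Sum>m=Suc j..M. (?a m - ?a (m - 1)) * ?g (?a m)) \<le> (\<integral>x. ?g x \<partial>lebesgue_on {0<..<T})"
    proof (rule right_endpoint_sum_le_integral[OF _ _ _ _ _ g])
      show "?a m \<le> ?a (Suc m)" if "m < M" for m using tmesh(3)[OF that] by simp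
      show "0 \<le> ?a j" "?a M \<le> T" "j \<le> M" using cb tmesh j by auto
      show "0 \<le> ?g x" if "x \<in> {0<..T}" for x using that \<omega>_nonneg by auto
      show "integrable (lebesgue_on {0<..<T}) ?g" using dini by (simp add: dini_modulus_def)
    qed
    then show ?thesis by (simp add: G_def k'_def)
  qed
  have S: "ts.S \<le> L1_L2_norm \<Omega> {0<..<T} f + L2_norm \<Omega> u0"
  proof -
    have "ts.S \<le> (\<Sum>m=1..M. cell_norm f m + (if m = 1 then L2_norm \<Omega> u0 else 0))"
      unfolding ts.S_def
    proof (rule sum_mono)
      fix m
      have "nrm (F m) \<le> nrm (F0 m) + nrm (if m = 1 then P else 0)"
        unfolding F_def using F0(1) P(1) by (intro triangle) auto
      also have "\<dots> \<le> cell_norm f m + (if m = 1 then L2_norm \<Omega> u0 else 0)"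
        using F0(3)[of m] P(3) by (intro add_mono) (auto simp: L2_norm_def zero_left)
      finally show "nrm (F m) \<le> cell_norm f m + (if m = 1 then L2_norm \<Omega> u0 else 0)" .
    qed
    also have "\<dots> = (\<Sum>m=1..M. cell_norm f m) + L2_norm \<Omega> u0"
      using M1 by (simp add: sum.distrib)
    finally show ?thesis using sum_cell_norm[OF f] by linarith
  qed
  define R where "R = (\<Sum>m=1..M. k' m * nrm (rep (avg_form m) (v m)))"
  have R: "R \<le> (1 + ln (T / k) + K) * ts.S"
    unfolding R_def K_def G_def[symmetric] using L G G0 by (rule ts.maximal_regularity)
  have AR: "time_step t m * L2_norm \<Omega> (A_disc_avg \<Omega> a V t m (u (t m))) = k' m * nrm (rep (avg_form m) (v m))"
    if m: "m \<in> {1..M}" for m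
    using m by (simp add: A_disc_avg_eq[OF m uV[OF m]] L2_norm_def v_def k'_def time_step_def)
  have J: "L2_norm \<Omega> (jump \<Omega> t V u0 u (m - 1)) \<le> cell_norm f m + k' m * nrm (rep (avg_form m) (v m))"
    if m: "m \<in> {1..M}" for m
  proof -
    let ?A = "rep (avg_form m) (v m)"
    have AV: "?A \<in> V" using rep_mem[OF avg_form_psd[OF m] vV] .
    have jump: "jump \<Omega> t V u0 u (m - 1) = F0 m + (- k' m) *\<^sub>R ?A"
    proof (cases "m = 1")
      case True
      have "jump \<Omega> t V u0 u (m - 1) = v 1 - P"
        using True M1 by (auto simp: jump_def P_def v_def)
      also have "\<dots> = F0 1 + (- k' 1) *\<^sub>R rep (avg_form 1) (v 1)"
        using scheme[OF M1] by (simp add: F_def v_def algebra_simps)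
      finally show ?thesis using True by simp
    next
      case False
      then have m1: "m - 1 \<in> {1..M}" "m - 1 \<noteq> 0" using m by auto
      have "jump \<Omega> t V u0 u (m - 1) = v m - v (m - 1)"
        using m m1 by (auto simp: jump_def v_def)
      also have "\<dots> = F0 m + (- k' m) *\<^sub>R ?A"
        using scheme[OF m] False by (simp add: F_def algebra_simps)
      finally show ?thesis .
    qed
    have "L2_norm \<Omega> (jump \<Omega> t V u0 u (m - 1)) \<le> nrm (F0 m) + nrm ((- k' m) *\<^sub>R ?A)"
      unfolding jump L2_norm_def by (intro triangle mem(3) F0(1) AV)
    also have "\<dots> = L2_norm \<Omega> (F0 m) + k' m * nrm ?A"
      using ts[OF m] by (subst norm_scale[OF AV]) (simp add: L2_norm_def k'_def time_step_def)
    finally show ?thesis using F0(3)[of m] by linarith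
  qed
  have "(\<Sum>m = 1..M. time_step t m * L2_norm \<Omega> (A_disc_avg \<Omega> a V t m (u (t m)))
            + L2_norm \<Omega> (jump \<Omega> t V u0 u (m - 1)))
      \<le> (\<Sum>m = 1..M. k' m * nrm (rep (avg_form m) (v m)) + (cell_norm f m + k' m * nrm (rep (avg_form m) (v m))))"
    by (intro sum_mono add_mono J) (auto simp: AR)
  also have "\<dots> = 2 * R + (\<Sum>m=1..M. cell_norm f m)" by (simp add: R_def sum.distrib sum_distrib_left)
  also have "\<dots> \<le> 2 * ((1 + ln (T / k) + K) * (L1_L2_norm \<Omega> {0<..<T} f + L2_norm \<Omega> u0))
      + (L1_L2_norm \<Omega> {0<..<T} f + L2_norm \<Omega> u0)"
  proof (intro add_mono mult_left_mono order_trans[OF R] S)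
    have "k \<le> T" using k(2)[OF M1] cell_bounds[OF M1] by (simp add: time_step_def)
    then have "0 \<le> ln (T / k)" using k(1) by simp
    moreover have "0 \<le> K" unfolding K_def G_def[symmetric] using G0 \<kappa> \<alpha> T by simp
    ultimately show "0 \<le> 1 + ln (T / k) + K" by simp
    show "(\<Sum>m=1..M. cell_norm f m) \<le> L1_L2_norm \<Omega> {0<..<T} f + L2_norm \<Omega> u0"
      using sum_cell_norm[OF f] P(3) norm_nn[OF P(1)] by linarith
  qed simp
  finally show ?thesis by (simp add: algebra_simps)
qed

end

theorem theorem3p16:
  fixes \<Omega> :: "(real^'d) set"
    and T \<alpha> c \<beta> \<kappa> :: real
    and \<omega> :: "real \<Rightarrow> real"
    and a :: "'d \<Rightarrow> 'd \<Rightarrow> real \<Rightarrow> real^'d \<Rightarrow> real"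
  assumes "polyhedral_lipschitz_domain \<Omega>"
    and "T > 0" and "\<alpha> > 0"
    and "dini_modulus T \<omega>"
    and "admissible_coeffs \<Omega> T \<alpha> \<omega> a"
    and "c > 0" and "\<beta> > 0" and "\<kappa> > 0"
  shows "\<exists>\<mu> > 0. \<exists>\<delta>\<^sub>0 > 0. \<exists>C > 0.
    \<forall>(r::nat) M t \<T>.
      r \<ge> 1 \<longrightarrow>
      admissible_mesh T c \<beta> \<kappa> M t \<longrightarrow>
      max_step M t - min_step M t \<le> \<delta>\<^sub>0 \<longrightarrow>
      conformal_triangulation \<Omega> \<T> \<longrightarrow>
      (\<forall>f u\<^sub>0 u.
        f \<in> Linf_L2 \<Omega> {0<..<T} \<longrightarrow>
        u\<^sub>0 \<in> H10 \<Omega> \<longrightarrow>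
        (\<forall>m \<in> {1..M}. functional_in_L2 \<Omega> (A_avg \<Omega> a t m u\<^sub>0)) \<longrightarrow>
        fully_discrete_solution \<Omega> T a M t (fe_space \<Omega> r \<T>) f u\<^sub>0 u \<longrightarrow>
        (\<Sum>m = 1..M.
            time_step t m * L2_norm \<Omega> (A_disc_avg \<Omega> a (fe_space \<Omega> r \<T>) t m (u (t m)))
            + L2_norm \<Omega> (jump \<Omega> t (fe_space \<Omega> r \<T>) u\<^sub>0 u (m - 1)))
        \<le> C * exp (\<mu> * T) * ln (T / max_step M t)
            * (L1_L2_norm \<Omega> {0<..<T} f + L2_norm \<Omega> u\<^sub>0))"
proof -
  have \<Omega>: "open \<Omega>" "bounded \<Omega>" using assms(1) by (auto simp: polyhedral_lipschitz_domain_def)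
  obtain B where B: "\<And>s. s \<in> {0..T} \<Longrightarrow> regular_slice \<Omega> \<alpha> B a s"
    using regular_slices[OF \<Omega>(1) assms(2,5)] by blast
  have \<omega>: "\<And>s. s \<in> {0..T} \<Longrightarrow> \<omega> s \<ge> 0" "mono_on {0..T} \<omega>"
    using assms(4) by (auto simp: dini_modulus_def)
  define K where "K = (real CARD('d))\<^sup>2 * sqrt ((1 + \<kappa>) / \<alpha>)
      * (\<integral>s. \<omega> s * s powr (- (3/2)) \<partial>lebesgue_on {0<..<T}) * sqrt (T / \<alpha>)"
  have K: "K \<ge> 0"
    unfolding K_def using assms \<omega>(1)
    by (intro mult_nonneg_nonneg Bochner_Integration.integral_nonneg) auto
  define Q where "Q = \<beta> + \<bar>1 - \<beta>\<bar> * \<bar>ln T\<bar> + \<bar>ln c\<bar>"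
  define C where "C = 2 * (1 + Q + K) + 1"
  have Q: "Q \<ge> 0" using assms by (simp add: Q_def)
  have C: "C > 0" using Q K by (simp add: C_def)
  have main: "(\<Sum>m = 1..M.
            time_step t m * L2_norm \<Omega> (A_disc_avg \<Omega> a (fe_space \<Omega> r \<T>) t m (u (t m)))
            + L2_norm \<Omega> (jump \<Omega> t (fe_space \<Omega> r \<T>) u\<^sub>0 u (m - 1)))
        \<le> C * exp (1 * T) * ln (T / max_step M t)
            * (L1_L2_norm \<Omega> {0<..<T} f + L2_norm \<Omega> u\<^sub>0)"
    if mesh: "admissible_mesh T c \<beta> \<kappa> M t" and tri: "conformal_triangulation \<Omega> \<T>"
      and f: "f \<in> Linf_L2 \<Omega> {0<..<T}" and u0: "u\<^sub>0 \<in> H10 \<Omega>"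
      and u: "fully_discrete_solution \<Omega> T a M t (fe_space \<Omega> r \<T>) f u\<^sub>0 u"
    for r M t \<T> f u\<^sub>0 u
  proof -
    interpret V: fd_inner "fe_space \<Omega> r \<T>" "L2_inner \<Omega>"
      by (rule fe_space_fd_inner[OF \<Omega> tri])
    interpret D: space_time_discretization "fe_space \<Omega> r \<T>" \<Omega> T \<alpha> B \<omega> a M t
    proof
      show "time_mesh T M t" using mesh by (simp add: admissible_mesh_def)
      show "fe_space \<Omega> r \<T> \<subseteq> H1 \<Omega>" by (rule fe_space_H1[OF \<Omega> tri])
    qed (use assms \<Omega> \<omega> B in \<open>auto simp: mono_on_def\<close>)
    have u0L: "u\<^sub>0 \<in> L2 \<Omega>" using u0 by (simp add: H10_def H1_def)
    have M: "{1..M} \<noteq> {}" using mesh assms(2) by (cases "M = 0") (auto simp: admissible_mesh_def time_mesh_def)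
    have pos: "time_step t m > 0" if "m \<in> {1..M}" for m
      using D.cell_bounds[OF that] by (simp add: time_step_def)
    have min: "min_step M t \<le> time_step t m" if "m \<in> {1..M}" for m
      unfolding min_step_def using that by (intro Min_le) auto
    have kpos: "0 < min_step M t" "0 < max_step M t"
      unfolding min_step_def max_step_def using M pos by (auto simp: Max_gr_iff)
    have lower: "c * max_step M t powr \<beta> \<le> min_step M t" "max_step M t \<le> T / 4"
      using mesh by (auto simp: admissible_mesh_def)
    let ?l = "ln (T / max_step M t)" and ?N = "L1_L2_norm \<Omega> {0<..<T} f + L2_norm \<Omega> u\<^sub>0"
    have l: "1 \<le> ?l" "ln (T / min_step M t) \<le> Q * ?l"
      unfolding Q_def using assms kpos lower by (intro ln_ratio_min_step; simp)+
    have N: "0 \<le> ?N"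
      by (auto simp: L1_L2_norm_def L2_norm_def L2_inner_def intro!: add_nonneg_nonneg Bochner_Integration.integral_nonneg)
    have "(\<Sum>m = 1..M.
            time_step t m * L2_norm \<Omega> (A_disc_avg \<Omega> a (fe_space \<Omega> r \<T>) t m (u (t m)))
            + L2_norm \<Omega> (jump \<Omega> t (fe_space \<Omega> r \<T>) u\<^sub>0 u (m - 1)))
        \<le> (2 * (1 + ln (T / min_step M t) + K) + 1) * ?N"
      unfolding K_def
      by (rule D.discrete_maximal_regularity[OF assms(4,8) _ kpos(1) min f u0L u])
        (use mesh in \<open>auto simp: admissible_mesh_def\<close>)
    also have "\<dots> \<le> (C * exp (1 * T) * ?l) * ?N"
    proof (rule mult_right_mono[OF _ N])
      have "2 * (1 + ln (T / min_step M t) + K) + 1 \<le> 2 * (1 * ?l + Q * ?l + K * ?l) + 1 * ?l"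
        using l K mult_left_mono[OF l(1) K] by simp
      also have "\<dots> = C * 1 * ?l" by (simp add: C_def algebra_simps)
      also have "\<dots> \<le> C * exp (1 * T) * ?l"
        using C l(1) assms(2) by (intro mult_right_mono mult_left_mono) auto
      finally show "2 * (1 + ln (T / min_step M t) + K) + 1 \<le> C * exp (1 * T) * ?l" .
    qed
    finally show ?thesis .
  qed
  show ?thesis
    by (rule exI[of _ 1], rule conjI, simp, rule exI[of _ 1], rule conjI, simp, rule exI[of _ C], rule conjI, rule C)
      (use main in blast)
qed

end
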